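(* Let $k=r+2\geq 4$, let $a_2\in E$ with $0<v(a_2)<1$, and let $\alpha':=\frac{a_2^2-2r^2}{2a_2}$, $\tau':=v(\alpha')$, $t:=v(r-1)$. Let $q:\mathcal{I}(V_r)\to\mathcal{I}(V_0)$ be the map induced by the $K$-linear surjection $V_r\to V_0$, $\sum_{0\leq j\leq r}c_jX^{r-j}Y^j\mapsto\sum_{1\leq j\leq r-1}c_j$. Then: (1) if $\tau'<t$, there is a $G$-equivariant map $\mathcal{I}(V_0)/T\mathcal{I}(V_0)\to\bar\Theta$ whose composite with $\mathcal{I}(V_r)\xrightarrow{q}\mathcal{I}(V_0)\to\mathcal{I}(V_0)/T\mathcal{I}(V_0)$ equals $P$; (2) if $\tau'\geq t$, there is a $G$-equivariant map $\mathcal{I}(V_0)/(T^2-cT+1)\mathcal{I}(V_0)\to\bar\Theta$ whose composite with $\mathcal{I}(V_r)\xrightarrow{q}\mathcal{I}(V_0)\to\mathcal{I}(V_0)/(T^2-cT+1)\mathcal{I}(V_0)$ equals $P$, where $c=\overline{\alpha'/(r-1)}\in\bar{\mathbb{F}}_2$.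
   Context: $E$ is a finite extension of $\mathbb{Q}_2$; $v$ is the $2$-adic valuation with $v(2)=1$; bars denote reduction modulo the maximal ideal of $\bar{\mathbb{Z}}_2$. $G=\mathrm{GL}_2(\mathbb{Q}_2)$, $K=\mathrm{GL}_2(\mathbb{Z}_2)$, with centre $\mathbb{Q}_2^\times$ of $G$. For a $\mathbb{Z}_2$-algebra $R$, $\mathrm{Sym}^rR^2$ is the space of homogeneous degree-$r$ polynomials in $X,Y$ over $R$ with $K$ acting by $\begin{pmatrix}a&b\\c&d\end{pmatrix}\cdot f(X,Y)=f(aX+cY,bX+dY)$, extended to $K\mathbb{Q}_2^\times$ by letting $\mathrm{diag}(2,2)$ act trivially; $V_r:=\mathrm{Sym}^r\bar{\mathbb{F}}_2^2$. $\mathcal{I}$ denotes compact induction $\mathrm{ind}_{K\mathbb{Q}_2^\times}^G$; for $g\in G$, $v\in\mathrm{Sym}^rR^2$, $[g,v]$ is the function supported on $K\mathbb{Q}_2^\times g^{-1}$ with $[g,v](g')=(g'g)\cdot v$. The Hecke operator $T$ on $\mathcal{I}(\mathrm{Sym}^rR^2)$ is the $G$-linear map $T[g,v(X,Y)]=\sum_{\mu\in\{0,1\}}\left[g\begin{pmatrix}2&\mu\\0&1\end{pmatrix},v(X,2Y-\mu X)\right]+\left[g\begin{pmatrix}1&0\\0&2\end{pmatrix},v(2X,Y)\right]$. Let $\Pi_{k,a_2}=\mathcal{I}(\mathrm{Sym}^{r}\bar{\mathbb{Q}}_2^2)/(T-a_2)$, let $\Theta=\Theta_{k,a_2}$ be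 the image of $\mathcal{I}(\mathrm{Sym}^{r}\bar{\mathbb{Z}}_2^2)$ in $\Pi_{k,a_2}$, $\bar\Theta:=\Theta\otimes_{\bar{\mathbb{Z}}_2}\bar{\mathbb{F}}_2$, and let $P:\mathcal{I}(V_r)\to\bar\Theta$ be the natural surjection. *)

theory Defs
  imports
    "HOL-Analysis.Analysis"
    "HOL-Algebra.Algebraic_Closure_Type"
    "HOL-Computational_Algebra.Computational_Algebra"
    "HOL-Library.Function_Algebras"
    "HOL-Library.Set_Algebras"
begin

section \<open>The fields\<close>

text \<open>The ring of 2-adic integers as the inverse limit of the rings Z/2^n, an element of Z/2^n
  being given by its representative in {0..<2^n}.\<close>

typedef z2 = "{x :: nat \<Rightarrow> int. \<forall>n. x n = x (Suc n) mod 2 ^ n}"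
proof
  show "(\<lambda>_. 0) \<in> {x :: nat \<Rightarrow> int. \<forall>n. x n = x (Suc n) mod 2 ^ n}" by simp
qed

setup_lifting type_definition_z2

lemma mod_pow2_Suc: "((a :: int) mod 2 ^ Suc n) mod 2 ^ n = a mod 2 ^ n"
  by (rule mod_mod_cancel) (simp add: le_imp_power_dvd)

instantiation z2 :: comm_ring_1
begin

lift_definition zero_z2 :: z2 is "\<lambda>_. 0" by simp

lift_definition one_z2 :: z2 is "\<lambda>n. 1 mod 2 ^ n"
  using mod_pow2_Suc[of 1] by metis

lift_definition plus_z2 :: "z2 \<Rightarrow> z2 \<Rightarrow> z2" is "\<lambda>x y n. (x n + y n) mod 2 ^ n"
  unfolding mod_pow2_Suc by (metis mod_add_eq)

lift_definition uminus_z2 :: "z2 \<Rightarrow> z2" is "\<lambda>x n. (- x n) mod 2 ^ n"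
  unfolding mod_pow2_Suc by (metis mod_minus_eq)

lift_definition minus_z2 :: "z2 \<Rightarrow> z2 \<Rightarrow> z2" is "\<lambda>x y n. (x n - y n) mod 2 ^ n"
  unfolding mod_pow2_Suc by (metis mod_diff_eq)

lift_definition times_z2 :: "z2 \<Rightarrow> z2 \<Rightarrow> z2" is "\<lambda>x y n. (x n * y n) mod 2 ^ n"
  unfolding mod_pow2_Suc by (metis mod_mult_eq)

lemma Rep_z2_compat: "Rep_z2 a n = Rep_z2 a (Suc n) mod 2 ^ n"
  using Rep_z2[of a] by blast

lemma Rep_z2_mod: "Rep_z2 a n mod 2 ^ n = Rep_z2 a n"
  using Rep_z2_compat[of a n] by (metis mod_mod_trivial)

lemma z2_eqI: "(\<And>n. Rep_z2 a n = Rep_z2 b n) \<Longrightarrow> a = b"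
  by (simp add: Rep_z2_inject[symmetric] fun_eq_iff)

lemmas Rep_z2_ops = zero_z2.rep_eq one_z2.rep_eq plus_z2.rep_eq uminus_z2.rep_eq
  minus_z2.rep_eq times_z2.rep_eq

instance
proof
  fix a b c :: z2
  show "a + b + c = a + (b + c)"
    by (rule z2_eqI) (simp add: Rep_z2_ops mod_simps add.assoc)
  show "a + b = b + a"
    by (rule z2_eqI) (simp add: Rep_z2_ops add.commute)
  show "0 + a = a"
    by (rule z2_eqI) (simp add: Rep_z2_ops Rep_z2_mod)
  show "- a + a = 0"
    by (rule z2_eqI) (simp add: Rep_z2_ops mod_simps)
  show "a - b = a + - b"
    by (rule z2_eqI) (simp add: Rep_z2_ops mod_simps)
  show "a * b * c = a * (b * c)"
    by (rule z2_eqI) (simp add: Rep_z2_ops mod_simps mult.assoc)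
  show "a * b = b * a"
    by (rule z2_eqI) (simp add: Rep_z2_ops mult.commute)
  show "1 * a = a"
  proof (rule z2_eqI)
    fix n
    have "Rep_z2 (1 * a) n = (1 mod 2 ^ n) * Rep_z2 a n mod 2 ^ n"
      by (simp only: Rep_z2_ops)
    also have "\<dots> = 1 * Rep_z2 a n mod 2 ^ n" by (rule mod_mult_left_eq)
    finally show "Rep_z2 (1 * a) n = Rep_z2 a n" by (simp add: Rep_z2_mod)
  qed
  show "(a + b) * c = a * c + b * c"
    by (rule z2_eqI) (simp add: Rep_z2_ops mod_simps distrib_right)
  have "Rep_z2 0 1 \<noteq> Rep_z2 1 1" by (simp add: Rep_z2_ops)
  thus "(0 :: z2) \<noteq> 1" by metis
qed

end

lemma Rep_z2_compat_add: "Rep_z2 a (k + d) mod 2 ^ k = Rep_z2 a k"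
proof (induction d)
  case 0
  show ?case by (simp add: Rep_z2_mod)
next
  case (Suc d)
  have "Rep_z2 a (k + d) mod 2 ^ k = Rep_z2 a (Suc (k + d)) mod 2 ^ (k + d) mod 2 ^ k"
    by (simp only: Rep_z2_compat[symmetric])
  also have "\<dots> = Rep_z2 a (Suc (k + d)) mod 2 ^ k"
    by (rule mod_mod_cancel) (simp add: le_imp_power_dvd)
  finally show ?case using Suc by simp
qed

instance z2 :: idom
proof
  fix a b :: z2
  assume "a \<noteq> 0" "b \<noteq> 0"
  then obtain m n where mn: "Rep_z2 a m \<noteq> 0" "Rep_z2 b n \<noteq> 0"
    by (metis z2_eqI zero_z2.rep_eq)
  have ndvd: "\<not> 2 ^ m dvd Rep_z2 a (m + n)" "\<not> 2 ^ n dvd Rep_z2 b (m + n)"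
    using mn Rep_z2_compat_add[of a m n] Rep_z2_compat_add[of b n m]
    by (simp_all add: dvd_eq_mod_eq_0 add.commute)
  have "\<not> 2 ^ (m + n) dvd Rep_z2 a (m + n) * Rep_z2 b (m + n)"
  proof
    assume dvd: "2 ^ (m + n) dvd Rep_z2 a (m + n) * Rep_z2 b (m + n)"
    have "prime_elem (2 :: int)" by simp
    from prime_elem_power_dvd_prod[OF dvd this]
    obtain i j where ij: "i + j = m + n" "2 ^ i dvd Rep_z2 a (m + n)" "2 ^ j dvd Rep_z2 b (m + n)"
      by blast
    hence "m \<le> i \<or> n \<le> j" by arith
    thus False using ij ndvd power_le_dvd by blast
  qed
  hence "Rep_z2 (a * b) (m + n) \<noteq> 0"
    by (simp add: times_z2.rep_eq dvd_eq_mod_eq_0)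
  thus "a * b \<noteq> 0" by (auto simp: zero_z2.rep_eq)
qed

type_synonym q2 = "z2 fract"

type_synonym qbar2 = "q2 alg_closure"

definition z2_q2 :: "z2 \<Rightarrow> q2" where
  "z2_q2 z = Fract z 1"

definition z2_qbar2 :: "z2 \<Rightarrow> qbar2" where
  "z2_qbar2 z = to_ac (z2_q2 z)"

text \<open>The 2-adic valuation on the algebraic closure of the 2-adic field, with value group written
  additively: the real-valued valuation extending the one of the 2-adic integers, for which a unit
  times 2^n has valuation n. This extension is unique.\<close>

definition two_adic_valuation :: "(qbar2 \<Rightarrow> ereal) \<Rightarrow> bool" where
  "two_adic_valuation v \<longleftrightarrow>
     (\<forall>x. v x \<noteq> -\<infinity>) \<and>
     (\<forall>x. v x = \<infinity> \<longleftrightarrow> x = 0) \<and>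
     (\<forall>x y. v (x * y) = v x + v y) \<and>
     (\<forall>x y. min (v x) (v y) \<le> v (x + y)) \<and>
     (\<forall>u n. u dvd 1 \<longrightarrow> v (z2_qbar2 (u * 2 ^ n)) = ereal (real n))"

definition zbar2 :: "(qbar2 \<Rightarrow> ereal) \<Rightarrow> qbar2 set" where
  "zbar2 v = {x. 0 \<le> v x}"

definition max_ideal :: "(qbar2 \<Rightarrow> ereal) \<Rightarrow> qbar2 set" where
  "max_ideal v = {x. 0 < v x}"

text \<open>The target of the reduction map is a model of the quotient of \<^term>\<open>zbar2 v\<close> by its
  maximal ideal. Values of the map outside \<^term>\<open>zbar2 v\<close> are irrelevant.\<close>

definition reduction_map :: "(qbar2 \<Rightarrow> ereal) \<Rightarrow> (qbar2 \<Rightarrow> 'f :: field) \<Rightarrow> bool" where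
  "reduction_map v red \<longleftrightarrow>
     red 1 = 1 \<and>
     (\<forall>x\<in>zbar2 v. \<forall>y\<in>zbar2 v. red (x + y) = red x + red y \<and> red (x * y) = red x * red y) \<and>
     red ` zbar2 v = UNIV \<and>
     (\<forall>x\<in>zbar2 v. red x = 0 \<longleftrightarrow> x \<in> max_ideal v)"

definition finite_extension_q2 :: "qbar2 set \<Rightarrow> bool" where
  "finite_extension_q2 E \<longleftrightarrow>
     range to_ac \<subseteq> E \<and>
     (\<forall>x\<in>E. \<forall>y\<in>E. x + y \<in> E \<and> x * y \<in> E) \<and>
     (\<forall>x\<in>E. - x \<in> E \<and> inverse x \<in> E) \<and>
     (\<exists>B. finite B \<and> E = {\<Sum>b\<in>B. to_ac (s b) * b | s. True})"


section \<open>Symmetric powers\<close>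

text \<open>Polynomials in X, Y over R are elements of R[X][Y]; \<open>coeff_XY f i j\<close> is the coefficient of
  X^i Y^j.\<close>

definition coeff_XY :: "'r :: zero poly poly \<Rightarrow> nat \<Rightarrow> nat \<Rightarrow> 'r" where
  "coeff_XY f i j = poly.coeff (poly.coeff f j) i"

definition CC :: "'r \<Rightarrow> 'r :: comm_ring_1 poly poly" where
  "CC c = [:[:c:]:]"

definition XX :: "'r :: comm_ring_1 poly poly" where
  "XX = [:[:0, 1:]:]"

definition YY :: "'r :: comm_ring_1 poly poly" where
  "YY = [:0, 1:]"

definition subst_XY :: "'r :: comm_ring_1 poly poly \<Rightarrow> 'r poly poly \<Rightarrow> 'r poly poly \<Rightarrow> 'r poly poly"
  where "subst_XY f P Q =
    (\<Sum>j\<le>Polynomial.degree f. \<Sum>i\<le>Polynomial.degree (poly.coeff f j).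
       CC (coeff_XY f i j) * P ^ i * Q ^ j)"

definition sym_pow :: "nat \<Rightarrow> 'r :: comm_ring_1 poly poly set" where
  "sym_pow r = {f. \<forall>i j. coeff_XY f i j \<noteq> 0 \<longrightarrow> i + j = r}"

definition sym_pow_zbar2 :: "(qbar2 \<Rightarrow> ereal) \<Rightarrow> nat \<Rightarrow> qbar2 poly poly set" where
  "sym_pow_zbar2 v r = {f \<in> sym_pow r. \<forall>i j. coeff_XY f i j \<in> zbar2 v}"


section \<open>Groups and compact induction\<close>

type_synonym mat_q2 = "q2 ^ 2 ^ 2"

definition mat22 :: "'a \<Rightarrow> 'a \<Rightarrow> 'a \<Rightarrow> 'a \<Rightarrow> 'a :: zero ^ 2 ^ 2" where
  "mat22 a b c d = vector [vector [a, b], vector [c, d]]"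

definition GL2_q2 :: "mat_q2 set" where
  "GL2_q2 = {g. invertible g}"

definition GL2_z2 :: "mat_q2 set" where
  "GL2_z2 = map_matrix z2_q2 ` {M. invertible M}"

definition KZ :: "mat_q2 set" where
  "KZ = {mat z ** k | z k. z \<noteq> 0 \<and> k \<in> GL2_z2}"

text \<open>Every element of \<^const>\<open>KZ\<close> is uniquely 2^n times the image of an invertible matrix over the
  2-adic integers. As the scalar matrix 2 acts trivially, it acts through that matrix.\<close>

definition KZ_part :: "mat_q2 \<Rightarrow> z2 ^ 2 ^ 2" where
  "KZ_part h = (THE M. invertible M \<and> (\<exists>n :: int. h = mat (2 powi n) ** map_matrix z2_q2 M))"

text \<open>Here \<^term>\<open>\<iota>\<close> is the structure map of the coefficient ring as an algebra over the 2-adic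
  integers.\<close>

definition act :: "(z2 \<Rightarrow> 'r) \<Rightarrow> mat_q2 \<Rightarrow> 'r :: comm_ring_1 poly poly \<Rightarrow> 'r poly poly" where
  "act \<iota> h f = (let M = KZ_part h;
                    a = CC (\<iota> (M $ 1 $ 1)); b = CC (\<iota> (M $ 1 $ 2));
                    c = CC (\<iota> (M $ 2 $ 1)); d = CC (\<iota> (M $ 2 $ 2))
                in subst_XY f (a * XX + c * YY) (b * XX + d * YY))"

text \<open>Compact induction of a subrepresentation \<^term>\<open>W\<close>. Functions on the group are total functions
  on all matrices that vanish at the non-invertible ones; compactness of the support modulo the
  open subgroup \<^const>\<open>KZ\<close> means that it lies in finitely many cosets.\<close>

definition cind :: "(z2 \<Rightarrow> 'r) \<Rightarrow> 'r poly poly set \<Rightarrow> (mat_q2 \<Rightarrow> 'r :: comm_ring_1 poly poly) set" where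
  "cind \<iota> W = {f.
     (\<forall>g. g \<notin> GL2_q2 \<longrightarrow> f g = 0) \<and>
     (\<forall>g\<in>GL2_q2. f g \<in> W) \<and>
     (\<forall>h\<in>KZ. \<forall>g\<in>GL2_q2. f (h ** g) = act \<iota> h (f g)) \<and>
     (\<exists>S. finite S \<and> (\<forall>g. f g \<noteq> 0 \<longrightarrow> (\<exists>h\<in>KZ. \<exists>s\<in>S. g = h ** s)))}"

definition trans :: "mat_q2 \<Rightarrow> (mat_q2 \<Rightarrow> 'w) \<Rightarrow> mat_q2 \<Rightarrow> 'w" where
  "trans g f = (\<lambda>x. f (x ** g))"

definition scal :: "'r \<Rightarrow> (mat_q2 \<Rightarrow> 'r :: comm_ring_1 poly poly) \<Rightarrow> mat_q2 \<Rightarrow> 'r poly poly" where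
  "scal c f = (\<lambda>x. CC c * f x)"

definition brk :: "(z2 \<Rightarrow> 'r) \<Rightarrow> mat_q2 \<Rightarrow> 'r :: comm_ring_1 poly poly \<Rightarrow> mat_q2 \<Rightarrow> 'r poly poly" where
  "brk \<iota> g w = (\<lambda>x. if x ** g \<in> KZ then act \<iota> (x ** g) w else 0)"


section \<open>The Hecke operator\<close>

definition is_hecke ::
  "(z2 \<Rightarrow> 'r) \<Rightarrow> nat \<Rightarrow>
   ((mat_q2 \<Rightarrow> 'r :: comm_ring_1 poly poly) \<Rightarrow> (mat_q2 \<Rightarrow> 'r poly poly)) \<Rightarrow> bool" where
  "is_hecke \<iota> r T \<longleftrightarrow>
     (\<forall>f\<in>cind \<iota> (sym_pow r). T f \<in> cind \<iota> (sym_pow r)) \<and>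
     (\<forall>f\<in>cind \<iota> (sym_pow r). \<forall>f'\<in>cind \<iota> (sym_pow r). T (f + f') = T f + T f') \<and>
     (\<forall>c. \<forall>f\<in>cind \<iota> (sym_pow r). T (scal c f) = scal c (T f)) \<and>
     (\<forall>g\<in>GL2_q2. \<forall>f\<in>cind \<iota> (sym_pow r). T (trans g f) = trans g (T f)) \<and>
     (\<forall>g\<in>GL2_q2. \<forall>w\<in>sym_pow r.
        T (brk \<iota> g w) =
          (\<Sum>\<mu>\<in>{0, 1 :: nat}.
             brk \<iota> (g ** mat22 2 (of_nat \<mu>) 0 1) (subst_XY w XX (2 * YY - of_nat \<mu> * XX)))
          + brk \<iota> (g ** mat22 1 0 0 2) (subst_XY w (2 * XX) YY))"

text \<open>The normalisation outside the induced representation makes the operator unique.\<close>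

definition hecke ::
  "(z2 \<Rightarrow> 'r) \<Rightarrow> nat \<Rightarrow> (mat_q2 \<Rightarrow> 'r :: comm_ring_1 poly poly) \<Rightarrow> (mat_q2 \<Rightarrow> 'r poly poly)" where
  "hecke \<iota> r = (THE T. is_hecke \<iota> r T \<and> (\<forall>f. f \<notin> cind \<iota> (sym_pow r) \<longrightarrow> T f = 0))"


section \<open>Quotients and the lattice\<close>

text \<open>The quotient of \<^term>\<open>A\<close> by a subgroup \<^term>\<open>N\<close> is its set of cosets. Cosets are added as sets,
  so that quotients can be iterated. An operator \<^term>\<open>s\<close> on \<^term>\<open>A\<close> stabilising \<^term>\<open>N\<close> acts on
  cosets by \<^term>\<open>quot_op N s\<close>; adding \<^term>\<open>N\<close> is needed as \<^term>\<open>s\<close> may fail to be surjective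
  (multiplication by 0).\<close>

definition quot :: "'b :: plus set \<Rightarrow> 'b set \<Rightarrow> 'b set set" where
  "quot A N = (\<lambda>x. x +o N) ` A"

definition quot_op :: "'b :: plus set \<Rightarrow> ('b \<Rightarrow> 'b) \<Rightarrow> 'b set \<Rightarrow> 'b set" where
  "quot_op N s u = s ` u + N"

type_synonym ind_qbar2 = "mat_q2 \<Rightarrow> qbar2 poly poly"

definition rel_sub :: "nat \<Rightarrow> qbar2 \<Rightarrow> ind_qbar2 set" where
  "rel_sub r a = (\<lambda>f. hecke z2_qbar2 r f - scal a f) ` cind z2_qbar2 (sym_pow r)"

definition Pi_rep :: "nat \<Rightarrow> qbar2 \<Rightarrow> ind_qbar2 set set" where
  "Pi_rep r a = quot (cind z2_qbar2 (sym_pow r)) (rel_sub r a)"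

definition lattice_ind :: "(qbar2 \<Rightarrow> ereal) \<Rightarrow> nat \<Rightarrow> ind_qbar2 set" where
  "lattice_ind v r = cind z2_qbar2 (sym_pow_zbar2 v r)"

text \<open>This is a subset of \<^term>\<open>Pi_rep r a\<close>.\<close>

definition Theta :: "(qbar2 \<Rightarrow> ereal) \<Rightarrow> nat \<Rightarrow> qbar2 \<Rightarrow> ind_qbar2 set set" where
  "Theta v r a = (\<lambda>f. f +o rel_sub r a) ` lattice_ind v r"

text \<open>The submodule of \<^term>\<open>Theta v r a\<close> generated by the products of elements of the maximal ideal
  with elements of \<^term>\<open>Theta v r a\<close>.\<close>

definition max_ideal_Theta :: "(qbar2 \<Rightarrow> ereal) \<Rightarrow> nat \<Rightarrow> qbar2 \<Rightarrow> ind_qbar2 set set" where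
  "max_ideal_Theta v r a =
     {(\<Sum>i<n. scal (x i) (f i)) +o rel_sub r a | (n :: nat) x f.
        \<forall>i<n. x i \<in> max_ideal v \<and> f i \<in> lattice_ind v r}"

text \<open>The tensor product of a module with the residue field is its quotient by the maximal ideal
  times the module.\<close>

definition Theta_bar :: "(qbar2 \<Rightarrow> ereal) \<Rightarrow> nat \<Rightarrow> qbar2 \<Rightarrow> ind_qbar2 set set set" where
  "Theta_bar v r a = quot (Theta v r a) (max_ideal_Theta v r a)"

definition Theta_bar_class ::
  "(qbar2 \<Rightarrow> ereal) \<Rightarrow> nat \<Rightarrow> qbar2 \<Rightarrow> ind_qbar2 \<Rightarrow> ind_qbar2 set set" where
  "Theta_bar_class v r a f = (f +o rel_sub r a) +o max_ideal_Theta v r a"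

definition Theta_bar_scal ::
  "(qbar2 \<Rightarrow> ereal) \<Rightarrow> nat \<Rightarrow> qbar2 \<Rightarrow> qbar2 \<Rightarrow> ind_qbar2 set set \<Rightarrow> ind_qbar2 set set" where
  "Theta_bar_scal v r a x = quot_op (max_ideal_Theta v r a) (quot_op (rel_sub r a) (scal x))"

definition Theta_bar_trans :: "mat_q2 \<Rightarrow> ind_qbar2 set set \<Rightarrow> ind_qbar2 set set" where
  "Theta_bar_trans g = image (image (trans g))"

definition z2_res :: "(qbar2 \<Rightarrow> 'f :: field) \<Rightarrow> z2 \<Rightarrow> 'f" where
  "z2_res red z = red (z2_qbar2 z)"

definition ind_V :: "(qbar2 \<Rightarrow> 'f :: field) \<Rightarrow> nat \<Rightarrow> (mat_q2 \<Rightarrow> 'f poly poly) set" where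
  "ind_V red r = cind (z2_res red) (sym_pow r)"

definition red_fun :: "(qbar2 \<Rightarrow> 'f :: field) \<Rightarrow> ind_qbar2 \<Rightarrow> mat_q2 \<Rightarrow> 'f poly poly" where
  "red_fun red f = (\<lambda>x. map_poly (map_poly red) (f x))"

definition P_map ::
  "(qbar2 \<Rightarrow> ereal) \<Rightarrow> (qbar2 \<Rightarrow> 'f :: field) \<Rightarrow> nat \<Rightarrow> qbar2 \<Rightarrow>
   (mat_q2 \<Rightarrow> 'f poly poly) \<Rightarrow> ind_qbar2 set set" where
  "P_map v red r a F =
     (THE \<xi>. \<exists>f\<in>lattice_ind v r. red_fun red f = F \<and> \<xi> = Theta_bar_class v r a f)"

definition q_map :: "nat \<Rightarrow> (mat_q2 \<Rightarrow> 'f :: field poly poly) \<Rightarrow> mat_q2 \<Rightarrow> 'f poly poly" where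
  "q_map r F = (\<lambda>x. CC (\<Sum>j = 1..r - 1. coeff_XY (F x) (r - j) j))"

text \<open>\<^term>\<open>\<psi>\<close> is a G-equivariant linear map from the quotient of the induction of V_0 by \<^term>\<open>N\<close> to
  \<^term>\<open>Theta_bar v r a\<close>.\<close>

definition equivariant_map_to_Theta_bar ::
  "(qbar2 \<Rightarrow> ereal) \<Rightarrow> (qbar2 \<Rightarrow> 'f :: field) \<Rightarrow> nat \<Rightarrow> qbar2 \<Rightarrow>
   (mat_q2 \<Rightarrow> 'f poly poly) set \<Rightarrow>
   ((mat_q2 \<Rightarrow> 'f poly poly) set \<Rightarrow> ind_qbar2 set set) \<Rightarrow> bool" where
  "equivariant_map_to_Theta_bar v red r a N \<psi> \<longleftrightarrow>
     (let Q = quot (ind_V red 0) N in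
       (\<forall>u\<in>Q. \<psi> u \<in> Theta_bar v r a) \<and>
       (\<forall>u\<in>Q. \<forall>u'\<in>Q. \<psi> (u + u') = \<psi> u + \<psi> u') \<and>
       (\<forall>x\<in>zbar2 v. \<forall>u\<in>Q. \<psi> (quot_op N (scal (red x)) u) = Theta_bar_scal v r a x (\<psi> u)) \<and>
       (\<forall>g\<in>GL2_q2. \<forall>u\<in>Q. \<psi> (trans g ` u) = Theta_bar_trans g (\<psi> u)))"

end

theory Submission
  imports Defs
begin

text \<open>Write \<open>[g, w]\<close> for the elements generating the induction, \<open>w\<^sub>j = X^(r-j) Y^j\<close>, and \<open>g\<^sub>0, g\<^sub>1, g\<^sub>2\<close> for
  the three matrices of the Hecke operator. Modulo \<open>T - a\<close> one has
  \<open>a [g, w] = \<Sum>\<^sub>i [g g\<^sub>i, adj(g\<^sub>i) w]\<close>. If w vanishes mod 2 at the three points of the projective line over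
  the field with two elements, the right-hand side is divisible by 2, so \<open>[g, w]\<close> is divisible by \<open>2 / a\<close>;
  together with \<open>[g, X^r] \<in> (a)\<close> this kills the kernel of q.

  The remaining relation comes from evaluating \<open>a [g, (X + Y)^r - X^r - Y^r]\<close> in two ways: by the Hecke
  relation at g, and by climbing in the tree from each of the three terms separately, using
  \<open>[g, X^r] = a [g g\<^sub>2, X^r - w\<^sub>(r-1)] + ...\<close>. The difference is \<open>a\<^sup>2 - 2 r\<^sup>2 = 2 a \<alpha>'\<close> times the sum \<open>\<tau>\<close> over
  the three neighbours of g. If \<open>v(\<alpha>') < 0\<close> all error terms are smaller. Otherwise \<open>v(a) = 1/2\<close> and r is odd;
  the errors are then controlled up to \<open>v(r - 1)\<close>, and the only one of that size is \<open>2 a (r - 1)\<close> times the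
  sum \<open>\<sigma>\<close> over the six vertices at distance two, which is \<open>T\<^sup>2 + 1\<close> in characteristic 2.
  Hence \<open>\<alpha>' \<tau> = (r - 1) \<sigma>\<close> up to smaller terms, which gives both cases.\<close>

subsection \<open>The 2-adic integers\<close>

text \<open>The three terms of \<open>HH = (X + Y)^r - X^r - Y^r\<close> are translates of
  \<open>X^r\<close> by a shear, the identity and a flip, which carry the neighbour
  \<open>g ** gm 2\<close> to \<open>g ** gm 1\<close>, itself and \<open>g ** gm 0\<close>. So one
  climbing estimate serves all three terms and ends on the neighbours of \<open>g\<close> with
  factor a^2, where the Hecke relation at \<open>g\<close> ends as well, with factor 2 r. The
  obstacle is precision. For v(\<alpha>') \<ge> 0 the errors must exceed min(v(\<alpha>'), v(r - 1))
  + 3/2, where 3/2 = v(2 a), but discarding \<open>a^2 [h, X^r]\<close> in the climb is an error of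
  valuation 3/2 only. The combination \<open>zeta\<close> absorbs that term, and expansions modulo 4
  (r - 1) replace those modulo 4. Their quadratic term 2 r (r - 1) does two things: it turns 2 r
  into 2 r^2 and, once completed to \<open>mon 1 + mon 2\<close>, which vanishes mod 2 at the three
  points, it can be pushed to distance two; this is the origin of \<open>sigma\<close>. For r = 3
  two terms at \<open>g\<close> itself can be as large as the main terms and cancel only against
  each other (\<open>coefficient_small\<close>).\<close>

lemma Rep_z2_add1: "Rep_z2 a 1 = Rep_z2 a (Suc n) mod 2"
  using Rep_z2_compat_add[of a 1 n] by simp

lemma Rep_z2_numeral_2: "Rep_z2 2 n = 2 mod 2 ^ n"
proof -
  have "Rep_z2 (1 + 1) n = 2 mod 2 ^ n"
    unfolding Rep_z2_ops mod_add_eq by simp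
  thus ?thesis by simp
qed

lemma z2_dvd_2_iff: "2 dvd (z :: z2) \<longleftrightarrow> Rep_z2 z 1 = 0"
proof
  assume "2 dvd z"
  then obtain y where "z = 2 * y" by auto
  thus "Rep_z2 z 1 = 0" by (simp add: Rep_z2_ops Rep_z2_numeral_2)
next
  assume z: "Rep_z2 z 1 = 0"
  \<comment> \<open>Halving loses one binary digit, so the half modulo 2^n is read off from
    \<open>z\<close> modulo 2^(n+1).\<close>
  define y where "y n = Rep_z2 z (Suc n) div 2" for n
  have ev: "Rep_z2 z (Suc n) mod 2 = 0" for n
    using Rep_z2_add1[of z n] z by simp
  have "y n = y (Suc n) mod 2 ^ n" for n
  proof -
    have "Rep_z2 z (Suc n) = Rep_z2 z (Suc (Suc n)) mod (2 ^ n * 2)"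
      using Rep_z2_compat[of z "Suc n"] by (simp add: mult.commute)
    also have "\<dots> = (2 * (Rep_z2 z (Suc (Suc n)) div 2)) mod (2 * 2 ^ n)"
      using ev[of "Suc n"] by (simp add: mult.commute minus_mod_eq_mult_div[symmetric])
    also have "\<dots> = 2 * ((Rep_z2 z (Suc (Suc n)) div 2) mod 2 ^ n)"
      by (simp only: mult_mod_right)
    finally show ?thesis by (simp add: y_def)
  qed
  hence "y \<in> {x. \<forall>n. x n = x (Suc n) mod 2 ^ n}" by blast
  hence R: "Rep_z2 (Abs_z2 y) = y" by (rule Abs_z2_inverse)
  have "z = 2 * Abs_z2 y"
  proof (rule z2_eqI)
    fix n
    have "2 * (Rep_z2 z (Suc n) div 2) = Rep_z2 z (Suc n)"
      using ev[of n] by presburger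
    thus "Rep_z2 z n = Rep_z2 (2 * Abs_z2 y) n"
      by (simp add: Rep_z2_ops Rep_z2_numeral_2 R y_def mod_mult_left_eq Rep_z2_compat[symmetric])
  qed
  thus "2 dvd z" by simp
qed

lemma z2_parity: "2 dvd (z :: z2) \<or> 2 dvd (z - 1)"
proof -
  have "Rep_z2 z 1 = 0 \<or> Rep_z2 z 1 = 1"
    using Rep_z2_mod[of z 1] by auto
  thus ?thesis by (auto simp: z2_dvd_2_iff Rep_z2_ops)
qed

lemma z2_odd_iff: "\<not> 2 dvd (z :: z2) \<longleftrightarrow> 2 dvd (z - 1)"
proof -
  have "\<not> 2 dvd (1 :: z2)" by (simp add: z2_dvd_2_iff Rep_z2_ops)
  moreover have "2 dvd z \<Longrightarrow> 2 dvd (z - 1) \<Longrightarrow> 2 dvd (1::z2)"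
    by (metis diff_diff_eq2 dvd_diff add_diff_cancel_left')
  ultimately show ?thesis using z2_parity by blast
qed

lemma z2_odd_unit:
  assumes "\<not> 2 dvd (z :: z2)"
  shows "z dvd 1"
proof -
  have z1: "Rep_z2 z 1 = 1"
    using assms Rep_z2_mod[of z 1] by (auto simp: z2_dvd_2_iff)
  have odd: "odd (Rep_z2 z (Suc n))" for n
    using Rep_z2_add1[of z n] z1 by presburger
  have ex: "\<exists>y. (Rep_z2 z n * y) mod 2 ^ n = 1 mod 2 ^ n \<and> y mod 2 ^ n = y" for n
  proof (cases n)
    case (Suc m)
    have "coprime (Rep_z2 z n) (2 ^ n)" using odd[of m] Suc by simp
    then obtain x w where "x * Rep_z2 z n + w * 2 ^ n = 1"
      using bezout_int[of "Rep_z2 z n" "2 ^ n"] by auto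
    hence "Rep_z2 z n * x = 1 - w * 2 ^ n" by (simp add: algebra_simps)
    hence "Rep_z2 z n * x mod 2 ^ n = 1 mod 2 ^ n" by (metis mod_diff_right_eq mod_mult_self2_is_0 diff_zero)
    thus ?thesis by (intro exI[of _ "x mod 2 ^ n"]) (simp add: mod_simps)
  qed auto
  then obtain y where y: "\<And>n. (Rep_z2 z n * y n) mod 2 ^ n = 1 mod 2 ^ n" "\<And>n. y n mod 2 ^ n = y n"
    by metis
  have "y n = y (Suc n) mod 2 ^ n" for n
  proof -
    let ?m = "2 ^ n :: int"
    have "(Rep_z2 z (Suc n) * y (Suc n)) mod 2 ^ Suc n mod ?m = 1 mod 2 ^ Suc n mod ?m"
      by (simp only: y)
    hence 1: "(Rep_z2 z n * y (Suc n)) mod ?m = 1 mod ?m"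
      unfolding mod_pow2_Suc using Rep_z2_compat[of z n] by (metis mod_mult_left_eq)
    \<comment> \<open>Inverses modulo 2^n are unique: the triple product of \<open>y n\<close>,
      \<open>z\<close> and \<open>y (Suc n)\<close> reduces to either outer factor. Hence the
      inverses chosen level by level are compatible.\<close>
    have "y n * (Rep_z2 z n * y (Suc n)) mod ?m = y n mod ?m"
      using 1 by (metis mod_mult_right_eq mult.right_neutral)
    moreover have "y (Suc n) * (Rep_z2 z n * y n) mod ?m = y (Suc n) mod ?m"
      using y(1)[of n] by (metis mod_mult_right_eq mult.right_neutral)
    ultimately show ?thesis using y(2)[of n] by (simp add: mult_ac)
  qed
  hence "y \<in> {x. \<forall>n. x n = x (Suc n) mod 2 ^ n}" by blast
  hence R: "Rep_z2 (Abs_z2 y) = y" by (rule Abs_z2_inverse)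
  have "1 = z * Abs_z2 y"
    by (rule z2_eqI) (simp add: Rep_z2_ops R y)
  thus ?thesis by (metis dvdI)
qed

lemma z2_unit_iff: "(z :: z2) dvd 1 \<longleftrightarrow> \<not> 2 dvd z"
proof -
  have "\<not> 2 dvd (1 :: z2)" by (simp add: z2_dvd_2_iff Rep_z2_ops)
  thus ?thesis using z2_odd_unit dvd_trans by blast
qed

lemma z2_2_neq_0 [simp]: "(2 :: z2) \<noteq> 0"
proof -
  have "Rep_z2 2 2 \<noteq> Rep_z2 0 2" by (simp add: Rep_z2_numeral_2 Rep_z2_ops)
  thus ?thesis by metis
qed

lemma z2_eq_unit_power:
  assumes "(z :: z2) \<noteq> 0"
  obtains u n where "u dvd 1" "z = u * 2 ^ n"
proof -
  obtain m where "Rep_z2 z m \<noteq> 0" using assms by (metis z2_eqI zero_z2.rep_eq)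
  \<comment> \<open>The induction is on a level \<open>m\<close> at which \<open>z\<close> is
    nonzero: dividing by 2 lowers this level by one, and at level 0 every element is zero.\<close>
  hence "\<exists>u n. u dvd 1 \<and> z = u * 2 ^ n"
  proof (induction m arbitrary: z)
    case 0
    thus ?case using Rep_z2_mod[of z 0] by simp
  next
    case (Suc m)
    show ?case
    proof (cases "2 dvd z")
      case True
      then obtain y where y: "z = 2 * y" by auto
      have "Rep_z2 y m \<noteq> 0"
      proof
        assume "Rep_z2 y m = 0"
        hence "2 ^ m dvd Rep_z2 y (Suc m)" using Rep_z2_compat[of y m] by auto
        hence "2 * Rep_z2 y (Suc m) mod 2 ^ Suc m = 0" by auto
        hence "Rep_z2 (2 * y) (Suc m) = 0"
          unfolding Rep_z2_ops Rep_z2_numeral_2 by (simp only: mod_mult_left_eq)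
        thus False using Suc.prems y by simp
      qed
      from Suc.IH[OF this] obtain u n where "u dvd 1" "y = u * 2 ^ n" by blast
      thus ?thesis using y by (intro exI[of _ u] exI[of _ "Suc n"]) simp
    next
      case False
      thus ?thesis using z2_odd_unit by (intro exI[of _ z] exI[of _ 0]) simp
    qed
  qed
  thus ?thesis using that by blast
qed

subsection \<open>The embedding into the 2-adic numbers\<close>

lemma z2_q2_hom [simp]:
  "z2_q2 0 = 0" "z2_q2 1 = 1" "z2_q2 (x + y) = z2_q2 x + z2_q2 y"
  "z2_q2 (x * y) = z2_q2 x * z2_q2 y" "z2_q2 (- x) = - z2_q2 x" "z2_q2 (x - y) = z2_q2 x - z2_q2 y"
  by (simp_all add: z2_q2_def Zero_fract_def One_fract_def)

lemma z2_q2_eq_iff [simp]: "z2_q2 x = z2_q2 y \<longleftrightarrow> x = y"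
  by (simp add: z2_q2_def eq_fract)

lemma z2_q2_eq_0_iff [simp]: "z2_q2 x = 0 \<longleftrightarrow> x = 0"
  using z2_q2_eq_iff[of x 0] by (simp del: z2_q2_eq_iff)

lemma z2_q2_numeral [simp]: "z2_q2 2 = 2"
  using z2_q2_hom(3)[of 1 1] by (simp del: z2_q2_hom(3))

lemma z2_q2_power [simp]: "z2_q2 (x ^ n) = z2_q2 x ^ n"
  by (induction n) auto

lemma q2_2_neq_0 [simp]: "(2 :: q2) \<noteq> 0"
  using z2_q2_eq_0_iff[of 2] by (simp del: z2_q2_eq_0_iff)

lemma z2_qbar2_hom [simp]:
  "z2_qbar2 0 = 0" "z2_qbar2 1 = 1" "z2_qbar2 (x + y) = z2_qbar2 x + z2_qbar2 y"
  "z2_qbar2 (x * y) = z2_qbar2 x * z2_qbar2 y" "z2_qbar2 (- x) = - z2_qbar2 x"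
  "z2_qbar2 (x - y) = z2_qbar2 x - z2_qbar2 y" "z2_qbar2 2 = 2" "z2_qbar2 (x ^ n) = z2_qbar2 x ^ n"
  by (simp_all add: z2_qbar2_def to_ac_add to_ac_mult to_ac_minus to_ac_diff to_ac_power)

lemma q2_eq_unit_powi:
  assumes "(z :: q2) \<noteq> 0"
  obtains u n where "u dvd 1" "z = z2_q2 u * 2 powi n"
proof -
  obtain a b where ab: "z = Fract a b" "b \<noteq> 0" by (cases z) auto
  hence "a \<noteq> 0" using assms by (auto simp: Zero_fract_def eq_fract)
  then obtain u m where u: "u dvd 1" "a = u * 2 ^ m" using z2_eq_unit_power by blast
  obtain w n where w: "w dvd 1" "b = w * 2 ^ n" using ab z2_eq_unit_power by blast
  obtain w' where w': "1 = w * w'" using w by (elim dvdE)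
  have 1: "z = z2_q2 a / z2_q2 b" using ab by (simp add: z2_q2_def)
  have ww: "z2_q2 w * z2_q2 w' = 1" using w' by (metis z2_q2_hom(2,4))
  hence "z2_q2 w \<noteq> 0" by auto
  hence "z = z2_q2 (u * w') * 2 powi (int m - int n)"
    using ww unfolding 1 u w by (simp add: field_simps power_int_diff)
  moreover have "u * w' dvd 1"
    using u w' by (metis dvd_triv_right mult_dvd_mono mult_1)
  ultimately show ?thesis using that by blast
qed

subsection \<open>Polynomials in two variables\<close>

lemma XX_power: "(XX :: 'r :: comm_ring_1 poly poly) ^ i = [:Polynomial.monom 1 i:]"
  by (induction i) (auto simp: XX_def monom_0 monom_Suc one_pCons)

lemma YY_power: "(YY :: 'r :: comm_ring_1 poly poly) ^ j = Polynomial.monom 1 j"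
  by (induction j) (auto simp: YY_def monom_0 monom_Suc)

lemma CC_hom [simp]:
  "CC 0 = 0" "CC 1 = 1" "CC (x + y) = CC x + CC y" "CC (x * y) = CC x * CC y"
  "CC (- x) = - CC x" "CC (x - y) = CC x - CC y"
  by (simp_all add: CC_def one_pCons)

lemma CC_power: "CC (x ^ n) = CC x ^ n"
  by (induction n) auto

lemma CC_of_nat [simp]: "CC (of_nat n) = of_nat n"
  by (induction n) auto

lemma CC_numeral [simp]: "CC (numeral n) = numeral n"
  using CC_of_nat[of "numeral n"] by (simp del: CC_of_nat)

lemma CC_sum: "CC (\<Sum>i\<in>A. f i) = (\<Sum>i\<in>A. CC (f i))"
  by (induction A rule: infinite_finite_induct) auto

lemma coeff_XY_linear [simp]:
  "coeff_XY 0 i j = 0" "coeff_XY (f + g) i j = coeff_XY f i j + coeff_XY g i j"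
  "coeff_XY (f' - g') i j = coeff_XY f' i j - coeff_XY g' i j"
  "coeff_XY (- f') i j = - coeff_XY f' i j"
  "coeff_XY (CC c * h) i j = c * coeff_XY h i j"
  for f' g' :: "'r :: ab_group_add poly poly" and h :: "'s :: comm_ring_1 poly poly"
  by (simp_all add: coeff_XY_def CC_def)

lemma coeff_XY_sum: "coeff_XY (\<Sum>x\<in>A. f x) i j = (\<Sum>x\<in>A. coeff_XY (f x) i j)"
  by (simp add: coeff_XY_def coeff_sum)

lemma coeff_XY_eqI: "(\<And>i j. coeff_XY f i j = coeff_XY g i j) \<Longrightarrow> f = g"
  by (intro poly_eqI) (simp add: coeff_XY_def)

lemma coeff_XY_monom:
  "coeff_XY (XX ^ i * YY ^ j :: 'r :: comm_ring_1 poly poly) i' j' = (if i = i' \<and> j = j' then 1 else 0)"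
  by (simp add: coeff_XY_def XX_power YY_power)

lemma coeff_XY_CC: "coeff_XY (CC c) i j = (if i = 0 \<and> j = 0 then c else 0)"
  by (auto simp: coeff_XY_def CC_def coeff_pCons split: nat.splits)

lemma coeff_XY_mult:
  "coeff_XY (f * g) i j = (\<Sum>j'\<le>j. \<Sum>i'\<le>i. coeff_XY f i' j' * coeff_XY g (i - i') (j - j'))"
  by (simp add: coeff_XY_def coeff_mult coeff_sum)

lemma finite_coeff_bound:
  fixes f :: "'r :: comm_ring_1 poly poly"
  obtains M where "\<And>i j. i > M \<or> j > M \<Longrightarrow> coeff_XY f i j = 0"
proof -
  define M where "M = Polynomial.degree f + (\<Sum>j\<le>Polynomial.degree f. Polynomial.degree (poly.coeff f j))"
  have 1: "Polynomial.degree f \<le> M" by (simp add: M_def)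
  have 2: "Polynomial.degree (poly.coeff f j) \<le> M" for j
  proof (cases "j \<le> Polynomial.degree f")
    case True
    hence "Polynomial.degree (poly.coeff f j) \<le> (\<Sum>j\<le>Polynomial.degree f. Polynomial.degree (poly.coeff f j))"
      by (intro member_le_sum) auto
    thus ?thesis by (simp add: M_def)
  next
    case False
    thus ?thesis by (simp add: coeff_eq_0)
  qed
  have 3: "coeff_XY f i j = 0" if "i > M \<or> j > M" for i j
    using that 1 2[of j] unfolding coeff_XY_def
    by (metis coeff_eq_0 coeff_0 order_le_less_trans)
  show ?thesis by (rule that[OF 3])
qed

text \<open>The definition of \<open>subst_XY\<close> sums over ranges given by degrees, which
  change under addition. On a common square range additivity can be checked term by term.\<close>

lemma subst_XY_bound:
  fixes f :: "'r :: comm_ring_1 poly poly"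
  assumes "\<And>i j. i > M \<or> j > M \<Longrightarrow> coeff_XY f i j = 0"
  shows "subst_XY f P Q = (\<Sum>j\<le>M. \<Sum>i\<le>M. CC (coeff_XY f i j) * P ^ i * Q ^ j)"
proof -
  have "(\<Sum>i\<le>Polynomial.degree (poly.coeff f j). CC (coeff_XY f i j) * P ^ i * Q ^ j) =
        (\<Sum>i\<le>M. CC (coeff_XY f i j) * P ^ i * Q ^ j)" for j
  proof (rule sum.mono_neutral_cong)
    fix i assume "i \<in> {..M} - {..Polynomial.degree (poly.coeff f j)}"
    thus "CC (coeff_XY f i j) * P ^ i * Q ^ j = 0" by (simp add: coeff_XY_def coeff_eq_0)
  next
    fix i assume "i \<in> {..Polynomial.degree (poly.coeff f j)} - {..M}"
    thus "CC (coeff_XY f i j) * P ^ i * Q ^ j = 0" using assms[of i j] by simp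
  qed auto
  hence "subst_XY f P Q = (\<Sum>j\<le>Polynomial.degree f. \<Sum>i\<le>M. CC (coeff_XY f i j) * P ^ i * Q ^ j)"
    unfolding subst_XY_def by simp
  also have "\<dots> = (\<Sum>j\<le>M. \<Sum>i\<le>M. CC (coeff_XY f i j) * P ^ i * Q ^ j)"
  proof (rule sum.mono_neutral_cong)
    fix j assume "j \<in> {..M} - {..Polynomial.degree f}"
    thus "(\<Sum>i\<le>M. CC (coeff_XY f i j) * P ^ i * Q ^ j) = 0" by (simp add: coeff_XY_def coeff_eq_0)
  next
    fix j assume "j \<in> {..Polynomial.degree f} - {..M}"
    thus "(\<Sum>i\<le>M. CC (coeff_XY f i j) * P ^ i * Q ^ j) = 0" using assms[of _ j] by simp
  qed auto
  finally show ?thesis .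
qed

lemma poly2_monom_sum:
  fixes f :: "'r :: comm_ring_1 poly poly"
  assumes "\<And>i j. i > M \<or> j > M \<Longrightarrow> coeff_XY f i j = 0"
  shows "f = (\<Sum>j\<le>M. \<Sum>i\<le>M. CC (coeff_XY f i j) * (XX ^ i * YY ^ j))"
proof (rule coeff_XY_eqI)
  fix i j
  show "coeff_XY f i j = coeff_XY (\<Sum>j\<le>M. \<Sum>i\<le>M. CC (coeff_XY f i j) * (XX ^ i * YY ^ j)) i j"
  proof (cases "i > M \<or> j > M")
    case True
    have "coeff_XY (\<Sum>j\<le>M. \<Sum>i\<le>M. CC (coeff_XY f i j) * (XX ^ i * YY ^ j)) i j = 0"
      unfolding coeff_XY_sum coeff_XY_linear coeff_XY_monom
      using True by (intro sum.neutral ballI) (auto intro!: sum.neutral)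
    thus ?thesis using assms True by simp
  next
    case False
    have "(\<Sum>i'\<le>M. coeff_XY f i' j' * (if i' = i \<and> j' = j then 1 else 0)) =
          (if j' = j then coeff_XY f i j else 0)" for j'
      using False by (auto simp: if_distrib[of "(*) _"] cong: if_cong)
    thus ?thesis using False by (simp add: coeff_XY_sum coeff_XY_monom)
  qed
qed

lemma poly2_induct:
  fixes f :: "'r :: comm_ring_1 poly poly"
  assumes "\<And>c i j. Q (CC c * (XX ^ i * YY ^ j))" and "\<And>f g. Q f \<Longrightarrow> Q g \<Longrightarrow> Q (f + g)"
  shows "Q f"
proof -
  have 0: "Q 0" using assms(1)[of 0 0 0] by simp
  have sum: "Q (\<Sum>x\<in>A. h x)" if "\<And>x. Q (h x)" for A :: "nat set" and h
  proof (induction A rule: infinite_finite_induct)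
    case (insert x A)
    show ?case unfolding sum.insert[OF insert(1,2)] by (rule assms(2)[OF that insert(3)])
  qed (simp_all add: 0)
  obtain M where "\<And>i j. i > M \<or> j > M \<Longrightarrow> coeff_XY f i j = 0"
    using finite_coeff_bound[of f] by (metis (no_types))
  note eq = poly2_monom_sum[OF this]
  have "Q (\<Sum>j\<le>M. \<Sum>i\<le>M. CC (coeff_XY f i j) * (XX ^ i * YY ^ j))"
    by (intro sum assms(1))
  thus ?thesis by (rule back_subst[of Q, OF _ eq[symmetric]])
qed

lemma subst_XY_add: "subst_XY (f + g) P Q = subst_XY f P Q + subst_XY g P Q"
proof -
  obtain M where M: "\<And>i j. i > M \<or> j > M \<Longrightarrow> coeff_XY f i j = 0"
    using finite_coeff_bound[of f] by (metis (no_types))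
  obtain N where N: "\<And>i j. i > N \<or> j > N \<Longrightarrow> coeff_XY g i j = 0"
    using finite_coeff_bound[of g] by (metis (no_types))
  let ?L = "max M N"
  have "subst_XY f P Q = (\<Sum>j\<le>?L. \<Sum>i\<le>?L. CC (coeff_XY f i j) * P ^ i * Q ^ j)"
    using M by (intro subst_XY_bound) auto
  moreover have "subst_XY g P Q = (\<Sum>j\<le>?L. \<Sum>i\<le>?L. CC (coeff_XY g i j) * P ^ i * Q ^ j)"
    using N by (intro subst_XY_bound) auto
  moreover have "subst_XY (f + g) P Q = (\<Sum>j\<le>?L. \<Sum>i\<le>?L. CC (coeff_XY (f + g) i j) * P ^ i * Q ^ j)"
    using M N by (intro subst_XY_bound) auto
  ultimately show ?thesis by (simp add: ring_distribs sum.distrib)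
qed

lemma subst_XY_scale: "subst_XY (CC c * f) P Q = CC c * subst_XY f P Q"
proof -
  obtain M where M: "\<And>i j. i > M \<or> j > M \<Longrightarrow> coeff_XY f i j = 0"
    using finite_coeff_bound[of f] by (metis (no_types))
  have "subst_XY f P Q = (\<Sum>j\<le>M. \<Sum>i\<le>M. CC (coeff_XY f i j) * P ^ i * Q ^ j)"
    using M by (intro subst_XY_bound) auto
  moreover have "subst_XY (CC c * f) P Q = (\<Sum>j\<le>M. \<Sum>i\<le>M. CC (coeff_XY (CC c * f) i j) * P ^ i * Q ^ j)"
    using M by (intro subst_XY_bound) auto
  ultimately show ?thesis by (simp add: sum_distrib_left mult.assoc)
qed

lemma subst_XY_0 [simp]: "subst_XY 0 P Q = 0"
  using subst_XY_scale[of 0 0] by simp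

lemma subst_XY_uminus: "subst_XY (- f) P Q = - subst_XY f P Q"
  using subst_XY_scale[of "- 1" f] by simp

lemma subst_XY_diff: "subst_XY (f - g) P Q = subst_XY f P Q - subst_XY g P Q"
  using subst_XY_add[of f "- g"] by (simp add: subst_XY_uminus)

lemma subst_XY_monom: "subst_XY (XX ^ i * YY ^ j) P Q = P ^ i * Q ^ j"
proof -
  have "subst_XY (XX ^ i * YY ^ j) P Q =
     (\<Sum>j'\<le>i + j. \<Sum>i'\<le>i + j. CC (coeff_XY (XX ^ i * YY ^ j) i' j') * P ^ i' * Q ^ j')"
    by (intro subst_XY_bound) (auto simp: coeff_XY_monom)
  also have "\<dots> = (\<Sum>j'\<le>i + j. if j' = j then P ^ i * Q ^ j else 0)"
  proof (intro sum.cong refl)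
    fix j' assume "j' \<in> {..i + j}"
    have "(\<Sum>i'\<le>i + j. CC (coeff_XY (XX ^ i * YY ^ j) i' j') * P ^ i' * Q ^ j') =
          (\<Sum>i'\<le>i + j. if i' = i then (if j' = j then P ^ i * Q ^ j else 0) else 0)"
      by (intro sum.cong) (auto simp: coeff_XY_monom)
    thus "(\<Sum>i'\<le>i + j. CC (coeff_XY (XX ^ i * YY ^ j) i' j') * P ^ i' * Q ^ j') =
        (if j' = j then P ^ i * Q ^ j else 0)" by simp
  qed
  also have "\<dots> = P ^ i * Q ^ j" by simp
  finally show ?thesis .
qed

lemma subst_XY_mult: "subst_XY (f * g) P Q = subst_XY f P Q * subst_XY g P Q"
proof (induction f rule: poly2_induct)
  case (1 c i j)
  show ?case
  proof (induction g rule: poly2_induct)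
    case (1 d k l)
    have "CC c * (XX ^ i * YY ^ j) * (CC d * (XX ^ k * YY ^ l)) =
          CC (c * d) * (XX ^ (i + k) * YY ^ (j + l))"
      by (simp add: power_add mult_ac)
    thus ?case by (simp only: subst_XY_scale subst_XY_monom) (simp add: power_add mult_ac)
  next
    case (2 f g)
    thus ?case by (simp add: ring_distribs subst_XY_add)
  qed
next
  case (2 f g)
  thus ?case by (simp add: ring_distribs subst_XY_add)
qed

lemma subst_XY_XX [simp]: "subst_XY XX P Q = P"
  using subst_XY_monom[of 1 0] by simp

lemma subst_XY_YY [simp]: "subst_XY YY P Q = Q"
  using subst_XY_monom[of 0 1] by simp

lemma subst_XY_CC [simp]: "subst_XY (CC c) P Q = CC c"
  using subst_XY_scale[of c "XX ^ 0 * YY ^ 0" P Q] unfolding subst_XY_monom by simp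

lemma subst_XY_1 [simp]: "subst_XY 1 P Q = 1"
  using subst_XY_CC[of 1] by simp

lemma subst_XY_of_nat [simp]: "subst_XY (of_nat n) P Q = of_nat n"
  using subst_XY_CC[of "of_nat n"] by simp

lemma subst_XY_numeral [simp]: "subst_XY (numeral n) P Q = numeral n"
  using subst_XY_CC[of "numeral n"] by simp

lemma subst_XY_power: "subst_XY (f ^ n) P Q = subst_XY f P Q ^ n"
  by (induction n) (auto simp: subst_XY_mult)

lemmas subst_XY_hom = subst_XY_add subst_XY_diff subst_XY_uminus subst_XY_mult subst_XY_power

lemma subst_XY_id [simp]: "subst_XY f XX YY = f"
  by (induction f rule: poly2_induct) (auto simp: subst_XY_add subst_XY_scale subst_XY_monom)

lemma subst_XY_comp:
  "subst_XY (subst_XY f P Q) P' Q' = subst_XY f (subst_XY P P' Q') (subst_XY Q P' Q')"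
  by (induction f rule: poly2_induct)
    (auto simp: subst_XY_hom subst_XY_scale subst_XY_monom)

subsection \<open>Homogeneous polynomials\<close>

lemma sym_pow_iff: "f \<in> sym_pow r \<longleftrightarrow> (\<forall>i j. i + j \<noteq> r \<longrightarrow> coeff_XY f i j = 0)"
  by (auto simp: sym_pow_def)

lemma sym_pow_add: "f \<in> sym_pow r \<Longrightarrow> g \<in> sym_pow r \<Longrightarrow> f + g \<in> sym_pow r"
  by (simp add: sym_pow_iff)

lemma sym_pow_0 [simp]: "0 \<in> sym_pow r"
  by (auto simp: sym_pow_def)

lemma sym_pow_scale: "f \<in> sym_pow r \<Longrightarrow> CC c * f \<in> sym_pow r"
  by (simp add: sym_pow_iff)

lemma sym_pow_uminus: "f \<in> sym_pow r \<Longrightarrow> - f \<in> sym_pow r"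
  using sym_pow_scale[of f r "- 1"] by simp

lemma sym_pow_diff: "f \<in> sym_pow r \<Longrightarrow> g \<in> sym_pow r \<Longrightarrow> f - g \<in> sym_pow r"
  using sym_pow_add[of f r "- g"] sym_pow_uminus[of g r] by simp

lemma sym_pow_monom: "i + j = r \<Longrightarrow> XX ^ i * YY ^ j \<in> sym_pow r"
  by (auto simp: sym_pow_def coeff_XY_monom split: if_splits)

lemma sym_pow_expand:
  assumes "f \<in> sym_pow r"
  shows "f = (\<Sum>j\<le>r. CC (coeff_XY f (r - j) j) * (XX ^ (r - j) * YY ^ j))"
proof (rule coeff_XY_eqI)
  fix i j
  have "coeff_XY (\<Sum>j\<le>r. CC (coeff_XY f (r - j) j) * (XX ^ (r - j) * YY ^ j)) i j =
        (\<Sum>k\<le>r. if k = j then (if i = r - j then coeff_XY f (r - j) j else 0) else 0)"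
    unfolding coeff_XY_sum by (intro sum.cong) (auto simp: coeff_XY_monom)
  also have "\<dots> = coeff_XY f i j" using assms by (force simp: sym_pow_def)
  finally show "coeff_XY f i j = coeff_XY (\<Sum>j\<le>r. CC (coeff_XY f (r - j) j) * (XX ^ (r - j) * YY ^ j)) i j" ..
qed

lemma sym_pow_induct [consumes 1, case_names monom add]:
  assumes "f \<in> sym_pow r"
    and "\<And>c j. j \<le> r \<Longrightarrow> Q (CC c * (XX ^ (r - j) * YY ^ j))"
    and "\<And>f g. Q f \<Longrightarrow> Q g \<Longrightarrow> Q (f + g)"
  shows "Q f"
proof -
  have 0: "Q 0" using assms(2)[of 0 0] by simp
  have "Q (\<Sum>j\<in>A. CC (c j) * (XX ^ (r - j) * YY ^ j))" if "A \<subseteq> {..r}" for A c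
    using finite_subset[OF that finite_atMost] that
  proof (induction A rule: finite_induct)
    case (insert x A)
    hence "Q (CC (c x) * (XX ^ (r - x) * YY ^ x))" "Q (\<Sum>j\<in>A. CC (c j) * (XX ^ (r - j) * YY ^ j))"
      using assms(2) by auto
    thus ?case unfolding sum.insert[OF insert(1,2)] by (rule assms(3))
  qed (simp add: 0)
  from this[of "{..r}" "\<lambda>j. coeff_XY f (r - j) j", OF order.refl] show ?thesis
    by (rule back_subst[of Q, OF _ sym_pow_expand[OF assms(1), symmetric]])
qed

lemma sym_pow_mult:
  assumes "f \<in> sym_pow m" "g \<in> sym_pow n"
  shows "f * g \<in> sym_pow (m + n)"
  using assms(1)
proof (induction rule: sym_pow_induct)
  case (monom c i)
  note i = this
  show ?case using assms(2)
  proof (induction rule: sym_pow_induct)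
    case (monom d j)
    have "CC c * (XX ^ (m - i) * YY ^ i) * (CC d * (XX ^ (n - j) * YY ^ j)) =
          CC (c * d) * (XX ^ ((m - i) + (n - j)) * YY ^ (i + j))"
      by (simp add: power_add mult_ac)
    thus ?case using i monom by (auto intro!: sym_pow_scale sym_pow_monom simp del: CC_hom)
  qed (auto simp: ring_distribs intro: sym_pow_add)
qed (auto simp: ring_distribs intro: sym_pow_add)

lemma sym_pow_power: "f \<in> sym_pow m \<Longrightarrow> f ^ n \<in> sym_pow (m * n)"
proof (induction n)
  case 0
  show ?case using sym_pow_monom[of 0 0 0] by simp
qed (auto intro: sym_pow_mult)

lemma sym_pow_subst:
  assumes "f \<in> sym_pow r" "P \<in> sym_pow 1" "Q \<in> sym_pow 1"
  shows "subst_XY f P Q \<in> sym_pow r"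
  using assms(1)
proof (induction rule: sym_pow_induct)
  case (monom c j)
  have "P ^ (r - j) * Q ^ j \<in> sym_pow (1 * (r - j) + 1 * j)"
    by (intro sym_pow_mult sym_pow_power assms)
  thus ?case using monom by (auto simp: subst_XY_scale subst_XY_monom intro: sym_pow_scale)
qed (auto simp: subst_XY_add intro: sym_pow_add)

lemma sym_pow_XX [simp]: "XX \<in> sym_pow 1" and sym_pow_YY [simp]: "YY \<in> sym_pow 1"
  using sym_pow_monom[of 1 0 1] sym_pow_monom[of 0 1 1] by auto

lemma sym_pow_0_iff: "f \<in> sym_pow 0 \<longleftrightarrow> f = CC (coeff_XY f 0 0)"
proof
  assume "f \<in> sym_pow 0"
  from sym_pow_expand[OF this] show "f = CC (coeff_XY f 0 0)" by simp
next
  assume "f = CC (coeff_XY f 0 0)"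
  thus "f \<in> sym_pow 0" using sym_pow_monom[of 0 0 0] by (metis power_0 mult_1_right sym_pow_scale add_0)
qed

subsection \<open>Coefficients in a subring\<close>

definition coeffs_in :: "'r :: comm_ring_1 set \<Rightarrow> 'r poly poly \<Rightarrow> bool" where
  "coeffs_in A f \<longleftrightarrow> (\<forall>i j. coeff_XY f i j \<in> A)"

locale subring_set =
  fixes A :: "'r :: comm_ring_1 set"
  assumes zero: "0 \<in> A" and one: "1 \<in> A" and uminus: "x \<in> A \<Longrightarrow> - x \<in> A"
    and add: "x \<in> A \<Longrightarrow> y \<in> A \<Longrightarrow> x + y \<in> A" and mult: "x \<in> A \<Longrightarrow> y \<in> A \<Longrightarrow> x * y \<in> A"
begin

lemma sum_in: "(\<And>x. x \<in> B \<Longrightarrow> f x \<in> A) \<Longrightarrow> (\<Sum>x\<in>B. f x) \<in> A"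
  by (induction B rule: infinite_finite_induct) (auto intro: zero add)

lemma coeffs_in_add: "coeffs_in A f \<Longrightarrow> coeffs_in A g \<Longrightarrow> coeffs_in A (f + g)"
  by (auto simp: coeffs_in_def intro: add)

lemma coeffs_in_uminus: "coeffs_in A f \<Longrightarrow> coeffs_in A (- f)"
  by (auto simp: coeffs_in_def intro: uminus)

lemma coeffs_in_diff: "coeffs_in A f \<Longrightarrow> coeffs_in A g \<Longrightarrow> coeffs_in A (f - g)"
  using coeffs_in_add[of f "- g"] coeffs_in_uminus by simp

lemma coeffs_in_mult: "coeffs_in A f \<Longrightarrow> coeffs_in A g \<Longrightarrow> coeffs_in A (f * g)"
  by (auto simp: coeffs_in_def coeff_XY_mult intro!: sum_in mult)

lemma coeffs_in_CC: "c \<in> A \<Longrightarrow> coeffs_in A (CC c)"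
  by (auto simp: coeffs_in_def coeff_XY_CC zero)

lemma coeffs_in_monom: "coeffs_in A (XX ^ i * YY ^ j)"
  by (auto simp: coeffs_in_def coeff_XY_monom zero one)

lemma coeffs_in_0: "coeffs_in A 0" and coeffs_in_1: "coeffs_in A 1"
  using coeffs_in_CC[of 0] coeffs_in_CC[of 1] by (auto simp: zero one)

lemma coeffs_in_XX: "coeffs_in A XX" and coeffs_in_YY: "coeffs_in A YY"
  using coeffs_in_monom[of 1 0] coeffs_in_monom[of 0 1] by auto

lemma coeffs_in_power: "coeffs_in A f \<Longrightarrow> coeffs_in A (f ^ n)"
  by (induction n) (auto intro: coeffs_in_1 coeffs_in_mult)

lemma coeffs_in_sum: "(\<And>x. x \<in> B \<Longrightarrow> coeffs_in A (f x)) \<Longrightarrow> coeffs_in A (\<Sum>x\<in>B. f x)"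
  by (induction B rule: infinite_finite_induct) (auto intro: coeffs_in_0 coeffs_in_add)

lemma coeffs_in_subst:
  assumes "coeffs_in A f" "coeffs_in A P" "coeffs_in A Q"
  shows "coeffs_in A (subst_XY f P Q)"
  unfolding subst_XY_def
  using assms by (intro coeffs_in_sum coeffs_in_mult coeffs_in_power coeffs_in_CC) (auto simp: coeffs_in_def)

end

definition map2 :: "('r :: comm_ring_1 \<Rightarrow> 's :: comm_ring_1) \<Rightarrow> 'r poly poly \<Rightarrow> 's poly poly" where
  "map2 h = map_poly (map_poly h)"

text \<open>Made for \<open>red\<close>, which is additive and multiplicative only on
  \<open>zbar2 v\<close> and arbitrary elsewhere. This is why the rules for sums and products under
  \<open>map2 h\<close> ask for coefficients in \<open>A\<close>.\<close>

locale partial_ring_hom = subring_set A for A :: "'r :: comm_ring_1 set" +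
  fixes h :: "'r \<Rightarrow> 's :: comm_ring_1"
  assumes h_1: "h 1 = 1"
    and h_add: "x \<in> A \<Longrightarrow> y \<in> A \<Longrightarrow> h (x + y) = h x + h y"
    and h_mult: "x \<in> A \<Longrightarrow> y \<in> A \<Longrightarrow> h (x * y) = h x * h y"
begin

lemma h_0: "h 0 = 0"
  using h_add[OF zero zero] by simp

lemma h_uminus: "x \<in> A \<Longrightarrow> h (- x) = - h x"
  using h_add[OF _ uminus, of x x] h_0 by (simp add: eq_neg_iff_add_eq_0 add.commute)

lemma h_diff: "x \<in> A \<Longrightarrow> y \<in> A \<Longrightarrow> h (x - y) = h x - h y"
  using h_add[OF _ uminus, of x y] h_uminus by simp

lemma h_sum: "(\<And>x. x \<in> B \<Longrightarrow> f x \<in> A) \<Longrightarrow> h (\<Sum>x\<in>B. f x) = (\<Sum>x\<in>B. h (f x))"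
  by (induction B rule: infinite_finite_induct) (auto simp: h_0 h_add sum_in)

lemma coeff_XY_map2 [simp]: "coeff_XY (map2 h f) i j = h (coeff_XY f i j)"
  by (simp add: coeff_XY_def map2_def coeff_map_poly h_0)

lemma map2_0 [simp]: "map2 h 0 = 0"
  by (rule coeff_XY_eqI) (simp add: h_0)

lemma map2_add: "coeffs_in A f \<Longrightarrow> coeffs_in A g \<Longrightarrow> map2 h (f + g) = map2 h f + map2 h g"
  by (rule coeff_XY_eqI) (auto simp: coeffs_in_def h_add)

lemma map2_uminus: "coeffs_in A f \<Longrightarrow> map2 h (- f) = - map2 h f"
  by (rule coeff_XY_eqI) (auto simp: coeffs_in_def h_uminus)

lemma map2_diff: "coeffs_in A f \<Longrightarrow> coeffs_in A g \<Longrightarrow> map2 h (f - g) = map2 h f - map2 h g"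
  by (rule coeff_XY_eqI) (auto simp: coeffs_in_def h_diff)

lemma map2_mult: "coeffs_in A f \<Longrightarrow> coeffs_in A g \<Longrightarrow> map2 h (f * g) = map2 h f * map2 h g"
  by (rule coeff_XY_eqI)
    (simp add: coeffs_in_def coeff_XY_mult h_sum h_mult sum_in mult)

lemma map2_CC [simp]: "map2 h (CC c) = CC (h c)"
  by (rule coeff_XY_eqI) (simp add: coeff_XY_CC h_0)

lemma map2_monom [simp]: "map2 h (XX ^ i * YY ^ j) = XX ^ i * YY ^ j"
  by (rule coeff_XY_eqI) (simp add: coeff_XY_monom h_0 h_1)

lemma map2_XX [simp]: "map2 h XX = XX" and map2_YY [simp]: "map2 h YY = YY"
  using map2_monom[of 1 0] map2_monom[of 0 1] by (simp_all del: map2_monom)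

lemma map2_1 [simp]: "map2 h 1 = 1"
  using map2_CC[of 1] by (simp add: h_1 del: map2_CC)

lemma map2_power: "coeffs_in A f \<Longrightarrow> map2 h (f ^ n) = map2 h f ^ n"
  by (induction n) (auto simp: map2_mult coeffs_in_power)

lemma map2_sum:
  "(\<And>x. x \<in> B \<Longrightarrow> coeffs_in A (f x)) \<Longrightarrow> map2 h (\<Sum>x\<in>B. f x) = (\<Sum>x\<in>B. map2 h (f x))"
  by (induction B rule: infinite_finite_induct) (auto simp: map2_add coeffs_in_sum)

lemma map2_subst:
  assumes "coeffs_in A f" "coeffs_in A P" "coeffs_in A Q"
  shows "map2 h (subst_XY f P Q) = subst_XY (map2 h f) (map2 h P) (map2 h Q)"
proof -
  obtain M where M: "\<And>i j. i > M \<or> j > M \<Longrightarrow> coeff_XY f i j = 0"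
    using finite_coeff_bound[of f] by (metis (no_types))
  have cf: "coeff_XY f i j \<in> A" for i j using assms(1) by (auto simp: coeffs_in_def)
  have 1: "subst_XY f P Q = (\<Sum>j\<le>M. \<Sum>i\<le>M. CC (coeff_XY f i j) * P ^ i * Q ^ j)"
    using M by (rule subst_XY_bound)
  have 2: "subst_XY (map2 h f) (map2 h P) (map2 h Q) =
       (\<Sum>j\<le>M. \<Sum>i\<le>M. CC (coeff_XY (map2 h f) i j) * map2 h P ^ i * map2 h Q ^ j)"
    by (rule subst_XY_bound) (simp add: M h_0)
  show ?thesis unfolding 1 2
    by (simp add: map2_sum map2_mult map2_power assms cf coeffs_in_sum coeffs_in_mult
        coeffs_in_power coeffs_in_CC)
qed

lemma map2_sym_pow: "f \<in> sym_pow r \<Longrightarrow> map2 h f \<in> sym_pow r"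
  by (auto simp: sym_pow_def) (metis h_0)

end

no_notation fps_nth (infixl "$" 75)


subsection \<open>Two by two matrices\<close>

lemma unit_mult_iff: "x * y dvd 1 \<longleftrightarrow> x dvd 1 \<and> (y :: 'a :: comm_ring_1) dvd 1"
  by (metis dvd_mult_left dvd_mult_right mult_dvd_mono mult_1)

lemma mat22_nth [simp]:
  "mat22 a b c d $ 1 $ 1 = a" "mat22 a b c d $ 1 $ 2 = b"
  "mat22 a b c d $ 2 $ 1 = c" "mat22 a b c d $ 2 $ 2 = d"
  by (simp_all add: mat22_def)

lemma matrix_eq_iff_2:
  "(A :: 'a ^ 2 ^ 2) = B \<longleftrightarrow> A$1$1 = B$1$1 \<and> A$1$2 = B$1$2 \<and> A$2$1 = B$2$1 \<and> A$2$2 = B$2$2"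
  by (auto simp: vec_eq_iff forall_2)

lemma mat_nth_2 [simp]:
  "(mat c :: 'a :: zero ^ 2 ^ 2) $ 1 $ 1 = c" "(mat c :: 'a :: zero ^ 2 ^ 2) $ 1 $ 2 = 0"
  "(mat c :: 'a :: zero ^ 2 ^ 2) $ 2 $ 1 = 0" "(mat c :: 'a :: zero ^ 2 ^ 2) $ 2 $ 2 = c"
  by (simp_all add: mat_def)

lemma matrix_mult_nth_2 [simp]:
  "((A :: 'a :: semiring_1 ^ 2 ^ 2) ** B) $ i $ j = A $ i $ 1 * B $ 1 $ j + A $ i $ 2 * B $ 2 $ j"
  by (simp add: matrix_matrix_mult_def sum_2)

lemma mat_mult_commute_2: "(A :: 'a ^ 2 ^ 2) ** mat c = mat (c :: 'a :: comm_ring_1) ** (A :: 'a ^ 2 ^ 2)"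
  by (simp add: matrix_eq_iff_2)

lemma mat_mult_mat_2: "mat x ** mat y = (mat (x * y) :: 'a :: comm_ring_1 ^ 2 ^ 2)"
  by (simp add: matrix_eq_iff_2)

text \<open>The inverse is the adjugate divided by the determinant; this holds over any commutative
  ring and is used over the 2-adic integers.\<close>

lemma invertible_iff_det_unit:
  "invertible (M :: 'a :: comm_ring_1 ^ 2 ^ 2) \<longleftrightarrow> det M dvd 1"
proof
  assume "invertible M"
  then obtain N where "M ** N = mat 1" by (auto simp: invertible_def)
  hence "det M * det N = 1" by (metis det_mul det_I)
  thus "det M dvd 1" by (metis dvd_triv_left)
next
  assume "det M dvd 1"
  then obtain u where u: "M$1$1 * M$2$2 - M$1$2 * M$2$1 = det M" "1 = det M * u" by (auto simp: det_2)
  let ?N = "mat u ** mat22 (M$2$2) (- M$1$2) (- M$2$1) (M$1$1)"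
  have "M ** ?N = mat (det M * u)" "?N ** M = mat (det M * u)"
    by (simp_all add: matrix_eq_iff_2 u(1)[symmetric] algebra_simps)
  thus "invertible M" unfolding invertible_def u(2)[symmetric] by blast
qed

lemma mat_2_cancel: "mat 2 ** M = mat 2 ** (N :: z2 ^ 2 ^ 2) \<Longrightarrow> M = N"
  by (simp add: matrix_eq_iff_2)

section \<open>Integral matrices inside GL2 of the 2-adic numbers, and the group
  \<open>KZ\<close>\<close>

definition zmat :: "z2 ^ 2 ^ 2 \<Rightarrow> mat_q2" where
  "zmat = map_matrix z2_q2"

lemma zmat_nth [simp]: "zmat M $ i $ j = z2_q2 (M $ i $ j)"
  by (simp add: zmat_def)

lemma zmat_mult: "zmat (M ** N) = zmat M ** zmat N"
  by (simp add: matrix_eq_iff_2)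

lemma zmat_mat [simp]: "zmat (mat c) = mat (z2_q2 c)"
  by (simp add: matrix_eq_iff_2)

lemma zmat_mat22 [simp]: "zmat (mat22 a b c d) = mat22 (z2_q2 a) (z2_q2 b) (z2_q2 c) (z2_q2 d)"
  by (simp add: matrix_eq_iff_2)

lemma det_zmat [simp]: "det (zmat M) = z2_q2 (det M)"
  by (simp add: det_2)

lemma det_mat_2 [simp]: "det (mat c :: 'a :: comm_ring_1 ^ 2 ^ 2) = c * c"
  by (simp add: det_2)

lemma GL2_iff: "g \<in> GL2_q2 \<longleftrightarrow> det g \<noteq> 0"
  by (simp add: GL2_q2_def invertible_det_nz)

lemma GL2_mult_iff [simp]: "g ** h \<in> GL2_q2 \<longleftrightarrow> g \<in> GL2_q2 \<and> h \<in> GL2_q2"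
  by (auto simp: GL2_iff det_mul)

lemma GL2_inverse:
  assumes "g \<in> GL2_q2"
  obtains g' where "g' \<in> GL2_q2" "g ** g' = mat 1" "g' ** g = mat 1"
proof -
  obtain g' where g': "g ** g' = mat 1" "g' ** g = mat 1"
    using assms by (auto simp: GL2_q2_def invertible_def)
  hence "invertible g'" unfolding invertible_def by blast
  thus ?thesis using that g' by (auto simp: GL2_q2_def)
qed

definition pmat :: "int \<Rightarrow> z2 ^ 2 ^ 2 \<Rightarrow> mat_q2" where
  "pmat n M = mat (2 powi n) ** zmat M"

lemma pmat_mult: "pmat n M ** pmat m N = pmat (n + m) (M ** N)"
  by (simp add: pmat_def matrix_eq_iff_2 power_int_add algebra_simps)

lemma det_pmat: "det (pmat n M) = 2 powi (n + n) * z2_q2 (det M)"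
  using power_int_add[of "2 :: q2" n n] by (simp add: pmat_def det_mul)

lemma z2_double_power_unit:
  assumes "z2_q2 u * 2 powi n = z2_q2 w * 2 powi m" "u dvd 1" "w dvd 1"
  shows "n = m"
  using assms
proof (induction n m arbitrary: u w rule: linorder_wlog)
  case (le n m)
  define k where "k = nat (m - n)"
  have m: "m = n + int k" using le by (simp add: k_def)
  have "z2_q2 u = z2_q2 w * 2 ^ k"
    using le(2) unfolding m by (simp add: power_int_add)
  hence "z2_q2 u = z2_q2 (w * 2 ^ k)" by simp
  hence "u = w * 2 ^ k" by (simp only: z2_q2_eq_iff)
  hence "\<not> 2 dvd w * 2 ^ k" using le(3) z2_unit_iff by auto
  hence "k = 0" by (cases k) auto
  thus ?case using m by simp
next
  case (sym n m)
  from sym(1)[of w u] sym(2-4) show ?case by simp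
qed

text \<open>Comparing determinants shows that \<open>2 powi (n + n)\<close> and
  \<open>2 powi (m + m)\<close> differ by a unit, so the exponents agree. The common factor
  \<open>c\<close> is 1 for elements of \<open>KZ\<close> and 2 for matrices that relate
  neighbouring vertices.\<close>

lemma pmat_eq:
  assumes "pmat n M = pmat m N" "det M = c * u" "det N = c * w" "u dvd 1" "w dvd 1" "c \<noteq> 0"
  shows "n = m \<and> M = N"
proof -
  have "2 powi (n + n) * z2_q2 (c * u) = 2 powi (m + m) * z2_q2 (c * w)"
    using assms det_pmat[of n M] det_pmat[of m N] by simp
  hence "z2_q2 u * 2 powi (n + n) = z2_q2 w * 2 powi (m + m)"
    using \<open>c \<noteq> 0\<close> by (simp add: mult.commute)
  hence "n + n = m + m" using assms z2_double_power_unit by blast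
  thus ?thesis using assms(1) by (simp add: pmat_def matrix_eq_iff_2)
qed

lemma KZ_iff: "h \<in> KZ \<longleftrightarrow> (\<exists>n M. det M dvd 1 \<and> h = pmat n M)"
proof
  assume "h \<in> KZ"
  then obtain z M where zM: "z \<noteq> 0" "invertible M" "h = mat z ** zmat M"
    by (auto simp: KZ_def GL2_z2_def zmat_def)
  \<comment> \<open>The unit part of the scalar is absorbed into the integral matrix; only the power
    of 2 stays outside.\<close>
  obtain u n where u: "u dvd 1" "z = z2_q2 u * 2 powi n"
    using q2_eq_unit_powi[OF zM(1)] by blast
  have "det (mat u ** M) dvd 1"
    using u(1) zM(2) by (simp add: det_mul invertible_iff_det_unit unit_mult_iff)
  moreover have "h = pmat n (mat u ** M)"
    by (simp add: zM u pmat_def matrix_eq_iff_2 mult_ac)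
  ultimately show "\<exists>n M. det M dvd 1 \<and> h = pmat n M" by blast
next
  assume "\<exists>n M. det M dvd 1 \<and> h = pmat n M"
  then obtain n M where "det M dvd 1" "h = pmat n M" by blast
  thus "h \<in> KZ"
    unfolding KZ_def GL2_z2_def pmat_def zmat_def
    by (auto simp: invertible_iff_det_unit intro!: exI[of _ "2 powi n"] exI[of _ "map_matrix z2_q2 M"])
qed

lemma KZ_pmat: "det M dvd 1 \<Longrightarrow> pmat n M \<in> KZ"
  by (auto simp: KZ_iff)

lemma KZ_part_pmat:
  assumes "det M dvd 1"
  shows "KZ_part (pmat n M) = M"
  unfolding KZ_part_def
proof (rule the_equality)
  show "invertible M \<and> (\<exists>m. pmat n M = mat (2 powi m) ** map_matrix z2_q2 M)"
    using assms by (auto simp: invertible_iff_det_unit pmat_def zmat_def)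
next
  fix N assume "invertible N \<and> (\<exists>m. pmat n M = mat (2 powi m) ** map_matrix z2_q2 N)"
  then obtain m where "det N dvd 1" "pmat n M = pmat m N"
    by (auto simp: invertible_iff_det_unit pmat_def zmat_def)
  thus "N = M" using pmat_eq[of n M m N 1 "det M" "det N"] assms by simp
qed

lemma KZ_mult: "h \<in> KZ \<Longrightarrow> k \<in> KZ \<Longrightarrow> h ** k \<in> KZ"
  by (auto simp: KZ_iff pmat_mult) (metis det_mul unit_mult_iff)

lemma KZ_GL2: "h \<in> KZ \<Longrightarrow> h \<in> GL2_q2"
  by (auto simp: KZ_iff GL2_iff det_pmat)

lemma pmat_0: "pmat 0 M = zmat M"
  by (simp add: pmat_def)

lemma KZ_inverse:
  assumes "h \<in> KZ"
  obtains h' where "h' \<in> KZ" "h ** h' = mat 1" "h' ** h = mat 1"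
proof -
  obtain n M where h: "det M dvd 1" "h = pmat n M" using assms by (auto simp: KZ_iff)
  then obtain N where N: "M ** N = mat 1" "N ** M = mat 1"
    using invertible_iff_det_unit[of M] by (auto simp: invertible_def)
  hence "det M * det N = 1" by (metis det_mul det_I)
  hence "det N dvd 1" by (metis dvd_triv_right)
  moreover have "pmat 0 (mat 1) = mat 1" by (simp add: pmat_0)
  ultimately show ?thesis
    using N h by (intro that[of "pmat (- n) N"]) (auto simp: pmat_mult KZ_pmat)
qed

lemma KZ_mult_iff:
  assumes "h \<in> KZ"
  shows "h ** g \<in> KZ \<longleftrightarrow> g \<in> KZ"
proof
  assume hg: "h ** g \<in> KZ"
  obtain h' where h': "h' \<in> KZ" "h' ** h = mat 1" using KZ_inverse[OF assms] by blast
  have "h' ** (h ** g) = g" by (simp add: matrix_mul_assoc h')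
  thus "g \<in> KZ" using KZ_mult[OF h'(1) hg] by simp
qed (use assms KZ_mult in blast)

subsection \<open>Parity patterns\<close>

text \<open>The matrices of the Hecke operator, numbered 0, 1, 2: the neighbours of the vertex
  \<open>g\<close> are the \<open>g ** gm i\<close>. Larger indices repeat the last matrix, so
  uniqueness statements restrict to indices below 3.\<close>

definition gm :: "nat \<Rightarrow> 'a :: comm_ring_1 ^ 2 ^ 2" where
  "gm i = (if i = 0 then mat22 2 0 0 1 else if i = 1 then mat22 2 1 0 1 else mat22 1 0 0 2)"

text \<open>The adjugates of the \<open>gm i\<close>. Acting on polynomials they give exactly the
  substitutions \<open>w(X, 2Y)\<close>, \<open>w(X, 2Y - X)\<close> and \<open>w(2X, Y)\<close> of
  the Hecke operator.\<close>

definition adjm :: "nat \<Rightarrow> 'a :: comm_ring_1 ^ 2 ^ 2" where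
  "adjm i = (if i = 0 then mat22 1 0 0 2 else if i = 1 then mat22 1 (- 1) 0 2 else mat22 2 0 0 1)"

lemma gm_adjm: "gm i ** adjm i = mat 2" "adjm i ** gm i = mat 2"
  by (auto simp: matrix_eq_iff_2 gm_def adjm_def)

lemma zmat_gm [simp]: "zmat (gm i) = gm i" and zmat_adjm [simp]: "zmat (adjm i) = adjm i"
  by (auto simp: gm_def adjm_def)

lemma det_gm [simp]: "det (gm i) = 2" and det_adjm [simp]: "det (adjm i) = 2"
  by (auto simp: gm_def adjm_def det_2)

lemma gm_GL2 [simp]: "gm i \<in> GL2_q2" and adjm_GL2 [simp]: "adjm i \<in> GL2_q2"
  by (simp_all add: GL2_iff)

lemma z2_even_simps:
  "2 dvd (x + y :: z2) \<longleftrightarrow> (2 dvd x \<longleftrightarrow> 2 dvd y)"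
  "2 dvd (x - y :: z2) \<longleftrightarrow> (2 dvd x \<longleftrightarrow> 2 dvd y)"
  "2 dvd (x * y :: z2) \<longleftrightarrow> 2 dvd x \<or> 2 dvd y"
proof -
  show add: "2 dvd (x + y :: z2) \<longleftrightarrow> (2 dvd x \<longleftrightarrow> 2 dvd y)" for x y :: z2
  proof (cases "2 dvd x \<or> 2 dvd y")
    case True
    thus ?thesis by (auto simp: dvd_add_right_iff dvd_add_left_iff)
  next
    case False
    then obtain a b where "x - 1 = 2 * a" "y - 1 = 2 * b" using z2_odd_iff by (auto elim!: dvdE)
    hence "x + y = 2 * (a + b + 1)" by (simp add: algebra_simps)
    thus ?thesis using False by simp
  qed
  show "2 dvd (x - y :: z2) \<longleftrightarrow> (2 dvd x \<longleftrightarrow> 2 dvd y)"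
    using add[of x "- y"] by simp
  show "2 dvd (x * y :: z2) \<longleftrightarrow> 2 dvd x \<or> 2 dvd y"
  proof (cases "2 dvd x \<or> 2 dvd y")
    case False
    then obtain a b where "x - 1 = 2 * a" "y - 1 = 2 * b" using z2_odd_iff by (auto elim!: dvdE)
    hence "x = 2 * a + 1" "y = 2 * b + 1" by (simp_all add: algebra_simps)
    hence "x * y - 1 = 2 * (2 * a * b + a + b)" by (simp add: algebra_simps)
    hence "2 dvd x * y - 1" by (rule dvdI)
    thus ?thesis using False z2_odd_iff[of "x * y"] by blast
  qed auto
qed

lemma left_coset_iff:
  fixes M :: "z2 ^ 2 ^ 2"
  shows
  "(\<exists>N. M = gm 0 ** N) \<longleftrightarrow> 2 dvd (M$1$1 :: z2) \<and> 2 dvd M$1$2"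
  "(\<exists>N. M = gm (Suc 0) ** N) \<longleftrightarrow> 2 dvd (M$1$1 - M$2$1 :: z2) \<and> 2 dvd (M$1$2 - M$2$2)"
  "(\<exists>N. M = gm 2 ** N) \<longleftrightarrow> 2 dvd (M$2$1 :: z2) \<and> 2 dvd M$2$2"
proof -
  show "(\<exists>N. M = gm 0 ** N) \<longleftrightarrow> 2 dvd (M$1$1 :: z2) \<and> 2 dvd M$1$2"
  proof (safe)
    assume "2 dvd M$1$1" "2 dvd M$1$2"
    then obtain x y where "M$1$1 = 2 * x" "M$1$2 = 2 * y" by (auto elim!: dvdE)
    thus "\<exists>N. M = gm 0 ** N"
      by (intro exI[of _ "mat22 x y (M$2$1) (M$2$2)"]) (simp add: matrix_eq_iff_2 gm_def)
  qed (auto simp: gm_def)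
  show "(\<exists>N. M = gm (Suc 0) ** N) \<longleftrightarrow> 2 dvd (M$1$1 - M$2$1 :: z2) \<and> 2 dvd (M$1$2 - M$2$2)"
  proof (safe)
    assume "2 dvd M$1$1 - M$2$1" "2 dvd M$1$2 - M$2$2"
    then obtain x y where "M$1$1 - M$2$1 = 2 * x" "M$1$2 - M$2$2 = 2 * y" by (auto elim!: dvdE)
    thus "\<exists>N. M = gm (Suc 0) ** N"
      by (intro exI[of _ "mat22 x y (M$2$1) (M$2$2)"]) (simp add: matrix_eq_iff_2 gm_def algebra_simps)
  qed (auto simp: gm_def)
  show "(\<exists>N. M = gm 2 ** N) \<longleftrightarrow> 2 dvd (M$2$1 :: z2) \<and> 2 dvd M$2$2"
  proof (safe)
    assume "2 dvd M$2$1" "2 dvd M$2$2"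
    then obtain x y where "M$2$1 = 2 * x" "M$2$2 = 2 * y" by (auto elim!: dvdE)
    thus "\<exists>N. M = gm 2 ** N"
      by (intro exI[of _ "mat22 (M$1$1) (M$1$2) x y"]) (simp add: matrix_eq_iff_2 gm_def)
  qed (auto simp: gm_def)
qed

lemma right_coset_iff:
  fixes M :: "z2 ^ 2 ^ 2"
  shows
  "(\<exists>N. M ** gm 0 = mat 2 ** N) \<longleftrightarrow> 2 dvd (M$1$2 :: z2) \<and> 2 dvd M$2$2"
  "(\<exists>N. M ** gm (Suc 0) = mat 2 ** N) \<longleftrightarrow> 2 dvd (M$1$1 + M$1$2 :: z2) \<and> 2 dvd (M$2$1 + M$2$2)"
  "(\<exists>N. M ** gm 2 = mat 2 ** N) \<longleftrightarrow> 2 dvd (M$1$1 :: z2) \<and> 2 dvd M$2$1"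
proof -
  show "(\<exists>N. M ** gm 0 = mat 2 ** N) \<longleftrightarrow> 2 dvd (M$1$2 :: z2) \<and> 2 dvd M$2$2"
  proof (safe)
    assume "2 dvd M$1$2" "2 dvd M$2$2"
    then obtain x y where "M$1$2 = 2 * x" "M$2$2 = 2 * y" by (auto elim!: dvdE)
    thus "\<exists>N. M ** gm 0 = mat 2 ** N"
      by (intro exI[of _ "mat22 (M$1$1) x (M$2$1) y"]) (simp add: matrix_eq_iff_2 gm_def)
  qed (auto simp: gm_def matrix_eq_iff_2)
  show "(\<exists>N. M ** gm (Suc 0) = mat 2 ** N) \<longleftrightarrow> 2 dvd (M$1$1 + M$1$2 :: z2) \<and> 2 dvd (M$2$1 + M$2$2)"
  proof (safe)
    assume "2 dvd M$1$1 + M$1$2" "2 dvd M$2$1 + M$2$2"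
    then obtain x y where "M$1$1 + M$1$2 = 2 * x" "M$2$1 + M$2$2 = 2 * y" by (auto elim!: dvdE)
    thus "\<exists>N. M ** gm (Suc 0) = mat 2 ** N"
      by (intro exI[of _ "mat22 (M$1$1) x (M$2$1) y"]) (simp add: matrix_eq_iff_2 gm_def)
  qed (auto simp: gm_def matrix_eq_iff_2)
  show "(\<exists>N. M ** gm 2 = mat 2 ** N) \<longleftrightarrow> 2 dvd (M$1$1 :: z2) \<and> 2 dvd M$2$1"
  proof (safe)
    assume "2 dvd M$1$1" "2 dvd M$2$1"
    then obtain x y where "M$1$1 = 2 * x" "M$2$1 = 2 * y" by (auto elim!: dvdE)
    thus "\<exists>N. M ** gm 2 = mat 2 ** N"
      by (intro exI[of _ "mat22 x (M$1$2) y (M$2$2)"]) (simp add: matrix_eq_iff_2 gm_def)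
  qed (auto simp: gm_def matrix_eq_iff_2)
qed

lemma ex1_less_3: "(\<exists>!i. i < (3 :: nat) \<and> P i) \<longleftrightarrow>
    P 0 \<and> \<not> P (Suc 0) \<and> \<not> P 2 \<or> \<not> P 0 \<and> P (Suc 0) \<and> \<not> P 2 \<or> \<not> P 0 \<and> \<not> P (Suc 0) \<and> P 2"
proof -
  have "(\<exists>!i. i < (3 :: nat) \<and> P i) \<longleftrightarrow> (\<exists>i<3. P i \<and> (\<forall>j<3. P j \<longrightarrow> j = i))" by auto
  also have "\<dots> \<longleftrightarrow> (P 0 \<and> \<not> P (Suc 0) \<and> \<not> P 2 \<or> \<not> P 0 \<and> P (Suc 0) \<and> \<not> P 2 \<or> \<not> P 0 \<and> \<not> P (Suc 0) \<and> P 2)"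
    by (auto simp: numeral_3_eq_3 All_less_Suc Ex_less_Suc numeral_2_eq_2)
  finally show ?thesis .
qed

context
  fixes M :: "z2 ^ 2 ^ 2" and u :: z2
  assumes det: "det M = 2 * u" and u: "u dvd 1"
begin

lemma parity:
  "2 dvd M$1$1 * M$2$2 - M$1$2 * M$2$1"
  "\<not> (2 dvd M$1$1 \<and> 2 dvd M$1$2 \<and> 2 dvd M$2$1 \<and> 2 dvd M$2$2)"
proof -
  show "2 dvd M$1$1 * M$2$2 - M$1$2 * M$2$1" using det by (simp add: det_2)
  show "\<not> (2 dvd M$1$1 \<and> 2 dvd M$1$2 \<and> 2 dvd M$2$1 \<and> 2 dvd M$2$2)"
  proof
    assume *: "2 dvd M$1$1 \<and> 2 dvd M$1$2 \<and> 2 dvd M$2$1 \<and> 2 dvd M$2$2"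
    hence "2 * 2 dvd M$1$1 * M$2$2 - M$1$2 * M$2$1"
      by (intro dvd_diff mult_dvd_mono) auto
    hence "2 * 2 dvd 2 * u" using det by (simp add: det_2)
    then obtain k where "2 * u = 2 * (2 * k)" by (auto elim!: dvdE simp: mult.assoc)
    hence "u = 2 * k" by (simp only: mult_cancel_left) simp
    hence "2 dvd u" by simp
    thus False using u z2_unit_iff by blast
  qed
qed

text \<open>By \<open>parity\<close> the matrix has rank one modulo 2. Its column space is one of
  the three lines of the plane over the field with two elements, and these lines are the images of
  the \<open>gm j\<close> modulo 2.\<close>

lemma left_coset_ex1: "\<exists>!j. j < 3 \<and> (\<exists>N. M = gm j ** N)"
  unfolding ex1_less_3 left_coset_iff using parity unfolding z2_even_simps by blast

text \<open>Dually, the kernel modulo 2 is a single line, and \<open>M ** gm j\<close> is divisible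
  by 2 exactly when that line is the image of \<open>gm j\<close>.\<close>

lemma right_coset_ex1: "\<exists>!j. j < 3 \<and> (\<exists>N. M ** gm j = mat 2 ** N)"
  unfolding ex1_less_3 right_coset_iff using parity unfolding z2_even_simps by blast

end

text \<open>This is the double coset of \<open>gm 0\<close> under \<open>KZ\<close>:
  \<open>x ** g\<close> lies in it when \<open>g\<close> and the inverse of \<open>x\<close>
  represent neighbouring vertices of the tree.\<close>

definition ndist1 :: "mat_q2 \<Rightarrow> bool" where
  "ndist1 y \<longleftrightarrow> (\<exists>n M u. det M = 2 * u \<and> u dvd 1 \<and> y = pmat n M)"

lemma adjm_KZ:
  assumes "adjm j ** y \<in> KZ"
  obtains n N where "det N dvd 1" "y = pmat n (gm j ** N)"
proof -
  obtain m N where N: "det N dvd 1" "adjm j ** y = pmat m N" using assms by (auto simp: KZ_iff)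
  have "mat 2 ** y = gm j ** (adjm j ** y)" by (simp add: matrix_mul_assoc gm_adjm)
  also have "\<dots> = pmat m (gm j ** N)"
    using pmat_mult[of 0 "gm j" m N] by (simp add: N pmat_0)
  finally have "mat (1/2) ** (mat 2 ** y) = mat (1/2) ** pmat m (gm j ** N)" by simp
  moreover have "mat (1/2) ** (mat 2 ** y) = y"
    by (simp add: matrix_mul_assoc mat_mult_mat_2)
  moreover have "mat (1/2) ** pmat m (gm j ** N) = pmat (m - 1) (gm j ** N)"
    by (simp add: pmat_def matrix_mul_assoc mat_mult_mat_2 power_int_diff)
  ultimately show ?thesis using that N(1) by metis
qed

lemma KZ_gm:
  assumes "y ** gm i \<in> KZ"
  obtains n N where "det N dvd 1" "y = pmat n (N ** adjm i)"
proof -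
  obtain m N where N: "det N dvd 1" "y ** gm i = pmat m N" using assms by (auto simp: KZ_iff)
  have "mat 2 ** y = (y ** gm i) ** adjm i"
    by (simp add: matrix_mul_assoc[symmetric] gm_adjm mat_mult_commute_2)
  also have "\<dots> = pmat m (N ** adjm i)"
    using pmat_mult[of m N 0 "adjm i"] by (simp add: N pmat_0)
  finally have "mat (1/2) ** (mat 2 ** y) = mat (1/2) ** pmat m (N ** adjm i)" by simp
  moreover have "mat (1/2) ** (mat 2 ** y) = y"
    by (simp add: matrix_mul_assoc mat_mult_mat_2)
  moreover have "mat (1/2) ** pmat m (N ** adjm i) = pmat (m - 1) (N ** adjm i)"
    by (simp add: pmat_def matrix_mul_assoc mat_mult_mat_2 power_int_diff)
  ultimately show ?thesis using that N(1) by metis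
qed

lemma not_ndist1:
  assumes "\<not> ndist1 y"
  shows "adjm j ** y \<notin> KZ" "y ** gm i \<notin> KZ"
proof -
  show "adjm j ** y \<notin> KZ"
  proof
    assume "adjm j ** y \<in> KZ"
    then obtain n N where "det N dvd 1" "y = pmat n (gm j ** N)" by (rule adjm_KZ)
    hence "ndist1 y" unfolding ndist1_def by (intro exI[of _ n] exI[of _ "gm j ** N"] exI[of _ "det N"]) (simp add: det_mul)
    thus False using assms by simp
  qed
  show "y ** gm i \<notin> KZ"
  proof
    assume "y ** gm i \<in> KZ"
    then obtain n N where "det N dvd 1" "y = pmat n (N ** adjm i)" by (rule KZ_gm)
    hence "ndist1 y" unfolding ndist1_def by (intro exI[of _ n] exI[of _ "N ** adjm i"] exI[of _ "det N"]) (simp add: det_mul)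
    thus False using assms by simp
  qed
qed

lemma ndist1_left:
  assumes "det M = 2 * u" "u dvd 1" "y = pmat n M"
  obtains j N where "j < 3" "M = gm j ** N" "det N dvd 1" "adjm j ** y = pmat (n + 1) N"
    "\<And>j'. j' < 3 \<Longrightarrow> adjm j' ** y \<in> KZ \<longleftrightarrow> j' = j"
proof -
  obtain j N where j: "j < 3" "M = gm j ** N" using left_coset_ex1[OF assms(1,2)] by blast
  have "2 * det N = 2 * u" using assms(1) j(2) by (simp add: det_mul)
  hence N: "det N dvd 1" using assms(2) by simp
  have "adjm j ** pmat n (gm j ** N) = pmat n (adjm j ** (gm j ** N))"
    using pmat_mult[of 0 "adjm j" n] by (simp add: pmat_0)
  also have "adjm j ** (gm j ** N) = mat 2 ** N" by (simp add: matrix_mul_assoc gm_adjm)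
  also have "pmat n (mat 2 ** N) = pmat (n + 1) N"
    by (simp add: pmat_def zmat_mult matrix_mul_assoc mat_mult_mat_2 power_int_add)
  finally have 1: "adjm j ** y = pmat (n + 1) N" using assms j by simp
  have 2: "j' = j" if j': "j' < 3" "adjm j' ** y \<in> KZ" for j'
  proof -
    from j'(2) obtain n' N' where N': "det N' dvd 1" "y = pmat n' (gm j' ** N')" by (rule adjm_KZ)
    have "n = n' \<and> M = gm j' ** N'"
      using pmat_eq[of n M n' "gm j' ** N'" 2 u "det N'"] N' assms by (simp add: det_mul)
    thus ?thesis using left_coset_ex1[OF assms(1,2)] j j'(1) by blast
  qed
  show ?thesis
  proof (rule that[OF j N 1])
    fix j' :: nat assume "j' < 3"
    moreover have "adjm j ** y \<in> KZ" unfolding 1 by (rule KZ_pmat[OF N])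
    ultimately show "adjm j' ** y \<in> KZ \<longleftrightarrow> j' = j" using 2 by blast
  qed
qed

lemma ndist1_right:
  assumes "det M = 2 * u" "u dvd 1" "y = pmat n M"
  obtains i N where "i < 3" "M = N ** adjm i" "det N dvd 1" "y ** gm i = pmat (n + 1) N"
    "\<And>i'. i' < 3 \<Longrightarrow> y ** gm i' \<in> KZ \<longleftrightarrow> i' = i"
proof -
  obtain i N where i: "i < 3" "M ** gm i = mat 2 ** N" using right_coset_ex1[OF assms(1,2)] by blast
  have "mat 2 ** M = M ** gm i ** adjm i"
    by (simp add: matrix_mul_assoc[symmetric] gm_adjm mat_mult_commute_2)
  also have "\<dots> = mat 2 ** (N ** adjm i)" by (simp add: i matrix_mul_assoc)
  finally have M: "M = N ** adjm i" by (rule mat_2_cancel)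
  have "2 * det N = 2 * u" using assms(1) by (simp add: M det_mul)
  hence N: "det N dvd 1" using assms(2) by simp
  have "pmat n M ** gm i = pmat n (M ** gm i)"
    using pmat_mult[of n M 0 "gm i"] by (simp add: pmat_0)
  also have "\<dots> = pmat (n + 1) N" unfolding i(2)
    by (simp add: pmat_def zmat_mult matrix_mul_assoc mat_mult_mat_2 power_int_add)
  finally have 1: "y ** gm i = pmat (n + 1) N" using assms by simp
  have 2: "i' = i" if i': "i' < 3" "y ** gm i' \<in> KZ" for i'
  proof -
    from i'(2) obtain n' N' where N': "det N' dvd 1" "y = pmat n' (N' ** adjm i')" by (rule KZ_gm)
    have "n = n' \<and> M = N' ** adjm i'"
      using pmat_eq[of n M n' "N' ** adjm i'" 2 u "det N'"] N' assms by (simp add: det_mul)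
    hence "M ** gm i' = mat 2 ** N'"
      by (simp add: matrix_mul_assoc[symmetric] gm_adjm mat_mult_commute_2)
    thus ?thesis using right_coset_ex1[OF assms(1,2)] i i'(1) by blast
  qed
  show ?thesis
  proof (rule that[OF i(1) M N 1])
    fix i' :: nat assume "i' < 3"
    moreover have "y ** gm i \<in> KZ" unfolding 1 by (rule KZ_pmat[OF N])
    ultimately show "y ** gm i' \<in> KZ \<longleftrightarrow> i' = i" using 2 by blast
  qed
qed

subsection \<open>The action on polynomials\<close>

lemma sum_fun_apply: "(\<Sum>i\<in>A. F i) x = (\<Sum>i\<in>A. F i x)"
  by (induction A rule: infinite_finite_induct) auto

definition rho :: "'r :: comm_ring_1 ^ 2 ^ 2 \<Rightarrow> 'r poly poly \<Rightarrow> 'r poly poly" where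
  "rho M f = subst_XY f (CC (M$1$1) * XX + CC (M$2$1) * YY) (CC (M$1$2) * XX + CC (M$2$2) * YY)"

lemma rho_linear:
  "rho M 0 = 0" "rho M (f + g) = rho M f + rho M g" "rho M (f - g) = rho M f - rho M g"
  "rho M (- f) = - rho M f" "rho M (CC c * f) = CC c * rho M f" "rho M (CC c) = CC c"
  by (simp_all add: rho_def subst_XY_hom subst_XY_scale)

lemma rho_1 [simp]: "rho (mat 1) f = f"
  by (simp add: rho_def)

lemma rho_mult: "rho (M ** N) f = rho M (rho N f)"
proof -
  have [simp]: "subst_XY (CC c * f) P Q = CC c * subst_XY f P Q" for c :: 'a and f P Q
    by (rule subst_XY_scale)
  show ?thesis
    unfolding rho_def subst_XY_comp
    by (rule arg_cong2[where f = "subst_XY f"]; simp add: subst_XY_add; simp add: algebra_simps)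
qed

lemma linear_form_sym_pow: "CC a * XX + CC b * YY \<in> sym_pow 1"
  by (intro sym_pow_add sym_pow_scale sym_pow_XX sym_pow_YY)

lemma rho_sym_pow: "f \<in> sym_pow r \<Longrightarrow> rho M f \<in> sym_pow r"
  unfolding rho_def by (intro sym_pow_subst linear_form_sym_pow)

locale z2_algebra =
  fixes \<iota> :: "z2 \<Rightarrow> 'r :: comm_ring_1"
  assumes \<iota>_1 [simp]: "\<iota> 1 = 1" and \<iota>_add [simp]: "\<iota> (x + y) = \<iota> x + \<iota> y"
    and \<iota>_mult [simp]: "\<iota> (x * y) = \<iota> x * \<iota> y"
begin

lemma \<iota>_0 [simp]: "\<iota> 0 = 0"
  using \<iota>_add[of 0 0] by simp

lemma \<iota>_uminus [simp]: "\<iota> (- x) = - \<iota> x"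
  using \<iota>_add[of x "- x"] by (simp add: eq_neg_iff_add_eq_0 add.commute)

lemma \<iota>_2 [simp]: "\<iota> 2 = 2"
  using \<iota>_add[of 1 1] by simp

definition rh :: "z2 ^ 2 ^ 2 \<Rightarrow> 'r poly poly \<Rightarrow> 'r poly poly" where
  "rh M = rho (map_matrix \<iota> M)"

lemma rh_mult: "rh (M ** N) f = rh M (rh N f)"
proof -
  have "map_matrix \<iota> (M ** N) = map_matrix \<iota> M ** map_matrix \<iota> N"
    by (simp add: matrix_eq_iff_2)
  thus ?thesis by (simp add: rh_def rho_mult)
qed

lemma rh_1 [simp]: "rh (mat 1) f = f"
proof -
  have "map_matrix \<iota> (mat 1 :: z2 ^ 2 ^ 2) = mat 1" by (simp add: matrix_eq_iff_2)
  thus ?thesis by (simp add: rh_def)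
qed

lemma rh_linear [simp]:
  "rh M 0 = 0" "rh M (f + g) = rh M f + rh M g" "rh M (f - g) = rh M f - rh M g"
  "rh M (- f) = - rh M f" "rh M (CC c * f) = CC c * rh M f" "rh M (CC c) = CC c"
  by (simp_all add: rh_def rho_linear)

lemma rh_sym_pow: "f \<in> sym_pow r \<Longrightarrow> rh M f \<in> sym_pow r"
  by (simp add: rh_def rho_sym_pow)

lemma act_eq_rh: "act \<iota> h f = rh (KZ_part h) f"
  by (simp add: act_def rh_def rho_def Let_def)

lemma act_pmat: "det M dvd 1 \<Longrightarrow> act \<iota> (pmat n M) f = rh M f"
  by (simp add: act_eq_rh KZ_part_pmat)

lemma act_1 [simp]: "act \<iota> (mat 1) f = f"
  using act_pmat[of "mat 1" 0] by (simp add: pmat_0)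

lemma act_mult: "h \<in> KZ \<Longrightarrow> k \<in> KZ \<Longrightarrow> act \<iota> (h ** k) f = act \<iota> h (act \<iota> k f)"
  by (auto simp: KZ_iff pmat_mult act_pmat det_mul unit_mult_iff rh_mult)

lemma act_linear [simp]:
  "act \<iota> h 0 = 0" "act \<iota> h (f + g) = act \<iota> h f + act \<iota> h g"
  "act \<iota> h (f - g) = act \<iota> h f - act \<iota> h g"
  "act \<iota> h (- f) = - act \<iota> h f" "act \<iota> h (CC c * f) = CC c * act \<iota> h f" "act \<iota> h (CC c) = CC c"
  by (simp_all add: act_eq_rh)

lemma act_mat_2: "mat 2 \<in> KZ" "act \<iota> (mat 2) f = f"
proof -
  have eq: "mat 2 = pmat 1 (mat 1)" by (simp add: pmat_def)
  show "mat 2 \<in> KZ" unfolding eq by (rule KZ_pmat) simp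
  show "act \<iota> (mat 2) f = f" unfolding eq by (subst act_pmat) auto
qed

lemma brk_add: "brk \<iota> g (w + w') = brk \<iota> g w + brk \<iota> g w'"
  by (auto simp: brk_def fun_eq_iff)

lemma brk_diff: "brk \<iota> g (w - w') = brk \<iota> g w - brk \<iota> g w'"
  by (auto simp: brk_def fun_eq_iff)

lemma brk_0 [simp]: "brk \<iota> g 0 = 0"
  by (auto simp: brk_def fun_eq_iff)

lemma brk_scal: "brk \<iota> g (CC c * w) = scal c (brk \<iota> g w)"
  by (auto simp: brk_def fun_eq_iff scal_def)

text \<open>This allows a vertex to be represented differently; it is applied later to the scalar 2,
  to the flip and to the shear.\<close>

lemma brk_KZ:
  assumes "k \<in> KZ"
  shows "brk \<iota> (g ** k) w = brk \<iota> g (act \<iota> k w)"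
proof
  fix x
  have "x ** (g ** k) \<in> KZ \<longleftrightarrow> x ** g \<in> KZ"
  proof
    assume *: "x ** (g ** k) \<in> KZ"
    obtain k' where k': "k' \<in> KZ" "k ** k' = mat 1" using KZ_inverse[OF assms] by blast
    have "x ** (g ** k) ** k' = x ** (g ** (k ** k'))" by (simp add: matrix_mul_assoc)
    hence "x ** (g ** k) ** k' = x ** g" by (simp add: k')
    thus "x ** g \<in> KZ" using KZ_mult[OF * k'(1)] by simp
  next
    assume "x ** g \<in> KZ"
    thus "x ** (g ** k) \<in> KZ" using KZ_mult[of "x ** g" k] assms by (simp add: matrix_mul_assoc)
  qed
  thus "brk \<iota> (g ** k) w x = brk \<iota> g (act \<iota> k w) x"
    using act_mult[of "x ** g" k w] assms by (auto simp: brk_def matrix_mul_assoc)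
qed

end

text \<open>Only an additive group stable under invertible integral matrices is required. Thus the
  locale covers the symmetric powers over both coefficient fields, the integral lattice
  \<open>W\<close> and the kernel \<open>W0\<close> of q inside it, and all of them share the
  induction over brackets.\<close>

locale z2_submodule = z2_algebra \<iota> for \<iota> :: "z2 \<Rightarrow> 'r :: comm_ring_1" +
  fixes W :: "'r poly poly set"
  assumes W_0: "0 \<in> W" and W_add: "w \<in> W \<Longrightarrow> w' \<in> W \<Longrightarrow> w + w' \<in> W"
    and W_uminus: "w \<in> W \<Longrightarrow> - w \<in> W"
    and W_rh: "w \<in> W \<Longrightarrow> det M dvd 1 \<Longrightarrow> rh M w \<in> W"
begin

lemma W_act: "w \<in> W \<Longrightarrow> h \<in> KZ \<Longrightarrow> act \<iota> h w \<in> W"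
  by (auto simp: KZ_iff act_pmat W_rh)

lemma cind_0: "0 \<in> cind \<iota> W"
  by (auto simp: cind_def W_0)

lemma cind_add:
  assumes "f \<in> cind \<iota> W" "f' \<in> cind \<iota> W"
  shows "f + f' \<in> cind \<iota> W"
proof -
  obtain S S' where S: "finite S" "\<And>g. f g \<noteq> 0 \<Longrightarrow> \<exists>h\<in>KZ. \<exists>s\<in>S. g = h ** s"
    and S': "finite S'" "\<And>g. f' g \<noteq> 0 \<Longrightarrow> \<exists>h\<in>KZ. \<exists>s\<in>S'. g = h ** s"
    using assms unfolding cind_def by blast
  have "\<exists>h\<in>KZ. \<exists>s\<in>S \<union> S'. g = h ** s" if "(f + f') g \<noteq> 0" for g
  proof -
    have "f g \<noteq> 0 \<or> f' g \<noteq> 0" using that by auto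
    thus ?thesis using S(2)[of g] S'(2)[of g] by blast
  qed
  hence "\<exists>S. finite S \<and> (\<forall>g. (f + f') g \<noteq> 0 \<longrightarrow> (\<exists>h\<in>KZ. \<exists>s\<in>S. g = h ** s))"
    using S(1) S'(1) by (intro exI[of _ "S \<union> S'"]) auto
  thus ?thesis using assms unfolding cind_def by (auto intro: W_add)
qed

lemma cind_uminus: "f \<in> cind \<iota> W \<Longrightarrow> - f \<in> cind \<iota> W"
  unfolding cind_def by (auto intro: W_uminus)

lemma cind_diff: "f \<in> cind \<iota> W \<Longrightarrow> f' \<in> cind \<iota> W \<Longrightarrow> f - f' \<in> cind \<iota> W"
  using cind_add[of f "- f'"] cind_uminus by simp

lemma cind_trans:
  assumes "f \<in> cind \<iota> W" "g \<in> GL2_q2"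
  shows "trans g f \<in> cind \<iota> W"
proof -
  obtain S where S: "finite S" "\<And>g. f g \<noteq> 0 \<Longrightarrow> \<exists>h\<in>KZ. \<exists>s\<in>S. g = h ** s"
    using assms unfolding cind_def by blast
  obtain g' where g': "g ** g' = mat 1" using GL2_inverse[OF assms(2)] by blast
  have "\<exists>h\<in>KZ. \<exists>s\<in>(\<lambda>s. s ** g') ` S. x = h ** s" if x: "trans g f x \<noteq> 0" for x
  proof -
    obtain h s where "h \<in> KZ" "s \<in> S" "x ** g = h ** s"
      using S(2)[of "x ** g"] x unfolding trans_def by blast
    hence "x ** (g ** g') = h ** (s ** g')" by (simp add: matrix_mul_assoc)
    thus ?thesis using \<open>h \<in> KZ\<close> \<open>s \<in> S\<close> g' by auto
  qed
  hence "\<exists>S. finite S \<and> (\<forall>x. trans g f x \<noteq> 0 \<longrightarrow> (\<exists>h\<in>KZ. \<exists>s\<in>S. x = h ** s))"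
    using S(1) by (intro exI[of _ "(\<lambda>s. s ** g') ` S"]) auto
  thus ?thesis using assms unfolding cind_def trans_def
    by (auto simp: matrix_mul_assoc[symmetric])
qed

lemma brk_in_cind:
  assumes "g \<in> GL2_q2" "w \<in> W"
  shows "brk \<iota> g w \<in> cind \<iota> W"
proof -
  obtain g' where g': "g' ** g = mat 1" "g ** g' = mat 1" using GL2_inverse[OF assms(1)] by blast
  have GL: "x \<in> GL2_q2" if "x ** g \<in> KZ" for x
    using KZ_GL2[OF that] by simp
  have eq: "x = x ** g ** g'" for x
    using g' by (simp add: matrix_mul_assoc[symmetric])
  have "\<exists>S. finite S \<and> (\<forall>x. brk \<iota> g w x \<noteq> 0 \<longrightarrow> (\<exists>h\<in>KZ. \<exists>s\<in>S. x = h ** s))"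
    using eq by (intro exI[of _ "{g'}"]) (auto simp: brk_def split: if_splits)
  thus ?thesis
    using GL assms unfolding cind_def brk_def
    by (auto intro: W_act W_0 simp: KZ_mult_iff act_mult matrix_mul_assoc[symmetric])
qed

text \<open>The proof removes one coset of the support at a time.\<close>

lemma cind_induct [consumes 1, case_names zero brk add]:
  assumes "f \<in> cind \<iota> W"
    and zero: "Q 0"
    and brk: "\<And>g w. g \<in> GL2_q2 \<Longrightarrow> w \<in> W \<Longrightarrow> Q (brk \<iota> g w)"
    and add: "\<And>f f'. f \<in> cind \<iota> W \<Longrightarrow> f' \<in> cind \<iota> W \<Longrightarrow> Q f \<Longrightarrow> Q f' \<Longrightarrow> Q (f + f')"
  shows "Q f"
proof -
  obtain S where S: "finite S" "\<And>g. f g \<noteq> 0 \<Longrightarrow> \<exists>h\<in>KZ. \<exists>s\<in>S. g = h ** s"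
    using assms(1) unfolding cind_def by blast
  thus ?thesis using assms(1)
  proof (induction S arbitrary: f rule: finite_induct)
    case empty
    hence "f = 0" by (auto simp: fun_eq_iff)
    thus ?case using zero by (simp only:)
  next
    case (insert s S f)
    show ?case
    proof (cases "s \<in> GL2_q2")
      case False
      have "\<exists>h\<in>KZ. \<exists>s\<in>S. g = h ** s" if g: "f g \<noteq> 0" for g
      proof -
        have "g \<in> GL2_q2" using g insert.prems(2) by (auto simp: cind_def)
        moreover obtain h s' where "h \<in> KZ" "s' \<in> insert s S" "g = h ** s'"
          using insert.prems(1)[OF g] by blast
        ultimately show ?thesis using False by auto
      qed
      thus ?thesis using insert.IH insert.prems(2) by blast
    next
      case s: True
      obtain s' where s': "s' \<in> GL2_q2" "s ** s' = mat 1" "s' ** s = mat 1" using GL2_inverse[OF s] by blast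
      let ?b = "brk \<iota> s' (f s)"
      have fs: "f s \<in> W" using insert.prems(2) s by (auto simp: cind_def)
      have b: "?b \<in> cind \<iota> W" by (rule brk_in_cind[OF s'(1) fs])
      have f: "f - ?b \<in> cind \<iota> W" by (rule cind_diff[OF insert.prems(2) b])
      have bs: "?b (h ** s) = f (h ** s)" if "h \<in> KZ" for h
      proof -
        have "h ** s ** s' = h" by (simp add: matrix_mul_assoc[symmetric] s')
        thus ?thesis using that insert.prems(2) s by (auto simp: brk_def cind_def)
      qed
      have "\<exists>h\<in>KZ. \<exists>s\<in>S. g = h ** s" if "(f - ?b) g \<noteq> 0" for g
      proof -
        have ng: "g \<noteq> h ** s" if "h \<in> KZ" for h
          using bs[OF that] \<open>(f - ?b) g \<noteq> 0\<close> by auto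
        have "?b g = 0"
        proof (rule ccontr)
          assume "?b g \<noteq> 0"
          hence "g ** s' \<in> KZ" by (auto simp: brk_def split: if_splits)
          moreover have "g = (g ** s') ** s" by (simp add: matrix_mul_assoc[symmetric] s')
          ultimately show False using ng by blast
        qed
        hence "f g \<noteq> 0" using that by auto
        from insert.prems(1)[OF this] ng show ?thesis by blast
      qed
      hence "Q (f - ?b)" using insert.IH f by blast
      hence "Q (f - ?b + ?b)" by (intro add brk f b s' fs)
      thus ?thesis by simp
    qed
  qed
qed

end

lemma (in z2_algebra) sym_pow_submodule: "z2_submodule \<iota> (sym_pow r)"
  by unfold_locales (auto intro: sym_pow_add sym_pow_uminus rh_sym_pow)

subsection \<open>Existence of the Hecke operator\<close>

context z2_algebra
begin

text \<open>The Hecke operator as a sum over left translates of the argument. This formula makes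
  sense for every function on matrices, so linearity and equivariance are immediate; the geometry of
  the tree enters only in \<open>hk_brk\<close>.\<close>

definition hk :: "(mat_q2 \<Rightarrow> 'r poly poly) \<Rightarrow> mat_q2 \<Rightarrow> 'r poly poly" where
  "hk f x = (\<Sum>j<3. rh (gm j) (f (adjm j ** x)))"

lemma hk_add: "hk (f + f') = hk f + hk f'"
  by (auto simp: hk_def fun_eq_iff sum.distrib)

lemma hk_0: "hk 0 = 0"
  by (auto simp: hk_def fun_eq_iff)

lemma hk_scal: "hk (scal c f) = scal c (hk f)"
  by (auto simp: hk_def fun_eq_iff scal_def sum_distrib_left)

lemma hk_trans: "hk (trans g f) = trans g (hk f)"
  by (auto simp: hk_def fun_eq_iff trans_def matrix_mul_assoc)

text \<open>At each \<open>x\<close> both sides have at most one nonzero summand. If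
  \<open>y = x ** g\<close> is a power of 2 times \<open>M\<close> with determinant twice a unit,
  the unique factorisations \<open>M = gm j ** N\<close> and \<open>M = N' ** adjm i\<close> turn
  both summands into \<open>rh M w\<close>.\<close>

lemma hk_brk: "hk (brk \<iota> g w) = (\<Sum>i<3. brk \<iota> (g ** gm i) (rh (adjm i) w))"
proof
  fix x :: mat_q2
  define y where "y = x ** g"
  have 1: "hk (brk \<iota> g w) x =
      (\<Sum>j<3. if adjm j ** y \<in> KZ then rh (gm j) (act \<iota> (adjm j ** y) w) else 0)"
    unfolding hk_def by (intro sum.cong) (auto simp: brk_def y_def matrix_mul_assoc)
  have 2: "(\<Sum>i<3. brk \<iota> (g ** gm i) (rh (adjm i) w)) x =
      (\<Sum>i<3. if y ** gm i \<in> KZ then act \<iota> (y ** gm i) (rh (adjm i) w) else 0)"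
    unfolding sum_fun_apply by (intro sum.cong) (auto simp: brk_def y_def matrix_mul_assoc)
  show "hk (brk \<iota> g w) x = (\<Sum>i<3. brk \<iota> (g ** gm i) (rh (adjm i) w)) x"
  proof (cases "ndist1 y")
    case False
    thus ?thesis unfolding 1 2 by (simp add: not_ndist1)
  next
    case True
    then obtain n M u where M: "det M = 2 * u" "u dvd 1" "y = pmat n M" by (auto simp: ndist1_def)
    obtain j N where j: "j < 3" "M = gm j ** N" "det N dvd 1" "adjm j ** y = pmat (n + 1) N"
      "\<And>j'. j' < 3 \<Longrightarrow> adjm j' ** y \<in> KZ \<longleftrightarrow> j' = j"
      using ndist1_left[OF M] by blast
    obtain i N' where i: "i < 3" "M = N' ** adjm i" "det N' dvd 1" "y ** gm i = pmat (n + 1) N'"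
      "\<And>i'. i' < 3 \<Longrightarrow> y ** gm i' \<in> KZ \<longleftrightarrow> i' = i"
      using ndist1_right[OF M] by blast
    have "hk (brk \<iota> g w) x = (\<Sum>j'<3. if j' = j then rh (gm j) (act \<iota> (adjm j ** y) w) else 0)"
      unfolding 1 by (intro sum.cong) (auto simp: j(5))
    also have "\<dots> = rh M w" using j(1) by (simp add: j(4) act_pmat[OF j(3)] j(2) rh_mult)
    also have "\<dots> = (\<Sum>i'<3. if i' = i then act \<iota> (y ** gm i) (rh (adjm i) w) else 0)"
      using i(1) by (simp add: i(4) act_pmat[OF i(3)] i(2) rh_mult)
    also have "\<dots> = (\<Sum>i<3. brk \<iota> (g ** gm i) (rh (adjm i) w)) x"
      unfolding 2 by (intro sum.cong) (auto simp: i(5))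
    finally show ?thesis .
  qed
qed

lemma hecke_terms:
  "(\<Sum>\<mu>\<in>{0, 1 :: nat}.
      brk \<iota> (g ** mat22 2 (of_nat \<mu>) 0 1) (subst_XY w XX (2 * YY - of_nat \<mu> * XX)))
    + brk \<iota> (g ** mat22 1 0 0 2) (subst_XY w (2 * XX) YY) =
   (\<Sum>i<3. brk \<iota> (g ** gm i) (rh (adjm i) w))"
proof -
  have "rh (adjm 0) w = subst_XY w XX (2 * YY)"
    "rh (adjm (Suc 0)) w = subst_XY w XX (2 * YY - XX)"
    "rh (adjm 2) w = subst_XY w (2 * XX) YY"
    by (simp_all add: rh_def rho_def adjm_def)
  thus ?thesis by (simp add: eval_nat_numeral gm_def)
qed

lemma scal_cind: "f \<in> cind \<iota> (sym_pow r) \<Longrightarrow> scal c f \<in> cind \<iota> (sym_pow r)"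
  unfolding cind_def scal_def by (auto intro: sym_pow_scale) (metis mult_zero_right)

lemma hk_cind:
  assumes "f \<in> cind \<iota> (sym_pow r)"
  shows "hk f \<in> cind \<iota> (sym_pow r)"
proof -
  interpret z2_submodule \<iota> "sym_pow r" by (rule sym_pow_submodule)
  show ?thesis using assms
  proof (induction rule: cind_induct)
    case zero
    show ?case unfolding hk_0 by (rule cind_0)
  next
    case (brk g w)
    have "(\<Sum>i\<in>A. brk \<iota> (g ** gm i) (rh (adjm i) w)) \<in> cind \<iota> (sym_pow r)" for A :: "nat set"
    proof (induction A rule: infinite_finite_induct)
      case (insert i A)
      have "brk \<iota> (g ** gm i) (rh (adjm i) w) \<in> cind \<iota> (sym_pow r)"
        using brk by (intro brk_in_cind rh_sym_pow) auto
      thus ?case unfolding sum.insert[OF insert(1,2)] using insert(3) by (rule cind_add)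
    qed (simp_all only: sum.infinite sum.empty cind_0 not_False_eq_True)
    thus ?case unfolding hk_brk .
  next
    case (add f f')
    thus ?case unfolding hk_add by (intro cind_add)
  qed
qed

text \<open>The cut-off matches the normalisation in \<open>hecke\<close>, which prescribes the
  value 0 outside the induced representation.\<close>

definition hk0 :: "nat \<Rightarrow> (mat_q2 \<Rightarrow> 'r poly poly) \<Rightarrow> mat_q2 \<Rightarrow> 'r poly poly" where
  "hk0 r f = (if f \<in> cind \<iota> (sym_pow r) then hk f else 0)"

lemma is_hecke_hk0: "is_hecke \<iota> r (hk0 r)"
proof -
  interpret z2_submodule \<iota> "sym_pow r" by (rule sym_pow_submodule)
  show ?thesis unfolding is_hecke_def hecke_terms
    by (simp add: hk0_def hk_cind cind_add hk_add hk_scal scal_cind hk_trans cind_trans brk_in_cind hk_brk)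
qed

text \<open>Uniqueness: brackets generate the induction additively, so additivity and the values on
  brackets determine the operator.\<close>

lemma hecke_eq_hk0: "hecke \<iota> r = hk0 r"
  unfolding hecke_def
proof (rule the_equality)
  show "is_hecke \<iota> r (hk0 r) \<and> (\<forall>f. f \<notin> cind \<iota> (sym_pow r) \<longrightarrow> hk0 r f = 0)"
    using is_hecke_hk0 by (simp add: hk0_def)
next
  interpret z2_submodule \<iota> "sym_pow r" by (rule sym_pow_submodule)
  fix T assume T: "is_hecke \<iota> r T \<and> (\<forall>f. f \<notin> cind \<iota> (sym_pow r) \<longrightarrow> T f = 0)"
  have T_add: "T (f + f') = T f + T f'" if "f \<in> cind \<iota> (sym_pow r)" "f' \<in> cind \<iota> (sym_pow r)" for f f'
    using T that unfolding is_hecke_def by blast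
  have T_brk: "T (brk \<iota> g w) = (\<Sum>i<3. brk \<iota> (g ** gm i) (rh (adjm i) w))"
    if "g \<in> GL2_q2" "w \<in> sym_pow r" for g w
    using T that unfolding is_hecke_def hecke_terms by blast
  have "T f = hk f" if "f \<in> cind \<iota> (sym_pow r)" for f
    using that
  proof (induction rule: cind_induct)
    case zero
    have "T 0 = 0" using T_add[OF cind_0 cind_0] by (simp only: add_0_left) (metis add_cancel_right_right)
    thus ?case by (simp only: hk_0)
  next
    case (brk g w)
    thus ?case by (simp add: T_brk hk_brk)
  next
    case (add f f')
    thus ?case by (simp only: T_add hk_add)
  qed
  thus "T = hk0 r" using T by (auto simp: hk0_def)
qed

lemma hecke_eq_hk: "f \<in> cind \<iota> (sym_pow r) \<Longrightarrow> hecke \<iota> r f = hk f"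
  by (simp add: hecke_eq_hk0 hk0_def)

end

subsection \<open>The valuation\<close>

lemma nat_odd_part: "n > 0 \<Longrightarrow> \<exists>k m. odd m \<and> n = 2 ^ k * (m :: nat)"
proof (induction n rule: less_induct)
  case (less n)
  show ?case
  proof (cases "even n")
    case True
    then obtain b where b: "n = 2 * b" by auto
    then obtain k m where "odd m" "b = 2 ^ k * m" using less.IH[of b] less.prems by auto
    thus ?thesis using b by (intro exI[of _ "Suc k"] exI[of _ m]) simp
  next
    case False
    thus ?thesis by (intro exI[of _ 0] exI[of _ n]) simp
  qed
qed

locale valuation2 =
  fixes v :: "qbar2 \<Rightarrow> ereal"
  assumes v: "two_adic_valuation v"
begin

lemma v_mult: "v (x * y) = v x + v y"
  using v by (simp add: two_adic_valuation_def)

lemma v_add: "min (v x) (v y) \<le> v (x + y)"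
  using v by (simp add: two_adic_valuation_def)

lemma v_eq_inf_iff: "v x = \<infinity> \<longleftrightarrow> x = 0"
  using v by (simp add: two_adic_valuation_def)

lemma v_0 [simp]: "v 0 = \<infinity>"
  by (simp add: v_eq_inf_iff)

lemma v_finite: "x \<noteq> 0 \<Longrightarrow> \<exists>s. v x = ereal s"
  using v v_eq_inf_iff[of x] by (cases "v x") (auto simp: two_adic_valuation_def)

lemma v_z2_unit: "u dvd 1 \<Longrightarrow> v (z2_qbar2 (u * 2 ^ n)) = ereal n"
  using v unfolding two_adic_valuation_def by blast

lemma v_1 [simp]: "v 1 = 0"
  using v_z2_unit[of 1 0] by (simp del: z2_qbar2_hom add: z2_qbar2_hom(2) zero_ereal_def)

lemma v_2 [simp]: "v 2 = 1"
  using v_z2_unit[of 1 1] by (simp add: one_ereal_def)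

lemma v_uminus [simp]: "v (- x) = v x"
proof (cases "x = 0")
  case False
  have "v (- 1 * - 1) = 0" by simp
  hence "v (- 1) + v (- 1) = 0" unfolding v_mult .
  moreover obtain s where "v (- 1) = ereal s" using v_finite[of "- 1"] by auto
  ultimately have "v (- 1) = 0" by (simp add: zero_ereal_def)
  thus ?thesis using v_mult[of "- 1" x] by simp
qed auto

lemma v_z2: "0 \<le> v (z2_qbar2 z)"
proof (cases "z = 0")
  case False
  then obtain u n where "u dvd 1" "z = u * 2 ^ n" using z2_eq_unit_power by blast
  thus ?thesis using v_z2_unit by simp
qed auto

definition vge :: "real \<Rightarrow> qbar2 set" where
  "vge s = {x. ereal s \<le> v x}"

definition vgt :: "real \<Rightarrow> qbar2 set" where
  "vgt s = {x. ereal s < v x}"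

lemma vge_0 [simp]: "0 \<in> vge s" and vgt_0 [simp]: "0 \<in> vgt s"
  by (simp_all add: vge_def vgt_def)

lemma vge_mult: "x \<in> vge s \<Longrightarrow> y \<in> vge t \<Longrightarrow> x * y \<in> vge (s + t)"
  using add_mono[of "ereal s" "v x" "ereal t" "v y"] by (simp add: vge_def v_mult)

lemma vgt_mult: "x \<in> vgt s \<Longrightarrow> y \<in> vge t \<Longrightarrow> x * y \<in> vgt (s + t)"
  unfolding vge_def vgt_def mem_Collect_eq v_mult
  by (cases "v x"; cases "v y") auto

lemma vge_add: "x \<in> vge s \<Longrightarrow> y \<in> vge s \<Longrightarrow> x + y \<in> vge s"
  using v_add[of x y] by (auto simp: vge_def min_le_iff_disj intro: order.trans)

lemma vgt_add: "x \<in> vgt s \<Longrightarrow> y \<in> vgt s \<Longrightarrow> x + y \<in> vgt s"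
  using v_add[of x y] by (auto simp: vgt_def min_le_iff_disj intro: less_le_trans)

lemma vge_uminus [simp]: "- x \<in> vge s \<longleftrightarrow> x \<in> vge s" and vgt_uminus [simp]: "- x \<in> vgt s \<longleftrightarrow> x \<in> vgt s"
  by (simp_all add: vge_def vgt_def)

lemma vge_diff: "x \<in> vge s \<Longrightarrow> y \<in> vge s \<Longrightarrow> x - y \<in> vge s"
  using vge_add[of x s "- y"] by simp

lemma vgt_diff: "x \<in> vgt s \<Longrightarrow> y \<in> vgt s \<Longrightarrow> x - y \<in> vgt s"
  using vgt_add[of x s "- y"] by simp

lemma vge_mono: "x \<in> vge s \<Longrightarrow> t \<le> s \<Longrightarrow> x \<in> vge t"
  using order.trans[of "ereal t" "ereal s" "v x"] by (simp add: vge_def)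

lemma vgt_if_vge: "x \<in> vge s \<Longrightarrow> t < s \<Longrightarrow> x \<in> vgt t"
  using less_le_trans[of "ereal t" "ereal s" "v x"] by (simp add: vge_def vgt_def)

lemma vge_if_vgt: "x \<in> vgt s \<Longrightarrow> x \<in> vge s"
  by (simp add: vge_def vgt_def)

lemma vge_I: "v x = ereal s \<Longrightarrow> x \<in> vge s"
  by (simp add: vge_def)

lemma zbar2_eq: "zbar2 v = vge 0" and max_ideal_eq: "max_ideal v = vgt 0"
  by (simp_all add: zbar2_def max_ideal_def vge_def vgt_def zero_ereal_def)

lemma vge_1: "1 \<in> vge 0" and vge_2: "2 \<in> vge 1"
  by (simp_all add: vge_def)

lemma vge_power: "x \<in> vge s \<Longrightarrow> x ^ n \<in> vge (real n * s)"
proof (induction n)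
  case (Suc n)
  thus ?case using vge_mult[of x s "x ^ n" "real n * s"] by (simp add: algebra_simps)
qed (simp add: vge_1)

lemma vge_2_power: "2 ^ n \<in> vge (real n)"
  using vge_power[OF vge_2, of n] by simp

lemma subring_zbar2: "subring_set (zbar2 v)"
  using vge_mult[of _ 0 _ 0] by unfold_locales (auto simp: zbar2_eq vge_1 vge_add)

lemma vge_of_nat: "of_nat n \<in> vge 0"
  by (induction n) (auto intro: vge_add vge_1)

lemma vge_even: "even n \<Longrightarrow> of_nat n \<in> vge 1"
  by (elim evenE) (use vge_mult[OF vge_2 vge_of_nat] in auto)

lemma v_odd: "odd n \<Longrightarrow> v (of_nat n) = 0"
proof -
  assume "odd n"
  then obtain m where m: "n = 2 * m + 1" by (elim oddE)
  have "\<not> 0 < v (of_nat n)"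
  proof
    assume "0 < v (of_nat n)"
    hence "of_nat n \<in> vgt 0" by (simp add: vgt_def zero_ereal_def)
    moreover have "2 * of_nat m \<in> vgt 0"
      using vge_mult[OF vge_2 vge_of_nat, of m] by (auto intro: vgt_if_vge)
    ultimately have "of_nat n - 2 * of_nat m \<in> vgt 0" by (rule vgt_diff)
    thus False by (simp add: m vgt_def)
  qed
  thus ?thesis using vge_of_nat[of n] by (auto simp: vge_def zero_ereal_def)
qed

lemma v_power: "v x = ereal s \<Longrightarrow> v (x ^ n) = ereal (real n * s)"
  by (induction n) (auto simp: v_mult algebra_simps zero_ereal_def)

lemma v_of_nat:
  assumes "n > 0"
  obtains k m where "odd m" "n = 2 ^ k * m" "v (of_nat n) = ereal (real k)"
proof -
  obtain k m where km: "odd m" "n = 2 ^ k * m"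
    using nat_odd_part[OF assms] by blast
  have "v (2 ^ k) = ereal (real k)" using v_power[of 2 1 k] by (simp add: one_ereal_def)
  hence "v (of_nat n) = ereal (real k)" using v_odd[OF km(1)] by (simp add: km(2) v_mult)
  thus ?thesis using that km by blast
qed

lemma of_nat_neq_0: "n > 0 \<Longrightarrow> (of_nat n :: qbar2) \<noteq> 0"
  by (rule v_of_nat[of n]) (auto simp: v_eq_inf_iff[symmetric])

lemma two_neq_0: "(2 :: qbar2) \<noteq> 0"
  using of_nat_neq_0[of 2] by simp

lemma v_inverse: "v x = ereal s \<Longrightarrow> v (inverse x) = ereal (- s)"
proof -
  assume x: "v x = ereal s"
  hence "x \<noteq> 0" by auto
  hence "v x + v (inverse x) = 0" using v_mult[of x "inverse x"] by simp
  thus ?thesis unfolding x by (cases "v (inverse x)") (auto simp: zero_ereal_def)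
qed

lemma vge_divide: "x \<in> vge s \<Longrightarrow> v y = ereal t \<Longrightarrow> x / y \<in> vge (s - t)"
  using vge_mult[of x s "inverse y" "- t"] v_inverse[of y t] by (simp add: divide_inverse vge_I)

lemma v_add_eq:
  assumes "v x = ereal s" "y \<in> vgt s"
  shows "v (x + y) = ereal s"
proof -
  have "ereal s \<le> v (x + y)"
    using vge_add[of x s y] assms vge_if_vgt by (auto simp: vge_def)
  moreover have "\<not> ereal s < v (x + y)"
  proof
    assume "ereal s < v (x + y)"
    hence "x + y \<in> vgt s" by (simp add: vgt_def)
    from vgt_diff[OF this assms(2)] show False using assms(1) by (simp add: vgt_def)
  qed
  ultimately show ?thesis by auto
qed

end

subsection \<open>The lattice and the relations\<close>

lemma scal_simps:
  "scal c (f + g) = scal c f + scal c g" "scal c (f - g) = scal c f - scal c g"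
  "scal c (- f) = - scal c f" "scal (c + d) f = scal c f + scal d f"
  "scal (c - d) f = scal c f - scal d f" "scal (- c) f = - scal c f"
  "scal c (scal d f) = scal (c * d) f" "scal 1 f = f" "scal 0 f = 0" "scal c 0 = 0"
  by (auto simp: scal_def fun_eq_iff algebra_simps)

lemma trans_simps:
  "trans g (f + f') = trans g f + trans g f'" "trans g (f - f') = trans g f - trans g f'"
  "trans g (scal c k) = scal c (trans g k)"
  for f f' :: "mat_q2 \<Rightarrow> 'a :: ab_group_add" and k :: "mat_q2 \<Rightarrow> 'r :: comm_ring_1 poly poly"
  by (auto simp: trans_def scal_def fun_eq_iff)

interpretation qb: z2_algebra z2_qbar2
  by unfold_locales auto

interpretation qbs: z2_submodule z2_qbar2 "sym_pow r" for r
  by (rule qb.sym_pow_submodule)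

locale slope01 = valuation2 v for v :: "qbar2 \<Rightarrow> ereal" +
  fixes red :: "qbar2 \<Rightarrow> 'f :: field" and r :: nat and a :: qbar2 and \<alpha> :: real
  assumes red: "reduction_map v red" and r2: "r \<ge> 2"
    and va: "v a = ereal \<alpha>" and \<alpha>_pos: "0 < \<alpha>" and \<alpha>_less: "\<alpha> < 1"
begin

sublocale zb: subring_set "zbar2 v"
  by (rule subring_zbar2)

sublocale rd: partial_ring_hom "zbar2 v" red
  using red by unfold_locales (auto simp: reduction_map_def)

lemma red_eq_0_iff: "x \<in> zbar2 v \<Longrightarrow> red x = 0 \<longleftrightarrow> x \<in> max_ideal v"
  using red unfolding reduction_map_def by blast

lemma red_surj: "\<exists>x\<in>zbar2 v. red x = y"
proof -
  have "y \<in> red ` zbar2 v" using red unfolding reduction_map_def by simp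
  thus ?thesis by auto
qed

lemma z2_zbar2: "z2_qbar2 z \<in> zbar2 v"
  using v_z2 by (simp add: zbar2_def)

sublocale rs: z2_algebra "z2_res red"
  by unfold_locales (simp_all add: z2_res_def rd.h_1 rd.h_add rd.h_mult z2_zbar2)

sublocale rss: z2_submodule "z2_res red" "sym_pow n" for n
  by (rule rs.sym_pow_submodule)

lemma red_2: "red 2 = 0"
  using red_eq_0_iff[of 2] by (simp add: zbar2_def max_ideal_def)

lemma residue_2 [simp]: "(2 :: 'f) = 0"
  using rd.h_add[OF zb.one zb.one] red_2 by (simp add: rd.h_1)

lemma residue_add_self: "x + x = (0 :: 'f)"
  by (metis mult_2 mult_zero_left residue_2)

lemma a_neq_0: "a \<noteq> 0"
  using va by auto

lemma a_vge: "a \<in> vge \<alpha>"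
  by (rule vge_I[OF va])

abbreviation W :: "qbar2 poly poly set" where "W \<equiv> sym_pow_zbar2 v r"

lemma W_iff: "w \<in> W \<longleftrightarrow> w \<in> sym_pow r \<and> coeffs_in (zbar2 v) w"
  by (auto simp: sym_pow_zbar2_def coeffs_in_def)

lemma coeffs_in_rh: "coeffs_in (zbar2 v) w \<Longrightarrow> coeffs_in (zbar2 v) (qb.rh M w)"
  unfolding qb.rh_def rho_def
  by (intro zb.coeffs_in_subst zb.coeffs_in_add zb.coeffs_in_mult zb.coeffs_in_CC zb.coeffs_in_XX
      zb.coeffs_in_YY) (simp_all add: z2_zbar2)

sublocale lat: z2_submodule z2_qbar2 W
  by unfold_locales (auto simp: W_iff intro: sym_pow_add sym_pow_uminus zb.coeffs_in_0 zb.coeffs_in_add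
      zb.coeffs_in_uminus qb.rh_sym_pow coeffs_in_rh)

abbreviation L :: "ind_qbar2 set" where "L \<equiv> lattice_ind v r"

lemmas L_add = lat.cind_add[folded lattice_ind_def]
lemmas L_0 = lat.cind_0[folded lattice_ind_def]
lemmas L_trans = lat.cind_trans[folded lattice_ind_def]
lemmas L_brk = lat.brk_in_cind[folded lattice_ind_def]

lemma W_scale: "c \<in> zbar2 v \<Longrightarrow> w \<in> W \<Longrightarrow> CC c * w \<in> W"
  by (auto simp: W_iff intro: sym_pow_scale zb.coeffs_in_mult zb.coeffs_in_CC)

lemma W_diff: "w \<in> W \<Longrightarrow> w' \<in> W \<Longrightarrow> w - w' \<in> W"
  using lat.W_add[of w "- w'"] lat.W_uminus by simp

lemma W_sum: "(\<And>x. x \<in> A \<Longrightarrow> f x \<in> W) \<Longrightarrow> (\<Sum>x\<in>A. f x) \<in> W"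
  by (induction A rule: infinite_finite_induct) (auto intro: lat.W_0 lat.W_add)

lemma L_scal: "c \<in> zbar2 v \<Longrightarrow> l \<in> L \<Longrightarrow> scal c l \<in> L"
  unfolding lattice_ind_def cind_def scal_def
  by (auto intro: W_scale)

lemma L_cind: "l \<in> L \<Longrightarrow> l \<in> cind z2_qbar2 (sym_pow r)"
  unfolding lattice_ind_def cind_def by (auto simp: W_iff)

text \<open>This is \<open>(T - a) ind + I L\<close>: as the values are totally ordered, the lattice part needs only one
  scalar and one element.\<close>

definition Zset :: "qbar2 set \<Rightarrow> ind_qbar2 set" where
  "Zset I = {qb.hk h - scal a h + scal d l | h d l. h \<in> cind z2_qbar2 (sym_pow r) \<and> d \<in> I \<and> l \<in> L}"

lemma ZsetI:
  "h \<in> cind z2_qbar2 (sym_pow r) \<Longrightarrow> d \<in> I \<Longrightarrow> l \<in> L \<Longrightarrow> f = qb.hk h - scal a h + scal d l \<Longrightarrow> f \<in> Zset I"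
  unfolding Zset_def by blast

lemma ZsetE:
  assumes "f \<in> Zset I"
  obtains h d l where "h \<in> cind z2_qbar2 (sym_pow r)" "d \<in> I" "l \<in> L" "f = qb.hk h - scal a h + scal d l"
  using assms unfolding Zset_def by blast

lemma Zset_mono: "I \<subseteq> J \<Longrightarrow> f \<in> Zset I \<Longrightarrow> f \<in> Zset J"
  unfolding Zset_def by blast

text \<open>Such a set is a \<open>zbar2 v\<close>-submodule, by the ultrametric inequality. It
  covers \<open>vge s\<close> and \<open>vgt s\<close> at once, so that each rule for
  \<open>Zset\<close> serves for weak and for strict bounds.\<close>

definition vcone :: "qbar2 set \<Rightarrow> bool" where
  "vcone I \<longleftrightarrow> 0 \<in> I \<and> (\<forall>x\<in>I. \<forall>y. v x \<le> v y \<longrightarrow> y \<in> I)"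

lemma vcone_vge [simp]: "vcone (vge s)" and vcone_vgt [simp]: "vcone (vgt s)"
  by (auto simp: vcone_def vge_def vgt_def intro: order.trans less_le_trans)

lemma Zset_lat: "l \<in> L \<Longrightarrow> d \<in> I \<Longrightarrow> scal d l \<in> Zset I"
  by (rule ZsetI[OF qbs.cind_0, of d I l]) (simp_all add: qb.hk_0 scal_simps)

lemma Zset_rel: "h \<in> cind z2_qbar2 (sym_pow r) \<Longrightarrow> vcone I \<Longrightarrow> qb.hk h - scal a h \<in> Zset I"
  by (rule ZsetI[of h 0 I 0]) (simp_all add: vcone_def scal_simps L_0)

lemma Zset_0: "vcone I \<Longrightarrow> 0 \<in> Zset I"
  using Zset_lat[OF L_0, of 0 I] by (simp add: vcone_def scal_simps)

lemma Zset_add: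
  assumes I: "vcone I" and f: "f \<in> Zset I" and f': "f' \<in> Zset I"
  shows "f + f' \<in> Zset I"
proof -
  have *: "f + f' \<in> Zset I" if "h \<in> cind z2_qbar2 (sym_pow r)" "h' \<in> cind z2_qbar2 (sym_pow r)"
    "d \<in> I" "l \<in> L" "l' \<in> L" "f = qb.hk h - scal a h + scal d l"
    "f' = qb.hk h' - scal a h' + scal d' l'" and dd': "v d \<le> v d'" for f f' h h' d d' l l'
  proof -
    obtain c where c: "c \<in> zbar2 v" "d' = d * c"
    proof (cases "d = 0")
      case True
      hence "d' = 0" using dd' v_eq_inf_iff[of d'] by simp
      thus ?thesis using that[of 0] True zb.zero by simp
    next
      case False
      then obtain s where s: "v d = ereal s" using v_finite by blast
      have "d' \<in> vge s" using dd' s by (simp add: vge_def)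
      from vge_divide[OF this s] show ?thesis using that[of "d' / d"] False by (simp add: zbar2_eq)
    qed
    have "f + f' = qb.hk (h + h') - scal a (h + h') + scal d (l + scal c l')"
      by (simp add: that c scal_simps qb.hk_add algebra_simps)
    moreover have "h + h' \<in> cind z2_qbar2 (sym_pow r)" "l + scal c l' \<in> L"
      using that c by (auto intro: qbs.cind_add L_add L_scal)
    ultimately show ?thesis using ZsetI that(3) by blast
  qed
  obtain h d l where 1: "h \<in> cind z2_qbar2 (sym_pow r)" "d \<in> I" "l \<in> L" "f = qb.hk h - scal a h + scal d l"
    using f by (rule ZsetE)
  obtain h' d' l' where 2: "h' \<in> cind z2_qbar2 (sym_pow r)" "d' \<in> I" "l' \<in> L"
    "f' = qb.hk h' - scal a h' + scal d' l'"
    using f' by (rule ZsetE)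
  show ?thesis
  proof (cases "v d \<le> v d'")
    case True
    thus ?thesis using *[of h h' d l l' f f' d'] 1 2 by simp
  next
    case False
    thus ?thesis using *[of h' h d' l' l f' f d] 1 2 by (simp add: add.commute)
  qed
qed

lemma Zset_scal:
  assumes "f \<in> Zset I" "\<And>d. d \<in> I \<Longrightarrow> c * d \<in> J"
  shows "scal c f \<in> Zset J"
proof -
  obtain h d l where 1: "h \<in> cind z2_qbar2 (sym_pow r)" "d \<in> I" "l \<in> L" "f = qb.hk h - scal a h + scal d l"
    using assms(1) by (rule ZsetE)
  show ?thesis
    by (rule ZsetI[of "scal c h" "c * d" J l])
      (simp_all add: 1 assms(2) qb.scal_cind qb.hk_scal scal_simps mult.commute)
qed

lemma Zge_scal: "f \<in> Zset (vge s) \<Longrightarrow> c \<in> vge t \<Longrightarrow> u \<le> s + t \<Longrightarrow> scal c f \<in> Zset (vge u)"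
  by (rule Zset_scal) (auto intro: vge_mult[of c t] vge_mono simp: add.commute)

lemma Zgt_scal: "f \<in> Zset (vgt s) \<Longrightarrow> c \<in> vge t \<Longrightarrow> scal c f \<in> Zset (vgt (s + t))"
  by (rule Zset_scal) (auto intro: vgt_mult simp: mult.commute)

lemma Zset_uminus:
  assumes "vcone I" "f \<in> Zset I"
  shows "- f \<in> Zset I"
proof -
  have "scal (- 1) f \<in> Zset I" using assms by (intro Zset_scal) (auto simp: vcone_def)
  thus ?thesis by (simp add: scal_simps)
qed

lemma Zset_diff: "vcone I \<Longrightarrow> f \<in> Zset I \<Longrightarrow> f' \<in> Zset I \<Longrightarrow> f - f' \<in> Zset I"
  using Zset_add[of I f "- f'"] Zset_uminus by simp

lemma Zset_sum: "vcone I \<Longrightarrow> (\<And>x. x \<in> A \<Longrightarrow> f x \<in> Zset I) \<Longrightarrow> (\<Sum>x\<in>A. f x) \<in> Zset I"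
proof (induction A rule: infinite_finite_induct)
  case (insert x A)
  show ?case unfolding sum.insert[OF insert(1,2)]
    using insert(3-5) by (intro Zset_add) auto
qed (simp_all only: sum.infinite sum.empty not_False_eq_True Zset_0)

lemma Zge_mono: "f \<in> Zset (vge s) \<Longrightarrow> t \<le> s \<Longrightarrow> f \<in> Zset (vge t)"
  by (erule Zset_mono[rotated]) (auto intro: vge_mono)

lemma Zgt_if_Zge: "f \<in> Zset (vge s) \<Longrightarrow> t < s \<Longrightarrow> f \<in> Zset (vgt t)"
  by (erule Zset_mono[rotated]) (auto intro: vgt_if_vge)

end

subsection \<open>Divisibility by the Hecke relation\<close>

context slope01
begin

abbreviation Wn :: "nat \<Rightarrow> qbar2 poly poly set" where "Wn n \<equiv> sym_pow_zbar2 v n"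

lemma Wn_iff: "w \<in> Wn n \<longleftrightarrow> w \<in> sym_pow n \<and> coeffs_in (zbar2 v) w"
  by (auto simp: sym_pow_zbar2_def coeffs_in_def)

lemma Wn_add: "p \<in> Wn n \<Longrightarrow> q \<in> Wn n \<Longrightarrow> p + q \<in> Wn n"
  and Wn_diff: "p \<in> Wn n \<Longrightarrow> q \<in> Wn n \<Longrightarrow> p - q \<in> Wn n"
  and Wn_uminus: "p \<in> Wn n \<Longrightarrow> - p \<in> Wn n"
  and Wn_scale: "c \<in> zbar2 v \<Longrightarrow> p \<in> Wn n \<Longrightarrow> CC c * p \<in> Wn n"
  and Wn_mult: "p \<in> Wn m \<Longrightarrow> q \<in> Wn n \<Longrightarrow> p * q \<in> Wn (m + n)"
  by (auto simp: Wn_iff intro: sym_pow_add sym_pow_diff sym_pow_uminus sym_pow_scale sym_pow_mult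
      zb.coeffs_in_add zb.coeffs_in_diff zb.coeffs_in_uminus zb.coeffs_in_mult zb.coeffs_in_CC)

lemma Wn_monom: "i + j = n \<Longrightarrow> XX ^ i * YY ^ j \<in> Wn n"
  by (auto simp: Wn_iff intro: sym_pow_monom zb.coeffs_in_monom)

lemma Wn_XX: "XX \<in> Wn 1" and Wn_YY: "YY \<in> Wn 1" and Wn_XXn: "XX ^ n \<in> Wn n" and Wn_YYn: "YY ^ n \<in> Wn n"
  using Wn_monom[of 1 0] Wn_monom[of 0 1] Wn_monom[of n 0] Wn_monom[of 0 n] by auto

lemma of_nat_zbar2: "of_nat n \<in> zbar2 v"
  using vge_of_nat by (simp add: zbar2_eq)

lemma numeral_zbar2: "numeral n \<in> zbar2 v"
  using of_nat_zbar2[of "numeral n"] by simp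

lemma Wn_numeral: "p \<in> Wn n \<Longrightarrow> numeral k * p \<in> Wn n"
  using Wn_scale[OF numeral_zbar2, of p n k] by simp

lemma Wn_of_nat: "p \<in> Wn n \<Longrightarrow> of_nat k * p \<in> Wn n"
  using Wn_scale[OF of_nat_zbar2, of p n k] by simp

lemma Wn_0: "0 \<in> Wn n"
  by (simp add: Wn_iff zb.coeffs_in_0)

lemma Wn_power: "p \<in> Wn 1 \<Longrightarrow> p ^ n \<in> Wn n"
proof (induction n)
  case 0
  show ?case using Wn_monom[of 0 0 0] by simp
next
  case (Suc n)
  thus ?case using Wn_mult[of p 1 "p ^ n" n] by simp
qed

lemma X_minus_2Y_power: "\<exists>Q\<in>Wn n. (XX - 2 * YY) ^ n = XX ^ n + 2 * Q"
proof (induction n)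
  case 0
  show ?case using Wn_0 by (intro bexI[of _ 0]) auto
next
  case (Suc n)
  then obtain Q where Q: "Q \<in> Wn n" "(XX - 2 * YY) ^ n = XX ^ n + 2 * Q" by blast
  let ?Q = "XX * Q - YY * XX ^ n - 2 * (YY * Q)"
  have "?Q \<in> Wn (1 + n)"
    by (intro Wn_diff Wn_numeral Wn_mult Wn_XX Wn_YY Q Wn_XXn)
  moreover have "(XX - 2 * YY) ^ Suc n = XX ^ Suc n + 2 * ?Q"
    unfolding power_Suc Q(2) by (simp add: algebra_simps)
  ultimately show ?case unfolding plus_1_eq_Suc by (rule bexI[rotated])
qed

section \<open>Monomials and the three branches of the Hecke relation\<close>

definition mon :: "nat \<Rightarrow> qbar2 poly poly" where
  "mon j = XX ^ (r - j) * YY ^ j"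

lemma mon_W: "j \<le> r \<Longrightarrow> mon j \<in> W"
  unfolding mon_def by (rule Wn_monom) simp

lemma W_sym: "w \<in> W \<Longrightarrow> w \<in> sym_pow r"
  by (simp add: W_iff)

abbreviation s0 :: "qbar2 poly poly \<Rightarrow> qbar2 poly poly" where "s0 w \<equiv> subst_XY w XX (2 * YY)"
abbreviation s1 :: "qbar2 poly poly \<Rightarrow> qbar2 poly poly" where "s1 w \<equiv> subst_XY w XX (2 * YY - XX)"
abbreviation s2 :: "qbar2 poly poly \<Rightarrow> qbar2 poly poly" where "s2 w \<equiv> subst_XY w (2 * XX) YY"

abbreviation b :: "mat_q2 \<Rightarrow> qbar2 poly poly \<Rightarrow> ind_qbar2" where "b \<equiv> brk z2_qbar2"

definition tree_sum :: "mat_q2 \<Rightarrow> qbar2 poly poly \<Rightarrow> ind_qbar2" where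
  "tree_sum g w = b (g ** gm 0) (s0 w) + b (g ** gm 1) (s1 w) + b (g ** gm 2) (s2 w)"

lemma hk_b: "qb.hk (b g w) = tree_sum g w"
proof -
  have "qb.rh (adjm 0) w = s0 w" "qb.rh (adjm (Suc 0)) w = s1 w" "qb.rh (adjm 2) w = s2 w"
    by (simp_all add: qb.rh_def rho_def adjm_def)
  thus ?thesis by (simp add: qb.hk_brk tree_sum_def eval_nat_numeral)
qed

text \<open>This is (T - a) [g, w], which vanishes in Pi. It therefore belongs to every
  \<open>Zset I\<close> and is negligible at any precision.\<close>

definition rl :: "mat_q2 \<Rightarrow> qbar2 poly poly \<Rightarrow> ind_qbar2" where
  "rl g w = tree_sum g w - scal a (b g w)"

lemma rl_in: "g \<in> GL2_q2 \<Longrightarrow> w \<in> W \<Longrightarrow> vcone I \<Longrightarrow> rl g w \<in> Zset I"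
  using Zset_rel[of "b g w" I] qbs.brk_in_cind W_sym by (simp add: hk_b rl_def)

lemma scal_a_b: "scal a (b g w) = tree_sum g w - rl g w"
  by (simp add: rl_def)

lemma b_lat: "g \<in> GL2_q2 \<Longrightarrow> w \<in> W \<Longrightarrow> d \<in> I \<Longrightarrow> b g (CC d * w) \<in> Zset I"
  unfolding qb.brk_scal by (intro Zset_lat L_brk)

lemma b_lat0: "g \<in> GL2_q2 \<Longrightarrow> w \<in> W \<Longrightarrow> b g w \<in> Zset (vge 0)"
  using b_lat[of g w 1 "vge 0"] by (simp add: vge_1)

lemma b_lat_2: "g \<in> GL2_q2 \<Longrightarrow> w \<in> W \<Longrightarrow> b g (2 * w) \<in> Zset (vge 1)"
  using b_lat[of g w 2] vge_2 by simp

lemma scal_a_cancel: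
  assumes "scal a f \<in> Zset (vge s)"
  shows "f \<in> Zset (vge (s - \<alpha>))"
proof -
  have "scal (inverse a) (scal a f) \<in> Zset (vge (s - \<alpha>))"
    by (rule Zge_scal[OF assms vge_I[OF v_inverse[OF va]]]) simp
  thus ?thesis using a_neq_0 by (simp add: scal_simps)
qed

text \<open>In Pi the tree sum equals a [g, w], so its divisibility passes to [g, w] at the cost
  \<alpha> = v(a).\<close>

lemma b_divide_a:
  assumes "g \<in> GL2_q2" "w \<in> W" "tree_sum g w \<in> Zset (vge s)"
  shows "b g w \<in> Zset (vge (s - \<alpha>))"
  by (intro scal_a_cancel) (simp add: scal_a_b Zset_diff rl_in assms)

lemma s_mon:
  "s0 (mon j) = 2 ^ j * mon j" "s2 (mon j) = 2 ^ (r - j) * mon j"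
  "s1 (mon j) = XX ^ (r - j) * (2 * YY - XX) ^ j"
  by (simp_all add: mon_def subst_XY_hom power_mult_distrib mult_ac)

lemma s_diff: "s0 (p - q) = s0 p - s0 q" "s1 (p - q) = s1 p - s1 q" "s2 (p - q) = s2 p - s2 q"
  and s_add: "s0 (p + q) = s0 p + s0 q" "s1 (p + q) = s1 p + s1 q" "s2 (p + q) = s2 p + s2 q"
  by (simp_all add: subst_XY_hom)

text \<open>Modulo 2 the three substitutions are evaluations: \<open>s0 w\<close> is w(1,0) X^r,
  \<open>s1 w\<close> is w(1,1) X^r and \<open>s2 w\<close> is w(0,1) Y^r. A middle monomial takes
  the values 0, 1, 0, independently of j, so differences of middle monomials become divisible by
  2.\<close>

lemma s_mon_2:
  assumes "1 \<le> j" "j < r"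
  shows "\<exists>Q\<in>W. s0 (mon j) = 2 * Q" "\<exists>Q\<in>W. s2 (mon j) = 2 * Q"
    "\<exists>Q\<in>W. s1 (mon j) = mon 0 + 2 * Q"
proof -
  have m: "2 ^ n * mon j \<in> W" for n
    using Wn_scale[of "2 ^ n" "mon j" r] mon_W[of j] assms of_nat_zbar2[of "2 ^ n"] by (simp add: CC_power)
  have "s0 (mon j) = 2 * (2 ^ (j - 1) * mon j)" "s2 (mon j) = 2 * (2 ^ (r - j - 1) * mon j)"
    unfolding s_mon using assms by (simp_all add: power_eq_if[of _ j] power_eq_if[of _ "r - j"])
  thus "\<exists>Q\<in>W. s0 (mon j) = 2 * Q" "\<exists>Q\<in>W. s2 (mon j) = 2 * Q" using m by blast+
  obtain Q where Q: "Q \<in> Wn j" "(XX - 2 * YY) ^ j = XX ^ j + 2 * Q" using X_minus_2Y_power by blast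
  have rj: "r = (r - j) + j" using assms by simp
  have XQ: "XX ^ (r - j) * Q \<in> W" using Wn_mult[OF Wn_XXn Q(1), of "r - j"] rj by simp
  have X: "XX ^ (r - j) * XX ^ j = mon 0" using rj by (simp add: mon_def power_add[symmetric])
  have pw: "(2 * YY - XX :: qbar2 poly poly) ^ j = (if even j then 1 else - 1) * (XX - 2 * YY) ^ j"
    using uminus_power_if[of "XX - 2 * YY :: qbar2 poly poly" j] by simp
  have "s1 (mon j) = (if even j then 1 else - 1) * (mon 0 + 2 * (XX ^ (r - j) * Q))"
    unfolding s_mon pw Q(2) X[symmetric] by (simp add: algebra_simps)
  also have "\<dots> = mon 0 + 2 * (if even j then XX ^ (r - j) * Q else - (XX ^ (r - j) * Q) - mon 0)"
    by (simp add: algebra_simps)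
  finally show "\<exists>Q\<in>W. s1 (mon j) = mon 0 + 2 * Q"
    using XQ mon_W[of 0] by (intro bexI[of _ "if even j then XX ^ (r - j) * Q else - (XX ^ (r - j) * Q) - mon 0"])
      (auto intro: Wn_diff Wn_uminus)
qed

lemma tree_sum_W2:
  assumes "g \<in> GL2_q2" "\<exists>Q\<in>W. s0 w = 2 * Q" "\<exists>Q\<in>W. s1 w = 2 * Q" "\<exists>Q\<in>W. s2 w = 2 * Q"
  shows "tree_sum g w \<in> Zset (vge 1)"
proof -
  obtain Q0 Q1 Q2 where "Q0 \<in> W" "Q1 \<in> W" "Q2 \<in> W" "s0 w = 2 * Q0" "s1 w = 2 * Q1" "s2 w = 2 * Q2"
    using assms by blast
  thus ?thesis unfolding tree_sum_def using assms(1)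
    by (intro Zset_add) (simp_all add: b_lat_2)
qed

lemma mon_diff_small:
  assumes "g \<in> GL2_q2" "1 \<le> i" "i < r" "1 \<le> j" "j < r"
  shows "b g (mon i - mon j) \<in> Zset (vge (1 - \<alpha>))"
proof (rule b_divide_a[OF assms(1)])
  show "mon i - mon j \<in> W" using assms by (intro W_diff mon_W) auto
  have *: "\<exists>Q\<in>W. p - q = 2 * Q" if pq: "\<exists>Q\<in>W. p = c + 2 * Q" "\<exists>Q\<in>W. q = c + 2 * Q" for p q c
  proof -
    obtain Q Q' where "Q \<in> W" "Q' \<in> W" "p = c + 2 * Q" "q = c + 2 * Q'" using pq by blast
    thus ?thesis by (intro bexI[of _ "Q - Q'"]) (auto intro: W_diff simp: algebra_simps)
  qed
  show "tree_sum g (mon i - mon j) \<in> Zset (vge 1)"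
    unfolding s_diff using s_mon_2[of i] s_mon_2[of j] assms *[of _ 0]
    by (intro tree_sum_W2) (auto simp: s_diff intro: *[of _ "mon 0"])
qed

text \<open>Let g be the \<open>gm 1\<close>-neighbour of g'. In the Hecke relation for X^(r-1) Y at
  g' the only term not divisible by 2 is [g, X^r]. So it is a times a lattice element, up to a
  multiple of 2, and v(2) = 1 exceeds \<alpha>.\<close>

lemma mon_0_small:
  assumes "g \<in> GL2_q2"
  shows "b g (mon 0) \<in> Zset (vge \<alpha>)"
proof -
  obtain g' where g': "g' \<in> GL2_q2" "g' ** gm 1 = g"
  proof -
    obtain k where k: "k \<in> GL2_q2" "k ** gm 1 = (mat 1 :: mat_q2)" using GL2_inverse[of "gm 1"] by auto
    show ?thesis using that[of "g ** k"] assms k by (simp add: matrix_mul_assoc[symmetric])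
  qed
  have m1: "mon 1 \<in> W" using r2 by (intro mon_W) simp
  obtain Q0 Q1 Q2 where Q: "Q0 \<in> W" "Q1 \<in> W" "Q2 \<in> W"
    "s0 (mon 1) = 2 * Q0" "s1 (mon 1) = mon 0 + 2 * Q1" "s2 (mon 1) = 2 * Q2"
    using s_mon_2[of 1] r2 by auto
  have eq: "b g (mon 0) = rl g' (mon 1) + scal a (b g' (mon 1))
       - b (g' ** gm 0) (2 * Q0) - b g (2 * Q1) - b (g' ** gm 2) (2 * Q2)"
    unfolding scal_a_b tree_sum_def Q qb.brk_add g'(2) by (simp only: algebra_simps)
  have 2: "b k (2 * Q) \<in> Zset (vge \<alpha>)" if "k \<in> GL2_q2" "Q \<in> W" for k Q
    using b_lat_2[OF that] \<alpha>_less by (auto elim: Zge_mono)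
  have "scal a (b g' (mon 1)) \<in> Zset (vge \<alpha>)"
    by (intro Zset_lat L_brk g' m1 a_vge)
  thus ?thesis unfolding eq
    by (intro Zset_diff Zset_add vcone_vge) (simp_all add: 2 rl_in Q g' m1 assms del: One_nat_def)
qed

section \<open>Change of representative of a vertex, and the kernel of q\<close>

definition kmat :: "z2 \<Rightarrow> z2 \<Rightarrow> z2 \<Rightarrow> z2 \<Rightarrow> mat_q2" where
  "kmat p q s t = zmat (mat22 p q s t)"

lemma kmat_KZ: "p * t - q * s dvd 1 \<Longrightarrow> kmat p q s t \<in> KZ"
  unfolding kmat_def pmat_0[symmetric] by (rule KZ_pmat) (simp add: det_2)

lemma b_kmat:
  assumes "p * t - q * s dvd 1"
  shows "b (g ** kmat p q s t) w = b g (subst_XY w (CC (z2_qbar2 p) * XX + CC (z2_qbar2 s) * YY)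
     (CC (z2_qbar2 q) * XX + CC (z2_qbar2 t) * YY))"
proof -
  have "act z2_qbar2 (kmat p q s t) w = qb.rh (mat22 p q s t) w"
    unfolding kmat_def pmat_0[symmetric] by (rule qb.act_pmat) (use assms in \<open>simp add: det_2\<close>)
  thus ?thesis using qb.brk_KZ[OF kmat_KZ[OF assms]] by (simp add: qb.rh_def rho_def)
qed

lemma b_flip: "b (g ** kmat 0 1 1 0) w = b g (subst_XY w YY XX)"
  by (subst b_kmat) simp_all

lemma mon_flip: "j \<le> r \<Longrightarrow> subst_XY (mon j) YY XX = mon (r - j)"
  by (simp add: mon_def subst_XY_hom mult.commute)

lemma kmat_GL2: "p * t - q * s dvd 1 \<Longrightarrow> kmat p q s t \<in> GL2_q2"
  by (intro KZ_GL2 kmat_KZ)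

lemma mon_r_small:
  assumes "g \<in> GL2_q2"
  shows "b g (mon r) \<in> Zset (vge \<alpha>)"
  using mon_0_small[of "g ** kmat 0 1 1 0"] kmat_GL2[of 0 0 1 1] assms
  by (simp add: b_flip mon_flip)

lemma mid_sum_small:
  assumes "g \<in> GL2_q2" "w \<in> W" "(\<Sum>j = 1..r - 1. coeff_XY w (r - j) j) \<in> max_ideal v"
  shows "b g w \<in> Zset (vgt 0)"
proof -
  define c where "c j = coeff_XY w (r - j) j" for j
  have c: "c j \<in> zbar2 v" for j using assms(2) by (auto simp: W_iff coeffs_in_def c_def)
  define e where "e = (\<Sum>j = 1..r - 1. c j)"
  have e: "e \<in> vgt 0" using assms(3) by (simp add: e_def c_def max_ideal_eq)
  have "w = (\<Sum>j\<le>r. CC (c j) * mon j)"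
    using sym_pow_expand[OF W_sym[OF assms(2)]] by (simp add: c_def mon_def)
  also have "{..r} = insert 0 (insert r {1..r - 1})" using r2 by auto
  finally have "w = CC (c 0) * mon 0 + (CC (c r) * mon r + (\<Sum>j = 1..r - 1. CC (c j) * mon j))"
    using r2 by simp
  \<comment> \<open>All middle coefficients are moved to \<open>mon 1\<close>. This costs
    differences of middle monomials, which are small, and leaves the middle sum \<open>e\<close>,
    which lies in the maximal ideal.\<close>
  also have "(\<Sum>j = 1..r - 1. CC (c j) * mon j) = (\<Sum>j = 1..r - 1. CC (c j) * (mon j - mon 1)) + CC e * mon 1"
    by (simp add: e_def CC_sum right_diff_distrib sum_subtractf sum_distrib_right)
  finally have w: "w = CC (c 0) * mon 0 + (CC (c r) * mon r +
     ((\<Sum>j = 1..r - 1. CC (c j) * (mon j - mon 1)) + CC e * mon 1))" .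
  have sum: "b g (\<Sum>j\<in>A. f j) = (\<Sum>j\<in>A. b g (f j))" for f :: "nat \<Rightarrow> qbar2 poly poly" and A
    by (induction A rule: infinite_finite_induct) (simp_all add: qb.brk_add)
  have sm: "b g (CC x * p) \<in> Zset (vgt 0)" if "b g p \<in> Zset (vge s)" "0 < s" "x \<in> zbar2 v" for x p s
    unfolding qb.brk_scal using Zgt_scal[of "b g p" 0 x 0] that Zgt_if_Zge by (simp add: zbar2_eq)
  show ?thesis
    unfolding w qb.brk_add sum
  proof (intro Zset_add Zset_sum vcone_vgt)
    show "b g (CC (c 0) * mon 0) \<in> Zset (vgt 0)" "b g (CC (c r) * mon r) \<in> Zset (vgt 0)"
      using sm mon_0_small mon_r_small assms(1) \<alpha>_pos c by blast+
    show "b g (CC (c j) * (mon j - mon 1)) \<in> Zset (vgt 0)" if "j \<in> {1..r - 1}" for j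
    proof (rule sm)
      show "b g (mon j - mon 1) \<in> Zset (vge (1 - \<alpha>))"
        using that r2 assms(1) by (intro mon_diff_small) auto
    qed (use \<alpha>_less c in auto)
    show "b g (CC e * mon 1) \<in> Zset (vgt 0)"
      using e r2 by (intro b_lat assms mon_W) auto
  qed
qed

end

subsection \<open>The relation of degree one\<close>

context slope01
begin

lemma b_mat_2: "b (g ** mat 2) w = b g w"
  using qb.brk_KZ[OF qb.act_mat_2(1)] qb.act_mat_2(2) by simp

text \<open>The first equation steps back from the neighbour \<open>g ** gm 2\<close> to g. The
  other two show that the flip and the shear carry the \<open>gm 2\<close>-neighbour to the other
  two neighbours.\<close>

lemma matrix_relations:
  "gm 2 ** gm 0 = (mat 2 :: mat_q2)"
  "kmat 0 1 1 0 ** gm 2 = gm 0 ** kmat 0 1 1 0"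
  "kmat 1 0 1 1 ** gm 2 = gm 1 ** kmat 0 (- 1) 1 2"
  by (simp_all add: kmat_def gm_def matrix_eq_iff_2)

lemma X_plus_2P_power:
  assumes P: "P \<in> Wn 1"
  shows "\<exists>Q\<in>Wn (Suc n). (XX + 2 * P) ^ Suc n = XX ^ Suc n + 2 * of_nat (Suc n) * (XX ^ n * P) + 4 * Q"
proof (induction n)
  case 0
  show ?case using Wn_0 by (intro bexI[of _ 0]) auto
next
  case (Suc n)
  then obtain Q where Q: "Q \<in> Wn (Suc n)"
    "(XX + 2 * P) ^ Suc n = XX ^ Suc n + 2 * of_nat (Suc n) * (XX ^ n * P) + 4 * Q" by blast
  let ?Q = "XX * Q + of_nat (Suc n) * (XX ^ n * (P * P)) + 2 * (P * Q)"
  have "XX * Q \<in> Wn (1 + Suc n)" "P * Q \<in> Wn (1 + Suc n)" "XX ^ n * (P * P) \<in> Wn (n + (1 + 1))"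
    by (intro Wn_mult Wn_XX Wn_XXn P Q)+
  hence "?Q \<in> Wn (Suc (Suc n))" by (intro Wn_add Wn_numeral Wn_of_nat) simp_all
  moreover have "(XX + 2 * P) ^ Suc (Suc n) =
      XX ^ Suc (Suc n) + 2 * of_nat (Suc (Suc n)) * (XX ^ Suc n * P) + 4 * ?Q"
    unfolding power_Suc[of "XX + 2 * P" "Suc n"] Q(2) by (simp add: algebra_simps)
  ultimately show ?case by (rule bexI[rotated])
qed

definition XYr :: "qbar2 poly poly" where "XYr = (XX + YY) ^ r"

text \<open>Under reduction and q every middle monomial becomes 1, so \<open>tau g\<close> becomes T
  [g, 1] (see \<open>q_tau\<close>). The monomials chosen here are those that occur both in the
  expansion of \<open>HH\<close> and at the end of the climb.\<close>

definition tau :: "mat_q2 \<Rightarrow> ind_qbar2" where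
  "tau g = b (g ** gm 0) (mon 1) + b (g ** gm 1) (mon 1) + b (g ** gm 2) (mon (r - 1))"

lemma XYr_W: "XYr \<in> W"
  unfolding XYr_def by (intro Wn_power Wn_add Wn_XX Wn_YY)

text \<open>This polynomial arises when the climb is transported by the shear (see
  \<open>b_shear_gm2\<close>).\<close>

lemma Y_2Y_minus_X:
  "\<exists>Q\<in>W. subst_XY (mon (r - 1)) YY (2 * YY - XX) = mon 1 + 2 * Q"
proof -
  obtain Q where Q: "Q \<in> Wn (r - 1)" "(XX - 2 * YY) ^ (r - 1) = XX ^ (r - 1) + 2 * Q"
    using X_minus_2Y_power by blast
  have r1: "r = 1 + (r - 1)" using r2 by simp
  have YQ: "YY * Q \<in> W" using Wn_mult[OF Wn_YY Q(1)] r1 by simp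
  have X: "YY * XX ^ (r - 1) = mon 1" by (simp add: mon_def)
  have pw: "(2 * YY - XX :: qbar2 poly poly) ^ (r - 1) =
      (if even (r - 1) then 1 else - 1) * (XX - 2 * YY) ^ (r - 1)"
    using uminus_power_if[of "XX - 2 * YY :: qbar2 poly poly" "r - 1"] by simp
  have "r - (r - 1) = 1" using r2 by simp
  hence "subst_XY (mon (r - 1)) YY (2 * YY - XX) = YY * (2 * YY - XX) ^ (r - 1)"
    by (simp add: mon_def subst_XY_hom)
  also have "\<dots> = (if even (r - 1) then 1 else - 1) * (mon 1 + 2 * (YY * Q))"
    unfolding pw Q(2) X[symmetric] by (simp add: algebra_simps)
  also have "\<dots> = mon 1 + 2 * (if even (r - 1) then YY * Q else - (YY * Q) - mon 1)"
    by (simp add: algebra_simps)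
  finally show ?thesis
    using YQ mon_W[of 1] r2
    by (intro bexI[of _ "if even (r - 1) then YY * Q else - (YY * Q) - mon 1"])
      (auto intro: Wn_diff Wn_uminus)
qed

text \<open>The Hecke relation at \<open>g ** gm 2\<close> for X^r - X Y^(r-1). Its branch
  \<open>gm 0\<close> leads back to g with X^r modulo 2; on the branch \<open>gm 1\<close> both
  monomials have the same value at (1 : 1) and cancel modulo 2; on the branch \<open>gm 2\<close>
  both are divisible by 2.\<close>

lemma mon_0_step:
  assumes g: "g \<in> GL2_q2"
  shows "b g (mon 0) - scal a (b (g ** gm 2) (mon 0 - mon (r - 1))) \<in> Zset (vge 1)"
proof -
  have "1 \<le> r - 1" "r - 1 < r" using r2 by auto
  then obtain Q0 Q1 Q2 where Q: "Q0 \<in> W" "Q1 \<in> W" "Q2 \<in> W"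
    "s0 (mon (r - 1)) = 2 * Q0" "s1 (mon (r - 1)) = mon 0 + 2 * Q1" "s2 (mon (r - 1)) = 2 * Q2"
    using s_mon_2[of "r - 1"] by blast
  have s00: "s0 (mon 0) = mon 0" "s1 (mon 0) = mon 0" by (simp_all add: mon_def subst_XY_hom)
  have "2 ^ (r - 1) * mon 0 \<in> W"
    using Wn_scale[of "2 ^ (r - 1)" "mon 0" r] mon_W[of 0] of_nat_zbar2[of "2 ^ (r - 1)"]
    by (simp add: CC_power)
  moreover have "s2 (mon 0) = 2 * (2 ^ (r - 1) * mon 0)"
    unfolding s_mon using r2 by (simp add: power_eq_if[of _ r])
  ultimately obtain Q3 where Q3: "Q3 \<in> W" "s2 (mon 0) = 2 * Q3" by blast
  have gg: "b (g ** gm 2 ** gm 0) w = b g w" for w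
    using b_mat_2[of g w] by (simp only: matrix_mul_assoc[symmetric] matrix_relations)
  have D: "mon 0 - mon (r - 1) \<in> W" by (intro W_diff mon_W) auto
  have eq: "b g (mon 0) - scal a (b (g ** gm 2) (mon 0 - mon (r - 1))) =
      rl (g ** gm 2) (mon 0 - mon (r - 1)) + b g (2 * Q0) + b (g ** gm 2 ** gm 1) (2 * Q1)
      - b (g ** gm 2 ** gm 2) (2 * Q3 - 2 * Q2)"
    unfolding scal_a_b unfolding tree_sum_def s_diff s00 Q Q3 qb.brk_add qb.brk_diff gg
    by (simp only: algebra_simps)
  have 2: "2 * Q3 - 2 * Q2 = 2 * (Q3 - Q2)" by (simp add: algebra_simps)
  show ?thesis unfolding eq 2
    by (intro Zset_add Zset_diff vcone_vge b_lat_2 rl_in[OF _ D] W_diff Q Q3) (simp_all add: g)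
qed

text \<open>The bound 1 + \<alpha> is a times the error of one step; 3 \<alpha> comes from a^2
  [h, X^r], where X^r contributes a further \<alpha> by \<open>mon_0_small\<close>.\<close>

lemma a_mon_0:
  assumes g: "g \<in> GL2_q2" and s: "s < 1 + \<alpha>" "s < 3 * \<alpha>"
  shows "scal a (b g (mon 0)) + scal (a * a) (b (g ** gm 2) (mon (r - 1))) \<in> Zset (vgt s)"
proof -
  have eq: "scal a (b g (mon 0)) + scal (a * a) (b (g ** gm 2) (mon (r - 1))) =
     scal a (b g (mon 0) - scal a (b (g ** gm 2) (mon 0 - mon (r - 1)))) +
     scal (a * a) (b (g ** gm 2) (mon 0))"
    by (simp add: scal_simps qb.brk_diff algebra_simps)
  have "scal a (b g (mon 0) - scal a (b (g ** gm 2) (mon 0 - mon (r - 1)))) \<in> Zset (vge (1 + \<alpha>))"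
    by (rule Zge_scal[OF mon_0_step a_vge]) (simp_all add: g)
  moreover have "scal (a * a) (b (g ** gm 2) (mon 0)) \<in> Zset (vge (3 * \<alpha>))"
    by (rule Zge_scal[OF mon_0_small vge_mult[OF a_vge a_vge]]) (simp_all add: g)
  ultimately show ?thesis unfolding eq using s Zgt_if_Zge by (intro Zset_add) auto
qed

lemma b_flip_gm2:
  "b (g ** kmat 0 1 1 0 ** gm 2) w = b (g ** gm 0) (subst_XY w YY XX)"
  unfolding b_flip[symmetric] by (simp only: matrix_mul_assoc[symmetric] matrix_relations)

lemma b_shear_gm2:
  "b (g ** kmat 1 0 1 1 ** gm 2) w = b (g ** gm 1) (subst_XY w YY (2 * YY - XX))"
proof -
  have "b (g ** kmat 1 0 1 1 ** gm 2) w = b (g ** gm 1 ** kmat 0 (- 1) 1 2) w"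
    by (simp only: matrix_mul_assoc[symmetric] matrix_relations)
  also have "\<dots> = b (g ** gm 1) (subst_XY w YY (2 * YY - XX))"
    by (subst b_kmat) simp_all
  finally show ?thesis .
qed

lemma b_shear: "b (g ** kmat 1 0 1 1) w = b g (subst_XY w (XX + YY) YY)"
  by (subst b_kmat) simp_all

lemma mon_0_shear: "subst_XY (mon 0) (XX + YY) YY = XYr"
  by (simp add: mon_def XYr_def subst_XY_hom)

lemma kmat_flip_GL2 [simp]: "kmat 0 1 1 0 \<in> GL2_q2" and kmat_shear_GL2 [simp]: "kmat 1 0 1 1 \<in> GL2_q2"
  by (simp_all add: kmat_GL2)

definition HH :: "qbar2 poly poly" where "HH = XYr - mon 0 - mon r"

lemma HH_W: "HH \<in> W"
  unfolding HH_def by (intro W_diff XYr_W mon_W) auto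

lemma s0_HH: "s0 HH = (XX + 2 * YY) ^ r - mon 0 - 2 ^ r * mon r"
  and s1_HH: "s1 HH = 2 ^ r * mon r - mon 0 - (2 * YY - XX) ^ r"
  and s2_HH: "s2 HH = (YY + 2 * XX) ^ r - 2 ^ r * mon 0 - mon r"
  by (simp_all add: HH_def XYr_def mon_def subst_XY_hom power_mult_distrib add.commute)

lemma four_W: "w \<in> W \<Longrightarrow> 2 ^ r * w \<in> (*) 4 ` W"
proof -
  assume w: "w \<in> W"
  have "2 ^ (r - 2) * w \<in> W"
    using Wn_scale[of "2 ^ (r - 2)" w r] w of_nat_zbar2[of "2 ^ (r - 2)"] by (simp add: CC_power)
  moreover have "2 ^ r * w = 4 * (2 ^ (r - 2) * w)"
    using r2 by (auto simp: power_add[symmetric] le_iff_add power2_eq_square)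
  ultimately show ?thesis by blast
qed

lemma flip_W: "w \<in> Wn n \<Longrightarrow> subst_XY w YY XX \<in> Wn n"
  unfolding Wn_iff by (intro conjI sym_pow_subst zb.coeffs_in_subst zb.coeffs_in_XX zb.coeffs_in_YY
      sym_pow_XX sym_pow_YY) auto

text \<open>Only first order terms in 2 are kept. The term with \<open>c\<close> occurs for even r,
  where the branch \<open>gm 1\<close> produces -2 X^r; it has valuation 1 + \<alpha> because
  [h, X^r] is itself divisible by a.\<close>

lemma HH_expand:
  obtains Q0 Q1 Q2 c where "Q0 \<in> W" "Q1 \<in> W" "Q2 \<in> W" "c \<in> vge 1"
    "s0 HH = 2 * of_nat r * mon 1 + 4 * Q0" "s1 HH = 2 * of_nat r * mon 1 + CC c * mon 0 + 4 * Q1"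
    "s2 HH = 2 * of_nat r * mon (r - 1) + 4 * Q2"
proof -
  have r: "r = Suc (r - 1)" using r2 by simp
  obtain P where P: "P \<in> W" "(XX + 2 * YY) ^ r = mon 0 + 2 * of_nat r * mon 1 + 4 * P"
    using X_plus_2P_power[OF Wn_YY, of "r - 1"] r by (simp add: mon_def) metis
  have "- YY \<in> Wn 1" by (intro Wn_uminus Wn_YY)
  from X_plus_2P_power[OF this, of "r - 1"] r
  obtain P' where P': "P' \<in> W" "(XX - 2 * YY) ^ r = mon 0 - 2 * of_nat r * mon 1 + 4 * P'"
    by (simp add: mon_def) metis
  obtain M where M: "M \<in> W" "2 ^ r * mon r = 4 * M" using four_W[OF mon_W[of r]] by auto
  obtain M' where M': "M' \<in> W" "2 ^ r * mon 0 = 4 * M'" using four_W[OF mon_W[of 0]] by auto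
  have pw: "(2 * YY - XX :: qbar2 poly poly) ^ r = (if even r then 1 else - 1) * (XX - 2 * YY) ^ r"
    using uminus_power_if[of "XX - 2 * YY :: qbar2 poly poly" r] by simp
  have h0: "s0 HH = 2 * of_nat r * mon 1 + 4 * (P - M)"
    unfolding s0_HH P M by (simp add: algebra_simps)
  have "(YY + 2 * XX :: qbar2 poly poly) ^ r = subst_XY ((XX + 2 * YY) ^ r) YY XX" by (simp add: subst_XY_hom)
  hence "(YY + 2 * XX) ^ r = mon r + 2 * of_nat r * mon (r - 1) + 4 * subst_XY P YY XX"
    unfolding P using r2 by (simp add: subst_XY_hom mon_flip)
  hence h2: "s2 HH = 2 * of_nat r * mon (r - 1) + 4 * (subst_XY P YY XX - M')"
    unfolding s2_HH M' by (simp add: algebra_simps)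
  have h1: "\<exists>c\<in>vge 1. \<exists>Q\<in>W. s1 HH = 2 * of_nat r * mon 1 + CC c * mon 0 + 4 * Q"
  proof (cases "even r")
    case True
    have "s1 HH = 2 * of_nat r * mon 1 + CC (- 2) * mon 0 + 4 * (M - P')"
      unfolding s1_HH pw P' M using True by (simp add: algebra_simps)
    moreover have "- 2 \<in> vge 1" using vge_2 by (simp only: vge_uminus)
    ultimately show ?thesis using P' M W_diff by blast
  next
    case False
    \<comment> \<open>For odd r the linear term is -2 r X^(r-1) Y; its sign is changed by moving 4 r
      X^(r-1) Y into the error.\<close>
    have "s1 HH = 2 * of_nat r * mon 1 + CC 0 * mon 0 + 4 * (M + P' - of_nat r * mon 1)"
      unfolding s1_HH pw P' M using False by (simp add: algebra_simps)
    moreover have "M + P' - of_nat r * mon 1 \<in> W" using r2 by (intro W_diff Wn_add M P' Wn_of_nat mon_W) auto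
    ultimately show ?thesis using vge_0 by blast
  qed
  then obtain c Q where Q: "c \<in> vge 1" "Q \<in> W" "s1 HH = 2 * of_nat r * mon 1 + CC c * mon 0 + 4 * Q"
    by blast
  show ?thesis
    by (rule that[OF W_diff[OF P(1) M(1)] Q(2) W_diff[OF flip_W[OF P(1)] M'(1)] Q(1) h0 Q(3) h2])
qed

lemma b_lat_4: "g \<in> GL2_q2 \<Longrightarrow> w \<in> W \<Longrightarrow> b g (4 * w) \<in> Zset (vge 2)"
proof -
  have "4 \<in> vge 2" using vge_mult[OF vge_2 vge_2] by simp
  thus "g \<in> GL2_q2 \<Longrightarrow> w \<in> W \<Longrightarrow> b g (4 * w) \<in> Zset (vge 2)" using b_lat[of g w 4] by simp
qed

lemma b_2r: "b g (2 * of_nat n * w) = scal (2 * of_nat n) (b g w)"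
  using qb.brk_scal[of g "2 * of_nat n" w] by simp

lemma tau_relation:
  assumes g: "g \<in> GL2_q2" and s: "s < 1 + \<alpha>" "s < 3 * \<alpha>" "s < 2"
  shows "scal (a * a - 2 * of_nat r) (tau g) \<in> Zset (vgt s)"
proof -
  obtain Q0 Q1 Q2 c where Q: "Q0 \<in> W" "Q1 \<in> W" "Q2 \<in> W" "c \<in> vge 1"
    "s0 HH = 2 * of_nat r * mon 1 + 4 * Q0" "s1 HH = 2 * of_nat r * mon 1 + CC c * mon 0 + 4 * Q1"
    "s2 HH = 2 * of_nat r * mon (r - 1) + 4 * Q2"
    by (rule HH_expand)
  obtain Q where Q': "Q \<in> W" "subst_XY (mon (r - 1)) YY (2 * YY - XX) = mon 1 + 2 * Q"
    using Y_2Y_minus_X by blast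
  define b0 where "b0 = b (g ** gm 0)"
  define b1 where "b1 = b (g ** gm 1)"
  define b2 where "b2 = b (g ** gm 2)"
  note bd = b0_def b1_def b2_def
  define F where "F = b0 (4 * Q0) + scal c (b1 (mon 0)) + b1 (4 * Q1) + b2 (4 * Q2)"
  have F: "tree_sum g HH = scal (2 * of_nat r) (tau g) + F"
    unfolding tree_sum_def Q qb.brk_add tau_def F_def bd b_2r scal_simps qb.brk_scal
    by (simp only: algebra_simps)
  have "scal c (b1 (mon 0)) \<in> Zset (vge (\<alpha> + 1))"
    unfolding bd by (rule Zge_scal[OF mon_0_small Q(4)]) (simp_all add: g)
  hence c: "scal c (b1 (mon 0)) \<in> Zset (vgt s)" by (rule Zgt_if_Zge) (use s in simp)
  have 4: "b (g ** gm i) (4 * w) \<in> Zset (vgt s)" if "w \<in> W" for w i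
    by (rule Zgt_if_Zge[OF b_lat_4]) (use g s that in simp_all)
  have FZ: "F \<in> Zset (vgt s)"
    unfolding F_def using c 4[OF Q(1), of 0] 4[OF Q(2), of 1] 4[OF Q(3), of 2]
    unfolding bd by (intro Zset_add vcone_vgt)
  define DX where "DX = scal a (b g (mon 0)) + scal (a * a) (b2 (mon (r - 1)))"
  define DY where "DY = scal a (b g (mon r)) + scal (a * a) (b0 (mon 1))"
  define DXY where "DXY = scal a (b g XYr) + scal (a * a) (b1 (mon 1 + 2 * Q))"
  have DX: "DX \<in> Zset (vgt s)"
    unfolding DX_def bd by (rule a_mon_0[OF g s(1,2)])
  have DY: "DY \<in> Zset (vgt s)"
    using a_mon_0[of "g ** kmat 0 1 1 0", OF _ s(1,2)] g r2
    unfolding DY_def bd by (simp add: b_flip b_flip_gm2 mon_flip)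
  have DXY: "DXY \<in> Zset (vgt s)"
    using a_mon_0[of "g ** kmat 1 0 1 1", OF _ s(1,2)] g
    unfolding DXY_def bd by (simp add: b_shear b_shear_gm2 mon_0_shear Q' del: One_nat_def)
  \<comment> \<open>The climb from (X + Y)^r enters \<open>HH\<close> with the sign opposite to the
    other two. The first summand turns the resulting minus at \<open>gm 1\<close> into the plus of
    \<open>tau\<close>; the second is the remainder of the shear.\<close>
  define R where "R = scal (a * a) (b1 (2 * mon 1)) + scal (a * a) (b1 (2 * Q))"
  have "a * a \<in> vge (\<alpha> + \<alpha>)" by (intro vge_mult a_vge)
  hence 2: "scal (a * a) (b1 (2 * w)) \<in> Zset (vgt s)" if "w \<in> W" for w
    unfolding bd using \<alpha>_pos g s
    by (intro Zgt_if_Zge[of _ "1 + \<alpha>"] Zge_scal[OF b_lat_2[OF _ that]]) auto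
  have "mon 1 \<in> W" using r2 by (intro mon_W) simp
  hence RZ: "R \<in> Zset (vgt s)" unfolding R_def
    by (intro Zset_add vcone_vgt 2 Q')
  have "scal a (b g HH) = DXY - DX - DY + scal (a * a) (tau g) - R"
  proof -
    have "b1 (2 * mon 1) = b1 (mon 1) + b1 (mon 1)" "b1 (mon 1 + 2 * Q) = b1 (mon 1) + b1 (2 * Q)"
      by (simp_all only: bd qb.brk_add mult_2)
    thus ?thesis
      unfolding HH_def DXY_def DX_def DY_def R_def tau_def bd[symmetric] qb.brk_diff
      by (simp only: scal_simps) (simp only: algebra_simps)
  qed
  moreover have "scal a (b g HH) = scal (2 * of_nat r) (tau g) + F - rl g HH"
    unfolding scal_a_b F ..
  ultimately have "scal (a * a) (tau g) - scal (2 * of_nat r) (tau g) = F - rl g HH - DXY + DX + DY + R"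
    by (simp add: algebra_simps)
  hence "scal (a * a - 2 * of_nat r) (tau g) = F - rl g HH - DXY + DX + DY + R"
    by (simp only: scal_simps)
  thus ?thesis
    by (simp only:) (intro Zset_add Zset_diff vcone_vgt FZ DXY DX DY RZ rl_in g HH_W)
qed

lemma Zgt_cancel:
  assumes "scal c f \<in> Zset (vgt s)" "v c = ereal t"
  shows "f \<in> Zset (vgt (s - t))"
proof -
  have "scal (inverse c) (scal c f) \<in> Zset (vgt (s + - t))"
    by (rule Zgt_scal[OF assms(1) vge_I[OF v_inverse[OF assms(2)]]])
  moreover have "c \<noteq> 0" using assms(2) by auto
  ultimately show ?thesis by (simp add: scal_simps)
qed

theorem tau_small:
  assumes g: "g \<in> GL2_q2" and s: "s < 1 + \<alpha>" "s < 3 * \<alpha>" "s < 2"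
    and v: "v (a * a - 2 * of_nat r) = ereal s"
  shows "tau g \<in> Zset (vgt 0)"
  using Zgt_cancel[OF tau_relation[OF g s] v] by simp

end

subsection \<open>The relation of degree two\<close>

text \<open>Since k and k - 1 are coprime, 2^m divides one of them, whence 2^m \<le> k < 2^(k-1). In
  terms of valuations, v(k (k - 1)) \<le> k - 2.\<close>

lemma odd_part_bound:
  assumes "k \<ge> 3" "k * (k - 1) = 2 ^ m * (n :: nat)" "odd n"
  shows "m + 2 \<le> k"
proof -
  have "2 ^ m dvd k * (k - 1)" using assms(2) by simp
  moreover have "coprime (2 ^ m) (k - 1) \<or> coprime (2 ^ m) k"
    using assms(1) by (cases "even k") simp_all
  ultimately have "2 ^ m dvd k \<or> 2 ^ m dvd k - 1"
    using coprime_dvd_mult_left_iff[of "2 ^ m" "k - 1" k] coprime_dvd_mult_right_iff[of "2 ^ m" k "k - 1"]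
    by blast
  hence "2 ^ m \<le> k" using assms(1) by (auto dest: dvd_imp_le)
  moreover have "k < 2 ^ (k - 1)" using assms(1)
  proof (induction k rule: dec_induct)
    case (step n)
    have "(2 :: nat) ^ (Suc n - 1) = 2 * 2 ^ (n - 1)" using step by (cases n) auto
    thus ?case using step by simp
  qed simp
  ultimately have "(2 :: nat) ^ m < 2 ^ (k - 1)" by linarith
  hence "m < k - 1" by (rule power_less_imp_less_exp[rotated]) simp
  thus ?thesis by simp
qed

lemma binomial_absorb_twice:
  assumes "k \<ge> 2" "n \<ge> 2"
  shows "k * (k - 1) * (n choose k) = n * (n - 1) * ((n - 2) choose (k - 2))"
proof -
  obtain i m where km: "k = Suc (Suc i)" "n = Suc (Suc m)"
    using assms by (metis add_2_eq_Suc le_Suc_ex)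
  have "k * (k - 1) * (n choose k) = (k - 1) * ((n choose k) * k)" by simp
  also have "(n choose k) * k = n * ((n - 1) choose (k - 1))"
    using Suc_times_binomial_eq[of "Suc m" "Suc i"] by (simp only: km diff_Suc_1)
  also have "(k - 1) * (n * ((n - 1) choose (k - 1))) = n * (((n - 1) choose (k - 1)) * (k - 1))" by simp
  also have "((n - 1) choose (k - 1)) * (k - 1) = (n - 1) * ((n - 2) choose (k - 2))"
    using Suc_times_binomial_eq[of m i] by (simp add: km del: binomial_Suc_Suc)
  finally show ?thesis by (simp only: mult.assoc)
qed

context slope01
begin

lemma Wn_sum: "(\<And>x. x \<in> A \<Longrightarrow> f x \<in> Wn n) \<Longrightarrow> (\<Sum>x\<in>A. f x) \<in> Wn n"
  by (induction A rule: infinite_finite_induct) (auto intro: Wn_0 Wn_add)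

text \<open>Absorbing twice rewrites the quotient as a binomial coefficient times 2^k / (4 k (k -
  1)), whose valuation is nonnegative by \<open>odd_part_bound\<close>.\<close>

lemma binomial_2_power_divisible:
  assumes "3 \<le> k" "2 \<le> n"
  shows "of_nat (n choose k) * 2 ^ k / (4 * of_nat n * of_nat (n - 1)) \<in> zbar2 v"
proof -
  have "k * (k - 1) > 0" using assms by simp
  then obtain m n' where m: "odd n'" "k * (k - 1) = 2 ^ m * n'" "v (of_nat (k * (k - 1))) = ereal (real m)"
    by (rule v_of_nat)
  have mk: "m + 2 \<le> k" using odd_part_bound m(1,2) assms(1) by blast
  define x :: qbar2 where "x = of_nat (k * (k - 1))"
  have x0: "x \<noteq> 0" unfolding x_def using of_nat_neq_0[of "k * (k - 1)"] assms by simp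
  have n0: "of_nat n * of_nat (n - 1) \<noteq> (0 :: qbar2)"
    using of_nat_neq_0[of n] of_nat_neq_0[of "n - 1"] assms by auto
  define N :: qbar2 where "N = of_nat n * of_nat (n - 1)"
  have "x * of_nat (n choose k) = of_nat n * of_nat (n - 1) * of_nat ((n - 2) choose (k - 2))"
    using binomial_absorb_twice[of k n] assms unfolding x_def of_nat_mult[symmetric] by simp
  hence eq: "of_nat (n choose k) * 2 ^ k / (4 * of_nat n * of_nat (n - 1)) =
      of_nat ((n - 2) choose (k - 2)) * 2 ^ k / (4 * x)"
  proof -
    have "x * of_nat (n choose k) = N * of_nat ((n - 2) choose (k - 2))"
      using \<open>x * of_nat (n choose k) = _\<close> by (simp only: N_def)
    hence "of_nat (n choose k) = N * of_nat ((n - 2) choose (k - 2)) / x"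
      using x0 by (simp add: nonzero_eq_divide_eq mult.commute)
    moreover have "N \<noteq> 0" unfolding N_def by (rule n0)
    moreover have D: "4 * of_nat n * of_nat (n - 1) = 4 * N" by (simp only: N_def mult.assoc)
    ultimately show ?thesis unfolding D by simp
  qed
  have "v (4 * x) = ereal (2 + real m)"
    using v_power[of 2 1 2] m(3) unfolding v_mult x_def[symmetric] by (simp add: one_ereal_def)
  hence "2 ^ k / (4 * x) \<in> vge (real k - (2 + real m))"
    by (intro vge_divide vge_2_power)
  hence "2 ^ k / (4 * x) \<in> vge 0" by (rule vge_mono) (use mk in simp)
  hence "of_nat ((n - 2) choose (k - 2)) * (2 ^ k / (4 * x)) \<in> vge (0 + 0)"
    by (intro vge_mult vge_of_nat)
  thus ?thesis unfolding eq by (simp add: zbar2_eq)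
qed

text \<open>Compared with \<open>X_plus_2P_power\<close>, the error 4 is improved to 4 n (n - 1) by
  keeping the quadratic term. For n = r this has valuation at least v(r - 1) + 2.\<close>

lemma X_plus_2P_power_fine:
  assumes P: "P \<in> Wn 1" and n: "2 \<le> n"
  shows "\<exists>Q\<in>Wn n. (XX + 2 * P) ^ n = XX ^ n + 2 * of_nat n * (XX ^ (n - 1) * P)
     + 2 * of_nat n * of_nat (n - 1) * (XX ^ (n - 2) * P ^ 2) + 4 * of_nat n * of_nat (n - 1) * Q"
proof -
  define q :: "nat \<Rightarrow> qbar2" where "q k = of_nat (n choose k) * 2 ^ k / (4 * of_nat n * of_nat (n - 1))" for k
  define T where "T k = of_nat (n choose k) * (2 * P) ^ k * XX ^ (n - k)" for k
  define Q where "Q = (\<Sum>k = 3..n. CC (q k) * (P ^ k * XX ^ (n - k)))"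
  have "CC (q k) * (P ^ k * XX ^ (n - k)) \<in> Wn n" if "k \<in> {3..n}" for k
    using Wn_mult[OF Wn_power[OF P, of k] Wn_XXn[of "n - k"]] that n
    unfolding q_def by (intro Wn_scale binomial_2_power_divisible) auto
  hence Q: "Q \<in> Wn n" unfolding Q_def
    by (rule Wn_sum)
  have T: "T k = 4 * of_nat n * of_nat (n - 1) * (CC (q k) * (P ^ k * XX ^ (n - k)))" for k
  proof -
    have n0: "of_nat n * of_nat (n - 1) \<noteq> (0 :: qbar2)"
      using of_nat_neq_0[of n] of_nat_neq_0[of "n - 1"] n by auto
    hence "4 * of_nat n * of_nat (n - 1) \<noteq> (0 :: qbar2)" using of_nat_neq_0[of 4] by auto
    hence "of_nat (n choose k) * 2 ^ k = 4 * of_nat n * of_nat (n - 1) * q k"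
      unfolding q_def by (simp only: nonzero_mult_div_cancel_left times_divide_eq_right simp_thms)
    from arg_cong[OF this, of CC] show ?thesis
      unfolding T_def by (simp add: CC_power power_mult_distrib mult_ac)
  qed
  have "(XX + 2 * P) ^ n = (\<Sum>k\<le>n. T k)"
    unfolding T_def using binomial_ring[of "2 * P" XX n] by (simp add: add.commute)
  also have "{..n} = insert 0 (insert 1 (insert 2 {3..n}))" using n by auto
  also have "(\<Sum>k\<in>\<dots>. T k) = T 0 + (T 1 + (T 2 + (\<Sum>k = 3..n. T k)))" by simp
  also have "(\<Sum>k = 3..n. T k) = 4 * of_nat n * of_nat (n - 1) * Q"
    unfolding Q_def T sum_distrib_left ..
  also have "T 0 = XX ^ n" by (simp add: T_def)
  also have "T 1 = 2 * of_nat n * (XX ^ (n - 1) * P)" by (simp add: T_def)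
  also have "T 2 = 2 * of_nat n * of_nat (n - 1) * (XX ^ (n - 2) * P ^ 2)"
  proof -
    have "(n choose 2) * 4 = 2 * n * (n - 1)"
    proof -
      have "even (n * (n - 1))" by (cases "even n") simp_all
      hence "(n choose 2) * 2 = n * (n - 1)" by (simp only: choose_two dvd_div_mult_self)
      thus ?thesis by simp
    qed
    hence "of_nat (n choose 2) * 4 = (2 * of_nat n * of_nat (n - 1) :: qbar2 poly poly)"
      by (metis of_nat_mult of_nat_numeral)
    thus ?thesis unfolding T_def by (simp add: power_mult_distrib mult_ac)
  qed
  finally show ?thesis using Q by (intro bexI[of _ Q]) (simp_all add: add.assoc)
qed

end

text \<open>Here \<open>s\<close> is the valuation that all errors have to exceed. As v(2 a) = 3/2,
  it stands for the level s - 3/2 of \<alpha>', which runs from 0 to t = v(r - 1). The terms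
  discarded below have valuation at least t + 2 or s + 1/2.\<close>

locale slope_half = slope01 v red r a "1 / 2" for v red and r :: nat and a +
  fixes t :: nat and s :: real
  assumes r_odd: "odd r" and t: "v (of_nat (r - 1)) = ereal (real t)"
    and t1: "1 \<le> t" and rt: "2 ^ t \<le> r - 1"
    and \<beta>: "a * a - 2 * of_nat r * of_nat r \<in> vge s"
    and s: "3 / 2 \<le> s" "s \<le> real t + 3 / 2"
begin

definition \<epsilon> :: nat where "\<epsilon> = r - 1"

definition \<beta> :: qbar2 where "\<beta> = a * a - 2 * of_nat r * of_nat r"

lemma Suc_\<epsilon>: "Suc \<epsilon> = r" "1 + \<epsilon> = r" and \<epsilon>_pos: "\<epsilon> > 0" and \<epsilon>_even: "even \<epsilon>"
  using r2 r_odd by (auto simp: \<epsilon>_def)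

lemma r3: "3 \<le> r"
  using r2 r_odd by (cases "r = 2") auto

lemma of_nat_r: "of_nat r = (of_nat \<epsilon> + 1 :: qbar2)"
  using of_nat_Suc[of \<epsilon>] by (simp only: Suc_\<epsilon> add.commute)

lemma \<epsilon>_vge: "of_nat \<epsilon> \<in> vge (real t)"
  using t by (simp add: \<epsilon>_def vge_I)

lemma t2_le_r: "t + 2 \<le> r"
proof -
  have "t + 1 \<le> 2 ^ t" by (induction t) auto
  thus ?thesis using rt r3 by linarith
qed

lemma two_power_4\<epsilon>: "2 ^ r \<in> vge (real t + 2)"
  by (rule vge_mono[OF vge_2_power]) (use t2_le_r in linarith)

lemma two_\<epsilon>: "2 * of_nat \<epsilon> \<in> vge (real t + 1)"
  using vge_mult[OF vge_2 \<epsilon>_vge] by (simp add: add.commute)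

lemma four_\<epsilon>: "4 * of_nat \<epsilon> \<in> vge (real t + 2)"
  using vge_mult[OF vge_2 two_\<epsilon>] by (simp add: add.commute)

lemma a_half: "a \<in> vge (1 / 2)"
  using a_vge .

lemma a2: "a * a \<in> vge 1"
  using vge_mult[OF a_half a_half] by simp

section \<open>Expansions modulo 4 (r - 1)\<close>

lemma XYexp:
  obtains P where "P \<in> W" "(XX + 2 * YY) ^ r =
     mon 0 + 2 * of_nat r * mon 1 + 2 * of_nat r * of_nat \<epsilon> * mon 2 + CC (4 * of_nat \<epsilon>) * P"
proof -
  obtain Q where Q: "Q \<in> Wn r" "(XX + 2 * YY) ^ r = XX ^ r + 2 * of_nat r * (XX ^ (r - 1) * YY)
     + 2 * of_nat r * of_nat (r - 1) * (XX ^ (r - 2) * YY ^ 2) + 4 * of_nat r * of_nat (r - 1) * Q"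
    using X_plus_2P_power_fine[OF Wn_YY r2] by blast
  have "of_nat r * Q \<in> W" by (intro Wn_of_nat Q)
  moreover have "(XX + 2 * YY) ^ r =
     mon 0 + 2 * of_nat r * mon 1 + 2 * of_nat r * of_nat \<epsilon> * mon 2 + CC (4 * of_nat \<epsilon>) * (of_nat r * Q)"
    unfolding Q by (simp add: mon_def \<epsilon>_def mult_ac)
  ultimately show ?thesis using that by blast
qed

lemma XYexp_minus:
  obtains P where "P \<in> W" "(XX - 2 * YY) ^ r =
     mon 0 - 2 * of_nat r * mon 1 + 2 * of_nat r * of_nat \<epsilon> * mon 2 + CC (4 * of_nat \<epsilon>) * P"
proof -
  have Y: "- YY \<in> Wn 1" by (intro Wn_uminus Wn_YY)
  obtain Q where Q: "Q \<in> Wn r" "(XX + 2 * (- YY)) ^ r = XX ^ r + 2 * of_nat r * (XX ^ (r - 1) * (- YY))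
     + 2 * of_nat r * of_nat (r - 1) * (XX ^ (r - 2) * (- YY) ^ 2) + 4 * of_nat r * of_nat (r - 1) * Q"
    using X_plus_2P_power_fine[OF Y r2] by blast
  have "of_nat r * Q \<in> W" by (intro Wn_of_nat Q)
  moreover have "XX - 2 * YY = (XX + 2 * (- YY) :: qbar2 poly poly)" by simp
  hence "(XX - 2 * YY) ^ r =
     mon 0 - 2 * of_nat r * mon 1 + 2 * of_nat r * of_nat \<epsilon> * mon 2 + CC (4 * of_nat \<epsilon>) * (of_nat r * Q)"
    unfolding Q(2)[symmetric] by (simp only: Q(2)) (simp add: mon_def \<epsilon>_def mult_ac)
  ultimately show ?thesis using that by blast
qed

lemma exp_\<epsilon>:
  obtains Q where "Q \<in> Wn \<epsilon>" "(2 * YY - XX) ^ \<epsilon> = XX ^ \<epsilon> - 2 * of_nat \<epsilon> * (XX ^ (\<epsilon> - 1) * YY)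
     + 2 * of_nat \<epsilon> * of_nat (\<epsilon> - 1) * (XX ^ (\<epsilon> - 2) * YY ^ 2) + CC (4 * of_nat \<epsilon>) * Q"
proof -
  have \<epsilon>2: "2 \<le> \<epsilon>" using r3 by (simp add: \<epsilon>_def)
  have Y: "- YY \<in> Wn 1" by (intro Wn_uminus Wn_YY)
  obtain Q where Q: "Q \<in> Wn \<epsilon>" "(XX + 2 * (- YY)) ^ \<epsilon> = XX ^ \<epsilon> + 2 * of_nat \<epsilon> * (XX ^ (\<epsilon> - 1) * (- YY))
     + 2 * of_nat \<epsilon> * of_nat (\<epsilon> - 1) * (XX ^ (\<epsilon> - 2) * (- YY) ^ 2) + 4 * of_nat \<epsilon> * of_nat (\<epsilon> - 1) * Q"
    using X_plus_2P_power_fine[OF Y \<epsilon>2] by blast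
  have "of_nat (\<epsilon> - 1) * Q \<in> Wn \<epsilon>" by (intro Wn_of_nat Q)
  moreover have "(2 * YY - XX :: qbar2 poly poly) ^ \<epsilon> = (XX + 2 * (- YY)) ^ \<epsilon>"
    using uminus_power_if[of "XX + 2 * (- YY) :: qbar2 poly poly" \<epsilon>] \<epsilon>_even by simp
  hence "(2 * YY - XX) ^ \<epsilon> = XX ^ \<epsilon> - 2 * of_nat \<epsilon> * (XX ^ (\<epsilon> - 1) * YY)
     + 2 * of_nat \<epsilon> * of_nat (\<epsilon> - 1) * (XX ^ (\<epsilon> - 2) * YY ^ 2) + CC (4 * of_nat \<epsilon>) * (of_nat (\<epsilon> - 1) * Q)"
    by (simp only: Q(2)) (simp add: mult_ac)
  ultimately show ?thesis using that by blast
qed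

lemma mon_\<epsilon>:
  "mon 0 = XX * XX ^ \<epsilon>" "mon 1 = XX * (XX ^ (\<epsilon> - 1) * YY)" "mon 2 = XX * (XX ^ (\<epsilon> - 2) * YY ^ 2)"
  "mon 1 = YY * XX ^ \<epsilon>" "mon \<epsilon> = XX * YY ^ \<epsilon>"
proof -
  have e: "r = Suc \<epsilon>" "r - 1 = Suc (\<epsilon> - 1)" "r - 2 = Suc (\<epsilon> - 2)" "r - \<epsilon> = 1" "r - 1 = \<epsilon>"
    using r3 by (auto simp: \<epsilon>_def)
  show "mon 0 = XX * XX ^ \<epsilon>" unfolding power_Suc[symmetric] Suc_\<epsilon> by (simp add: mon_def)
  show "mon 1 = XX * (XX ^ (\<epsilon> - 1) * YY)" unfolding mon_def e(2) by (simp add: mult.assoc)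
  show "mon 2 = XX * (XX ^ (\<epsilon> - 2) * YY ^ 2)" unfolding mon_def e(3) by (simp add: mult.assoc)
  show "mon 1 = YY * XX ^ \<epsilon>" unfolding mon_def e(5) by (simp add: mult.commute)
  show "mon \<epsilon> = XX * YY ^ \<epsilon>" unfolding mon_def e(4) by simp
qed

text \<open>The branch \<open>gm 1\<close> of \<open>mon_0_step\<close>, now modulo 4 (r - 1)
  instead of 2. The leading part is a multiple of \<open>mon 1 + mon 2\<close>, which vanishes
  modulo 2 at the three points and so gains another 1/2.\<close>

lemma s1_step:
  obtains Q where "Q \<in> W"
    "s1 (mon 0 - mon \<epsilon>) = CC (2 * of_nat \<epsilon>) * (mon 1 + mon 2) + CC (4 * of_nat \<epsilon>) * Q"
proof -
  obtain Q where Q: "Q \<in> Wn \<epsilon>" "(2 * YY - XX) ^ \<epsilon> = XX ^ \<epsilon> - 2 * of_nat \<epsilon> * (XX ^ (\<epsilon> - 1) * YY)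
     + 2 * of_nat \<epsilon> * of_nat (\<epsilon> - 1) * (XX ^ (\<epsilon> - 2) * YY ^ 2) + CC (4 * of_nat \<epsilon>) * Q"
    by (rule exp_\<epsilon>)
  \<comment> \<open>Since \<epsilon> - 1 = 2 e - 1, the quadratic term acquires the same sign as the
    linear one, and the part with 2 e goes into the error.\<close>
  obtain e where e: "\<epsilon> = 2 * e" using \<epsilon>_even by auto
  have e1: "of_nat (\<epsilon> - 1) = (2 * of_nat e - 1 :: qbar2 poly poly)"
    using \<epsilon>_pos by (simp add: e of_nat_diff)
  define Q' where "Q' = - (XX * Q) - of_nat e * mon 2"
  have "XX * Q \<in> W" using Wn_mult[OF Wn_XX Q(1)] unfolding Suc_\<epsilon> .
  hence "Q' \<in> W" unfolding Q'_def using r2 by (intro Wn_diff Wn_uminus Wn_of_nat mon_W)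
  moreover have "s1 (mon 0 - mon \<epsilon>) = XX * XX ^ \<epsilon> - XX * (2 * YY - XX) ^ \<epsilon>"
    unfolding mon_\<epsilon> by (simp add: subst_XY_hom)
  hence "s1 (mon 0 - mon \<epsilon>) = CC (2 * of_nat \<epsilon>) * (mon 1 + mon 2) + CC (4 * of_nat \<epsilon>) * Q'"
    unfolding Q(2) e1 Q'_def mon_\<epsilon>(2,3) by (simp add: algebra_simps)
  ultimately show ?thesis using that by blast
qed

text \<open>Sharpens \<open>Y_2Y_minus_X\<close>: the remainder 2 becomes 2 (r - 1), which after
  multiplication by a^2 has valuation at least t + 2.\<close>

lemma Y_step:
  obtains Q where "Q \<in> W" "subst_XY (mon \<epsilon>) YY (2 * YY - XX) = mon 1 + CC (2 * of_nat \<epsilon>) * Q"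
proof -
  obtain Q where Q: "Q \<in> Wn \<epsilon>" "(2 * YY - XX) ^ \<epsilon> = XX ^ \<epsilon> - 2 * of_nat \<epsilon> * (XX ^ (\<epsilon> - 1) * YY)
     + 2 * of_nat \<epsilon> * of_nat (\<epsilon> - 1) * (XX ^ (\<epsilon> - 2) * YY ^ 2) + CC (4 * of_nat \<epsilon>) * Q"
    by (rule exp_\<epsilon>)
  define Q' where "Q' = YY * (of_nat (\<epsilon> - 1) * (XX ^ (\<epsilon> - 2) * YY ^ 2) - XX ^ (\<epsilon> - 1) * YY + 2 * Q)"
  have \<epsilon>2: "(\<epsilon> - 2) + 2 = \<epsilon>" "(\<epsilon> - 1) + 1 = \<epsilon>" using r3 by (simp_all add: \<epsilon>_def)
  have "XX ^ (\<epsilon> - 2) * YY ^ 2 \<in> Wn \<epsilon>" "XX ^ (\<epsilon> - 1) * YY \<in> Wn \<epsilon>"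
    using Wn_monom[OF \<epsilon>2(1)] Wn_monom[OF \<epsilon>2(2)] by simp_all
  hence "Q' \<in> Wn (1 + \<epsilon>)" unfolding Q'_def
    by (intro Wn_mult Wn_YY Wn_add Wn_diff Wn_of_nat Wn_numeral Q(1))
  hence "Q' \<in> W" unfolding Suc_\<epsilon> .
  moreover have "subst_XY (mon \<epsilon>) YY (2 * YY - XX) = YY * (2 * YY - XX) ^ \<epsilon>"
    unfolding mon_\<epsilon> by (simp add: subst_XY_hom)
  hence "subst_XY (mon \<epsilon>) YY (2 * YY - XX) = mon 1 + CC (2 * of_nat \<epsilon>) * Q'"
    unfolding Q(2) Q'_def mon_\<epsilon>(4) by (simp add: algebra_simps)
  ultimately show ?thesis using that by blast
qed

lemma HH_fine:
  obtains Q0 Q1 Q2 where "Q0 \<in> W" "Q1 \<in> W" "Q2 \<in> W"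
    "s0 HH = 2 * of_nat r * mon 1 + 2 * of_nat r * of_nat \<epsilon> * mon 2 + CC (4 * of_nat \<epsilon>) * Q0"
    "s1 HH = 2 * of_nat r * of_nat \<epsilon> * mon 2 - 2 * of_nat r * mon 1 + CC (4 * of_nat \<epsilon>) * Q1"
    "s2 HH = 2 * of_nat r * mon \<epsilon> + 2 * of_nat r * of_nat \<epsilon> * mon (r - 2) + CC (4 * of_nat \<epsilon>) * Q2"
proof -
  obtain P where P: "P \<in> W" "(XX + 2 * YY) ^ r =
     mon 0 + 2 * of_nat r * mon 1 + 2 * of_nat r * of_nat \<epsilon> * mon 2 + CC (4 * of_nat \<epsilon>) * P"
    by (rule XYexp)
  obtain P' where P': "P' \<in> W" "(XX - 2 * YY) ^ r =
     mon 0 - 2 * of_nat r * mon 1 + 2 * of_nat r * of_nat \<epsilon> * mon 2 + CC (4 * of_nat \<epsilon>) * P'"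
    by (rule XYexp_minus)
  have v4: "v (4 * of_nat \<epsilon>) = ereal (real t + 2)"
    using v_power[of 2 1 2] t by (simp add: v_mult \<epsilon>_def one_ereal_def add.commute)
  \<comment> \<open>The pure powers 2^r in \<open>HH\<close> go into the error; the quotient is
    integral because t + 2 \<le> r.\<close>
  define d where "d = 2 ^ r / (4 * of_nat \<epsilon> :: qbar2)"
  have "d \<in> vge (real t + 2 - (real t + 2))" unfolding d_def by (rule vge_divide[OF two_power_4\<epsilon> v4])
  hence d: "d \<in> zbar2 v" by (simp add: zbar2_eq)
  have "4 * of_nat \<epsilon> \<noteq> (0 :: qbar2)" using v4 by auto
  hence "2 ^ r = 4 * of_nat \<epsilon> * d" unfolding d_def by (simp only: nonzero_mult_div_cancel_left times_divide_eq_right simp_thms)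
  from arg_cong[OF this, of CC] have two_r: "2 ^ r * w = CC (4 * of_nat \<epsilon>) * (CC d * w)" for w
    by (simp add: CC_power mult.assoc)
  have pw: "(2 * YY - XX :: qbar2 poly poly) ^ r = - ((XX - 2 * YY) ^ r)"
    using uminus_power_if[of "XX - 2 * YY :: qbar2 poly poly" r] r_odd by simp
  have "s0 HH = 2 * of_nat r * mon 1 + 2 * of_nat r * of_nat \<epsilon> * mon 2 + CC (4 * of_nat \<epsilon>) * (P - CC d * mon r)"
    unfolding s0_HH P two_r by (simp only: algebra_simps)
  moreover have "s1 HH = 2 * of_nat r * of_nat \<epsilon> * mon 2 - 2 * of_nat r * mon 1 + CC (4 * of_nat \<epsilon>) * (P' + CC d * mon r)"
    unfolding s1_HH pw P' two_r by (simp add: algebra_simps)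
  moreover have "(YY + 2 * XX :: qbar2 poly poly) ^ r = subst_XY ((XX + 2 * YY) ^ r) YY XX" by (simp add: subst_XY_hom)
  hence "(YY + 2 * XX) ^ r = mon r + 2 * of_nat r * mon \<epsilon> + 2 * of_nat r * of_nat \<epsilon> * mon (r - 2)
      + CC (4 * of_nat \<epsilon>) * subst_XY P YY XX"
    unfolding P using r2 by (simp add: subst_XY_hom mon_flip \<epsilon>_def)
  hence "s2 HH = 2 * of_nat r * mon \<epsilon> + 2 * of_nat r * of_nat \<epsilon> * mon (r - 2)
      + CC (4 * of_nat \<epsilon>) * (subst_XY P YY XX - CC d * mon 0)"
    unfolding s2_HH two_r by (simp only: algebra_simps)
  moreover have "P - CC d * mon r \<in> W" "P' + CC d * mon r \<in> W" "subst_XY P YY XX - CC d * mon 0 \<in> W"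
    by (intro Wn_add Wn_diff Wn_scale P P' d mon_W flip_W; simp)+
  ultimately show ?thesis using that by blast
qed

section \<open>The climb with sharp error bounds\<close>

definition xi :: "mat_q2 \<Rightarrow> ind_qbar2" where "xi g = b g (mon 0)"
definition om :: "mat_q2 \<Rightarrow> ind_qbar2" where "om g = b g (mon \<epsilon>)"
text \<open>By the coarse climb, a \<open>xi g\<close> is close to -a^2
  \<open>om (g ** gm 2)\<close>, and a^2 is close to 2. So the two summands cancel to first order,
  and \<open>zeta\<close> measures the defect.\<close>

definition zeta :: "mat_q2 \<Rightarrow> ind_qbar2" where "zeta g = scal a (xi g) + scal 2 (om (g ** gm 2))"

lemma mon_\<epsilon>_W: "mon \<epsilon> \<in> W" and mon_1_W: "mon 1 \<in> W" and mon_2_W: "mon 2 \<in> W" and mon_0_W: "mon 0 \<in> W"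
  using r2 by (intro mon_W; simp add: \<epsilon>_def)+

lemma mon_12_small:
  assumes g: "g \<in> GL2_q2"
  shows "b g (mon 1 + mon 2) \<in> Zset (vge (1 / 2))"
proof -
  have eq: "mon 1 + mon 2 = (mon 2 - mon 1) + 2 * mon 1" by (simp add: algebra_simps)
  have "b g (mon 2 - mon 1) \<in> Zset (vge (1 - 1 / 2))" using g r3 by (intro mon_diff_small) auto
  moreover have "b g (2 * mon 1) \<in> Zset (vge (1 / 2))"
    by (rule Zge_mono[OF b_lat_2[OF g mon_1_W]]) simp
  ultimately show ?thesis unfolding eq qb.brk_add by (intro Zset_add) simp_all
qed

text \<open>The relation of \<open>mon_0_step\<close> with all terms kept that may fall below t +
  3/2. The term with \<open>2 ^ \<epsilon>\<close> is among them because of r = 3, where its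
  valuation is 2 and t + 3/2 = 5/2.\<close>

lemma xi_step:
  assumes g: "g \<in> GL2_q2"
  shows "xi g - scal a (xi (g ** gm 2)) + scal a (om (g ** gm 2)) - scal 2 (om (g ** gm 2 ** gm 2))
     - scal (2 ^ \<epsilon>) (om g) \<in> Zset (vge (real t + 3 / 2))"
proof -
  obtain Q where Q: "Q \<in> W"
    "s1 (mon 0 - mon \<epsilon>) = CC (2 * of_nat \<epsilon>) * (mon 1 + mon 2) + CC (4 * of_nat \<epsilon>) * Q"
    by (rule s1_step)
  have r\<epsilon>: "r - \<epsilon> = 1" using r2 by (simp add: \<epsilon>_def)
  have S0: "s0 (mon 0 - mon \<epsilon>) = mon 0 - CC (2 ^ \<epsilon>) * mon \<epsilon>"
    unfolding s_diff s_mon by (simp add: CC_power)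
  have S2: "s2 (mon 0 - mon \<epsilon>) = CC (2 ^ r) * mon 0 - CC 2 * mon \<epsilon>"
    unfolding s_diff s_mon r\<epsilon> by (simp add: CC_power)
  define h where "h = g ** gm 2"
  have gg: "b (h ** gm 0) w = b g w" for w
    using b_mat_2[of g w] by (simp only: h_def matrix_mul_assoc[symmetric] matrix_relations)
  have h: "h \<in> GL2_q2" "h ** gm i \<in> GL2_q2" for i using g by (simp_all add: h_def)
  have D: "mon 0 - mon \<epsilon> \<in> W" by (intro W_diff mon_0_W mon_\<epsilon>_W)
  have "scal a (b h (mon 0 - mon \<epsilon>)) =
      b g (mon 0) - scal (2 ^ \<epsilon>) (b g (mon \<epsilon>))
      + (scal (2 * of_nat \<epsilon>) (b (h ** gm 1) (mon 1 + mon 2)) + b (h ** gm 1) (CC (4 * of_nat \<epsilon>) * Q))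
      + (b (h ** gm 2) (CC (2 ^ r) * mon 0) - scal 2 (b (h ** gm 2) (mon \<epsilon>))) - rl h (mon 0 - mon \<epsilon>)"
    unfolding scal_a_b unfolding tree_sum_def S0 S2 Q(2) qb.brk_diff
    unfolding qb.brk_add[of "h ** gm 1" "CC (2 * of_nat \<epsilon>) * (mon 1 + mon 2)"]
      qb.brk_scal[of "h ** gm 1" "2 * of_nat \<epsilon>"] qb.brk_scal[of _ _ "mon \<epsilon>"] gg ..
  hence eq: "xi g - scal a (xi h) + scal a (om h) - scal 2 (om (h ** gm 2)) - scal (2 ^ \<epsilon>) (om g) =
      rl h (mon 0 - mon \<epsilon>) - scal (2 * of_nat \<epsilon>) (b (h ** gm 1) (mon 1 + mon 2))
       - b (h ** gm 1) (CC (4 * of_nat \<epsilon>) * Q) - b (h ** gm 2) (CC (2 ^ r) * mon 0)"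
    unfolding xi_def om_def by (simp only: qb.brk_diff scal_simps) (simp only: algebra_simps)
  have 1: "scal (2 * of_nat \<epsilon>) (b (h ** gm 1) (mon 1 + mon 2)) \<in> Zset (vge (real t + 3 / 2))"
    by (rule Zge_scal[OF mon_12_small two_\<epsilon>]) (simp_all add: h)
  have 2: "b (h ** gm 1) (CC (4 * of_nat \<epsilon>) * Q) \<in> Zset (vge (real t + 3 / 2))"
    by (rule Zge_mono[OF b_lat[OF _ Q(1) four_\<epsilon>]]) (simp_all add: h)
  have 3: "b (h ** gm 2) (CC (2 ^ r) * mon 0) \<in> Zset (vge (real t + 3 / 2))"
    by (rule Zge_mono[OF b_lat[OF _ mon_0_W two_power_4\<epsilon>]]) (simp_all add: h)
  show ?thesis unfolding h_def[symmetric] eq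
    by (intro Zset_diff vcone_vge 1 2 3 rl_in D h)
qed

lemma om_in: "g \<in> GL2_q2 \<Longrightarrow> c \<in> vge x \<Longrightarrow> scal c (om g) \<in> Zset (vge x)"
  unfolding om_def by (intro Zset_lat L_brk mon_\<epsilon>_W)

lemma two_power_\<epsilon>: "2 ^ \<epsilon> \<in> vge (real t + 1)"
  by (rule vge_mono[OF vge_2_power]) (use t2_le_r Suc_\<epsilon>(1) in linarith)

text \<open>One step up the tree multiplies \<^term>\<open>zeta\<close> by a, up to a multiple of \<open>2 - a\<^sup>2\<close>; iterating gives
  the bound.\<close>

lemma zeta_step:
  assumes g: "g \<in> GL2_q2"
  shows "zeta g - scal a (zeta (g ** gm 2)) \<in> Zset (vge s)"
proof -
  define E where "E = xi g - scal a (xi (g ** gm 2)) + scal a (om (g ** gm 2)) - scal 2 (om (g ** gm 2 ** gm 2))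
     - scal (2 ^ \<epsilon>) (om g)"
  have E: "scal a E \<in> Zset (vge s)"
    unfolding E_def by (rule Zge_scal[OF xi_step[OF g] a_half]) (use s in simp)
  have eq: "zeta g - scal a (zeta (g ** gm 2)) =
      scal a E + scal (2 - a * a) (om (g ** gm 2)) + scal (a * 2 ^ \<epsilon>) (om g)"
    unfolding zeta_def E_def by (simp only: scal_simps) (simp only: algebra_simps)
  \<comment> \<open>Here 2 - 2 r^2 = -2 (r - 1) (r + 1), and r + 1 is even, so this part has
    valuation at least t + 2.\<close>
  have "2 - a * a = - (a * a - 2 * of_nat r * of_nat r) - 2 * of_nat \<epsilon> * of_nat (r + 1)"
    by (simp add: of_nat_r algebra_simps)
  also have "\<dots> \<in> vge s"
  proof (intro vge_diff)
    show "- (a * a - 2 * of_nat r * of_nat r) \<in> vge s" using \<beta> by (simp only: vge_uminus)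
    have "of_nat (r + 1) \<in> vge 1" using r_odd by (intro vge_even) simp
    thus "2 * of_nat \<epsilon> * of_nat (r + 1) \<in> vge s"
      by (rule vge_mono[OF vge_mult[OF two_\<epsilon>]]) (use s in linarith)
  qed
  finally have 1: "2 - a * a \<in> vge s" .
  have 2: "a * 2 ^ \<epsilon> \<in> vge s"
    by (rule vge_mono[OF vge_mult[OF a_half two_power_\<epsilon>]]) (use s in linarith)
  show ?thesis unfolding eq
    by (intro Zset_add vcone_vge E om_in 1 2) (simp_all add: g)
qed

lemma zeta_small:
  assumes "g \<in> GL2_q2"
  shows "zeta g \<in> Zset (vge s)"
proof -
  have *: "zeta g \<in> Zset (vge (min (real n / 2) s))" if "g \<in> GL2_q2" for n g
    using that
  proof (induction n arbitrary: g)
    case 0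
    have "scal a (xi g) \<in> Zset (vge 0)"
      unfolding xi_def by (rule Zge_scal[OF b_lat0[OF 0 mon_0_W] a_half]) simp
    moreover have "scal 2 (om (g ** gm 2)) \<in> Zset (vge 0)"
      by (rule Zge_mono[OF om_in[OF _ vge_2]]) (simp_all add: 0)
    ultimately show ?case unfolding zeta_def using s by (intro Zset_add) (simp_all add: min_def)
  next
    case (Suc n)
    have "zeta (g ** gm 2) \<in> Zset (vge (min (real n / 2) s))" using Suc by simp
    moreover have "min (real (Suc n) / 2) s \<le> min (real n / 2) s + 1 / 2"
      unfolding min_def of_nat_Suc by (simp split: if_splits)
    ultimately have "scal a (zeta (g ** gm 2)) \<in> Zset (vge (min (real (Suc n) / 2) s))"
      using a_half by (intro Zge_scal)
    moreover have "zeta g - scal a (zeta (g ** gm 2)) \<in> Zset (vge (min (real (Suc n) / 2) s))"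
      by (rule Zge_mono[OF zeta_step[OF Suc.prems]]) simp
    ultimately have "(zeta g - scal a (zeta (g ** gm 2))) + scal a (zeta (g ** gm 2)) \<in>
        Zset (vge (min (real (Suc n) / 2) s))" by (intro Zset_add vcone_vge)
    thus ?case by (simp only: diff_add_cancel)
  qed
  obtain n :: nat where "2 * s \<le> real n" using real_arch_simple by blast
  hence "min (real n / 2) s = s" by (intro min_absorb2) simp
  thus ?thesis using *[OF assms, of n] by simp
qed

text \<open>The sharp form of \<open>a_mon_0\<close>. There the term a^2 \<open>xi\<close> was
  discarded at valuation 3/2; here it joins 2 a \<open>om\<close> to form a \<open>zeta\<close>, of
  valuation at least s + 1/2.\<close>

lemma a_xi:
  assumes g: "g \<in> GL2_q2"
  shows "scal a (xi g) + scal (a * a) (om (g ** gm 2)) - scal (a * 2 ^ \<epsilon>) (om g) \<in> Zset (vgt s)"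
proof -
  define E where "E = xi g - scal a (xi (g ** gm 2)) + scal a (om (g ** gm 2)) - scal 2 (om (g ** gm 2 ** gm 2))
     - scal (2 ^ \<epsilon>) (om g)"
  have "scal a E \<in> Zset (vge (real t + 2))"
    unfolding E_def by (rule Zge_scal[OF xi_step[OF g] a_half]) simp
  hence E: "scal a E \<in> Zset (vgt s)" by (rule Zgt_if_Zge) (use s in linarith)
  have "scal a (zeta (g ** gm 2)) \<in> Zset (vge (s + 1 / 2))"
    by (rule Zge_scal[OF zeta_small a_half]) (simp_all add: g)
  hence Z: "scal a (zeta (g ** gm 2)) \<in> Zset (vgt s)" by (rule Zgt_if_Zge) simp
  have eq: "scal a (xi g) + scal (a * a) (om (g ** gm 2)) - scal (a * 2 ^ \<epsilon>) (om g) =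
      scal a E + scal a (zeta (g ** gm 2))"
    unfolding zeta_def E_def by (simp only: scal_simps) (simp only: algebra_simps)
  show ?thesis unfolding eq by (intro Zset_add vcone_vgt E Z)
qed

section \<open>From the three neighbours to the six vertices at distance two\<close>

definition taum :: "mat_q2 \<Rightarrow> ind_qbar2" where
  "taum g = b (g ** gm 0) (mon 1) - b (g ** gm 1) (mon 1) + b (g ** gm 2) (mon \<epsilon>)"

definition Sig' :: "mat_q2 \<Rightarrow> ind_qbar2" where
  "Sig' g = b (g ** gm 0) (mon 1 + mon 2) + b (g ** gm 1) (mon 1 + mon 2)
     + b (g ** gm 2) (mon \<epsilon> + mon (r - 2))"

lemma b_of_nat2: "b g (2 * of_nat m * of_nat n * w) = scal (2 * of_nat m * of_nat n) (b g w)"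
  using qb.brk_scal[of g "2 * of_nat m * of_nat n" w] by simp

lemma mon_sum_12_in: "mon 1 + mon 2 \<in> W" and mon_r2_W: "mon (r - 2) \<in> W"
  using r2 by (intro Wn_add mon_W; simp)+

lemma r\<epsilon>4: "4 * of_nat r * of_nat \<epsilon> \<in> vge (real t + 2)"
  using vge_mult[OF four_\<epsilon> vge_of_nat[of r]] by (simp add: mult_ac)

lemma vgt_s: "c \<in> vge (real t + 2) \<Longrightarrow> c \<in> vgt s"
  by (erule vgt_if_vge) (use s in linarith)

lemma b_lat_s: "g \<in> GL2_q2 \<Longrightarrow> w \<in> W \<Longrightarrow> c \<in> vgt s \<Longrightarrow> scal c (b g w) \<in> Zset (vgt s)"
  by (intro Zset_lat L_brk)

text \<open>For odd r both evaluations of a [g, \<open>HH\<close>] produce the minus sign at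
  \<open>gm 1\<close>, hence \<open>taum\<close> instead of \<open>tau\<close>. Changing the sign
  here would cost 2 a^2, of valuation 2; in \<open>tau_sigma\<close> it costs only 2 \<beta>, of
  valuation at least s + 1.\<close>

lemma taum_relation:
  assumes g: "g \<in> GL2_q2"
  shows "scal \<beta> (taum g) - scal (2 * of_nat r * of_nat \<epsilon>) (Sig' g) - scal (a * 2 ^ \<epsilon>) (b g (mon 1))
     \<in> Zset (vgt s)"
proof -
  obtain Q0 Q1 Q2 where Q: "Q0 \<in> W" "Q1 \<in> W" "Q2 \<in> W"
    "s0 HH = 2 * of_nat r * mon 1 + 2 * of_nat r * of_nat \<epsilon> * mon 2 + CC (4 * of_nat \<epsilon>) * Q0"
    "s1 HH = 2 * of_nat r * of_nat \<epsilon> * mon 2 - 2 * of_nat r * mon 1 + CC (4 * of_nat \<epsilon>) * Q1"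
    "s2 HH = 2 * of_nat r * mon \<epsilon> + 2 * of_nat r * of_nat \<epsilon> * mon (r - 2) + CC (4 * of_nat \<epsilon>) * Q2"
    by (rule HH_fine)
  obtain Q where Q': "Q \<in> W" "subst_XY (mon \<epsilon>) YY (2 * YY - XX) = mon 1 + CC (2 * of_nat \<epsilon>) * Q"
    by (rule Y_step)
  define b0 where "b0 = b (g ** gm 0)"
  define b1 where "b1 = b (g ** gm 1)"
  define b2 where "b2 = b (g ** gm 2)"
  note bd = b0_def b1_def b2_def
  define F where "F = scal (4 * of_nat \<epsilon>) (b0 Q0) + scal (4 * of_nat \<epsilon>) (b1 Q1) + scal (4 * of_nat \<epsilon>) (b2 Q2)"
  define R2 where "R2 = scal (2 * of_nat r * of_nat \<epsilon>) (b0 (mon 2) + b1 (mon 2) + b2 (mon (r - 2)))"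
  have F: "tree_sum g HH = scal (2 * of_nat r) (taum g) + R2 + F"
    unfolding tree_sum_def Q qb.brk_add qb.brk_diff b_of_nat2 b_2r qb.brk_scal[of _ "4 * of_nat \<epsilon>"]
      taum_def R2_def F_def bd scal_simps
    by (simp only: algebra_simps)
  have FZ: "F \<in> Zset (vgt s)" unfolding F_def bd
    by (intro Zset_add vcone_vgt b_lat_s vgt_s four_\<epsilon> Q) (simp_all add: g)
  \<comment> \<open>The coefficient of the corrections left by the three climbs. In
    \<open>HH\<close> those with \<open>mon \<epsilon>\<close> cancel, the one with
    \<open>mon r\<close> is small, and -c [g, \<open>mon 1\<close>] survives.\<close>
  define c where "c = a * 2 ^ \<epsilon>"
  define DX where "DX = scal a (b g (mon 0)) + scal (a * a) (b2 (mon \<epsilon>)) - scal c (b g (mon \<epsilon>))"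
  define DY where "DY = scal a (b g (mon r)) + scal (a * a) (b0 (mon 1)) - scal c (b g (mon 1))"
  define DXY where "DXY = scal a (b g XYr) + scal (a * a) (b1 (mon 1 + CC (2 * of_nat \<epsilon>) * Q))
     - scal c (b g (mon \<epsilon> + mon r))"
  have DX: "DX \<in> Zset (vgt s)"
    using a_xi[OF g] unfolding DX_def bd xi_def om_def c_def .
  have fl: "subst_XY (mon \<epsilon>) YY XX = mon 1"
    using mon_flip[of \<epsilon>] r2 by (simp add: \<epsilon>_def)
  have DY: "DY \<in> Zset (vgt s)"
    using a_xi[of "g ** kmat 0 1 1 0"] g mon_flip[of 0]
    unfolding DY_def bd xi_def om_def c_def by (simp add: b_flip b_flip_gm2 fl del: One_nat_def)
  have sh: "subst_XY (mon \<epsilon>) (XX + YY) YY = mon \<epsilon> + mon r"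
  proof -
    have "mon r = YY * YY ^ \<epsilon>" unfolding power_Suc[symmetric] Suc_\<epsilon> by (simp add: mon_def)
    thus ?thesis unfolding mon_\<epsilon>(5) by (simp add: subst_XY_hom algebra_simps)
  qed
  have DXY: "DXY \<in> Zset (vgt s)"
    using a_xi[of "g ** kmat 1 0 1 1"] g
    unfolding DXY_def bd xi_def om_def c_def
    by (simp add: b_shear b_shear_gm2 mon_0_shear Q' sh del: One_nat_def CC_hom)
  have R1: "scal (a * a * (2 * of_nat \<epsilon>)) (b1 Q) \<in> Zset (vgt s)"
    unfolding bd by (intro b_lat_s Q' vgt_s) (use vge_mult[OF a2 two_\<epsilon>] g in \<open>simp_all add: add.commute\<close>)
  have R3: "scal c (b g (mon r)) \<in> Zset (vgt s)"
  proof -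
    have "c \<in> vge (1 / 2 + (real t + 1))" unfolding c_def by (rule vge_mult[OF a_half two_power_\<epsilon>])
    from Zge_scal[OF mon_r_small[OF g] this order.refl] show ?thesis
      by (rule Zgt_if_Zge) (use s in linarith)
  qed
  have e1: "b1 (mon 1 + CC (2 * of_nat \<epsilon>) * Q) = b1 (mon 1) + scal (2 * of_nat \<epsilon>) (b1 Q)"
    unfolding bd qb.brk_add qb.brk_scal ..
  have aH: "scal a (b g HH) = DXY - DX - DY + scal (a * a) (taum g)
      - scal (a * a * (2 * of_nat \<epsilon>)) (b1 Q) + scal c (b g (mon r)) - scal c (b g (mon 1))"
    unfolding HH_def DXY_def DX_def DY_def taum_def bd[symmetric] qb.brk_diff qb.brk_add e1
    by (simp only: scal_simps) (simp only: algebra_simps)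
  define d where "d = 2 * of_nat r * of_nat \<epsilon> * (1 :: qbar2)"
  have dd: "d + d = 4 * of_nat r * of_nat \<epsilon>" by (simp add: d_def)
  have R4: "scal (d + d) (b0 (mon 1) + b2 (mon \<epsilon>)) \<in> Zset (vgt s)"
    unfolding dd bd scal_simps
    by (intro Zset_add vcone_vgt b_lat_s vgt_s r\<epsilon>4 mon_1_W mon_\<epsilon>_W) (simp_all add: g)
  \<comment> \<open>The quadratic terms are completed to \<open>mon 1 + mon 2\<close>, and likewise
    at the flipped neighbour. The linear terms added for this purpose amount to d
    \<open>taum\<close>, up to multiples of 2 d, and lower the coefficient a^2 - 2 r to \<beta> =
    a^2 - 2 r^2.\<close>
  have R2: "R2 = scal d (Sig' g) + scal d (taum g) - scal (d + d) (b0 (mon 1) + b2 (mon \<epsilon>))"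
    unfolding R2_def Sig'_def taum_def bd qb.brk_add d_def mult_1_right
    by (simp only: scal_simps) (simp only: algebra_simps)
  have \<beta>d: "\<beta> = a * a - 2 * of_nat r - d"
    unfolding \<beta>_def d_def by (simp add: of_nat_r algebra_simps)
  have "scal \<beta> (taum g) - scal d (Sig' g) - scal c (b g (mon 1)) =
     F - rl g HH - DXY + DX + DY + scal (a * a * (2 * of_nat \<epsilon>)) (b1 Q) - scal c (b g (mon r))
     - scal (d + d) (b0 (mon 1) + b2 (mon \<epsilon>))"
  proof -
    have "scal (2 * of_nat r) (taum g) + R2 + F - rl g HH = DXY - DX - DY + scal (a * a) (taum g)
      - scal (a * a * (2 * of_nat \<epsilon>)) (b1 Q) + scal c (b g (mon r)) - scal c (b g (mon 1))"
      using aH unfolding scal_a_b F .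
    hence "scal (a * a) (taum g) = scal (2 * of_nat r) (taum g) + R2 + F - rl g HH - DXY + DX + DY
      + scal (a * a * (2 * of_nat \<epsilon>)) (b1 Q) - scal c (b g (mon r)) + scal c (b g (mon 1))"
      by (simp only: algebra_simps)
    thus ?thesis unfolding \<beta>d R2 scal_simps by (simp only: algebra_simps)
  qed
  also have "\<dots> \<in> Zset (vgt s)"
    by (intro Zset_add Zset_diff vcone_vgt FZ DXY DX DY R1 R3 R4 rl_in g HH_W)
  finally show ?thesis by (simp only: c_def d_def mult_1_right)
qed

definition child2 :: "mat_q2 \<Rightarrow> ind_qbar2" where
  "child2 g = b (g ** gm 0) (mon 1) + b (g ** gm 1) (mon 1)"

text \<open>From the neighbours \<open>gm 0\<close> and \<open>gm 1\<close> the way back to g is the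
  branch \<open>gm 2\<close>, which \<open>child2\<close> omits. From the neighbour
  \<open>gm 2\<close> it is the branch \<open>gm 0\<close>; the flip moves it to
  \<open>gm 2\<close>, so that the remaining branches lead away from g there too.\<close>

definition sigma :: "mat_q2 \<Rightarrow> ind_qbar2" where
  "sigma g = child2 (g ** gm 0) + child2 (g ** gm 1) + child2 (g ** gm 2 ** kmat 0 1 1 0)"

lemma mon_quadratic:
  "mon 0 = XX ^ (r - 2) * (XX * XX)" "mon 1 = XX ^ (r - 2) * (XX * YY)" "mon 2 = XX ^ (r - 2) * (YY * YY)"
proof -
  have "(r - 2) + 2 = r" "(r - 2) + 1 = r - 1" using r2 by auto
  hence "XX ^ r = XX ^ (r - 2) * (XX ^ 2 :: qbar2 poly poly)"
    "XX ^ (r - 1) = XX ^ (r - 2) * (XX ^ 1 :: qbar2 poly poly)"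
    unfolding power_add[symmetric] by simp_all
  thus "mon 0 = XX ^ (r - 2) * (XX * XX)" "mon 1 = XX ^ (r - 2) * (XX * YY)" "mon 2 = XX ^ (r - 2) * (YY * YY)"
    unfolding mon_def power2_eq_square by (simp_all add: mult.assoc)
qed

text \<open>On the branches \<open>gm 0\<close> and \<open>gm 1\<close> the polynomial
  \<open>mon 1 + mon 2\<close> becomes 2 \<open>mon 1\<close> modulo 4. On the branch
  \<open>gm 2\<close> the coefficient \<open>2 ^ (r - 2)\<close> is kept because it is only 2 for r
  = 3.\<close>

lemma mon_12_step:
  assumes g: "g \<in> GL2_q2"
  shows "scal a (b g (mon 1 + mon 2)) - scal 2 (child2 g) - scal (2 ^ (r - 2)) (b (g ** gm 2) (mon 2))
     \<in> Zset (vge 2)"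
proof -
  have r\<epsilon>: "r - 1 = \<epsilon>" by (simp add: \<epsilon>_def)
  have S0: "s0 (mon 1 + mon 2) = CC 2 * mon 1 + 4 * mon 2" unfolding s_add s_mon by simp
  have S2: "s2 (mon 1 + mon 2) = CC (2 ^ \<epsilon>) * mon 1 + CC (2 ^ (r - 2)) * mon 2"
    unfolding s_add s_mon r\<epsilon> by (simp add: CC_power)
  have S1: "s1 (mon 1 + mon 2) = CC 2 * mon 1 - 4 * mon 1 + 4 * mon 2"
    unfolding mon_quadratic by (simp add: subst_XY_hom algebra_simps)
  have eq: "scal a (b g (mon 1 + mon 2)) - scal 2 (child2 g) - scal (2 ^ (r - 2)) (b (g ** gm 2) (mon 2)) =
    b (g ** gm 0) (4 * mon 2) - b (g ** gm 1) (4 * mon 1) + b (g ** gm 1) (4 * mon 2)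
    + scal (2 ^ \<epsilon>) (b (g ** gm 2) (mon 1)) - rl g (mon 1 + mon 2)"
    unfolding scal_a_b unfolding tree_sum_def S0 S1 S2 child2_def qb.brk_add qb.brk_diff
      qb.brk_scal[of _ 2 "mon 1"] qb.brk_scal[of _ _ "mon 2"] qb.brk_scal[of _ "2 ^ \<epsilon>"] scal_simps
    by (simp only: algebra_simps)
  have 1: "scal (2 ^ \<epsilon>) (b (g ** gm 2) (mon 1)) \<in> Zset (vge 2)"
    by (intro Zset_lat L_brk mon_1_W vge_mono[OF two_power_\<epsilon>]) (use t1 g in simp_all)
  show ?thesis unfolding eq
    by (intro Zset_add Zset_diff vcone_vge b_lat_4 1 rl_in mon_1_W mon_2_W mon_sum_12_in) (simp_all add: g)
qed

lemma inverse_a: "inverse a \<in> vge (- (1 / 2))"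
  by (rule vge_I[OF v_inverse[OF va]])

lemma mon_12_scaled:
  assumes g: "g \<in> GL2_q2"
  shows "scal (2 * of_nat r * of_nat \<epsilon>) (b g (mon 1 + mon 2)) - scal (4 * of_nat r * of_nat \<epsilon> / a) (child2 g)
     - scal (2 * of_nat r * of_nat \<epsilon> * 2 ^ (r - 2) / a) (b (g ** gm 2) (mon 2)) \<in> Zset (vgt s)"
proof -
  define d where "d = 2 * of_nat r * of_nat \<epsilon> * (1 :: qbar2)"
  have d: "d \<in> vge (real t + 1)"
    using vge_mult[OF two_\<epsilon> vge_of_nat[of r]] by (simp add: d_def mult_ac)
  have "d * inverse a \<in> vge (real t + 1 + - (1 / 2))" by (rule vge_mult[OF d inverse_a])
  from Zge_scal[OF mon_12_step[OF g] this order.refl]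
  have "scal (d * inverse a) (scal a (b g (mon 1 + mon 2)) - scal 2 (child2 g)
      - scal (2 ^ (r - 2)) (b (g ** gm 2) (mon 2))) \<in> Zset (vgt s)"
    by (rule Zgt_if_Zge) (use s in linarith)
  moreover have "d * inverse a * a = d" "d * inverse a * 2 = 4 * of_nat r * of_nat \<epsilon> / a"
    "d * inverse a * 2 ^ (r - 2) = 2 * of_nat r * of_nat \<epsilon> * 2 ^ (r - 2) / a"
    using a_neq_0 by (simp_all add: d_def field_simps)
  ultimately show ?thesis unfolding scal_simps by (simp only: d_def mult_1_right)
qed

text \<open>If t = 1 then r = 3 modulo 4, so 3 r - 1 is divisible by 4. If t is at least 2 then t +
  3 \<le> r, and it suffices that 3 r - 1 is even.\<close>

lemma r_t_bound: "of_nat (3 * r - 1) \<in> vge (real t + 4 - real r)"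
proof (cases "t = 1")
  case True
  have "v (of_nat \<epsilon>) = 1" using t True by (simp add: \<epsilon>_def one_ereal_def)
  obtain k m where km: "odd m" "\<epsilon> = 2 ^ k * m" "v (of_nat \<epsilon>) = ereal (real k)"
    using v_of_nat[OF \<epsilon>_pos] by blast
  hence "k = 1" using \<open>v (of_nat \<epsilon>) = 1\<close> by (simp add: one_ereal_def)
  then obtain n where n: "\<epsilon> = 2 * (2 * n + 1)" using km by (auto elim!: oddE)
  have "3 * r - 1 = 2 * (2 * (3 * n + 2))" using n by (simp add: \<epsilon>_def)
  hence e: "of_nat (3 * r - 1) = (2 * (2 * of_nat (3 * n + 2)) :: qbar2)" by (simp only: of_nat_mult of_nat_numeral)
  have "2 * (2 * of_nat (3 * n + 2)) \<in> vge (1 + (1 + 0))" by (intro vge_mult vge_2 vge_of_nat)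
  thus ?thesis unfolding e using True r3 by (elim vge_mono) simp
next
  case False
  hence "2 \<le> t" using t1 by simp
  hence "t + 2 \<le> 2 ^ t" by (induction t rule: dec_induct) auto
  hence "t + 3 \<le> r" using rt r3 by linarith
  moreover have "of_nat (3 * r - 1) \<in> vge 1" using r_odd r2 by (intro vge_even) simp
  ultimately show ?thesis by (elim vge_mono) linarith
qed

text \<open>The branch omitted by \<open>child2\<close> returns to g from each neighbour, so the
  left-over terms of \<open>mon_12_step\<close> all collect at g, up to a shear and a flip of the
  polynomial.\<close>

lemma third_neighbours:
  "b (g ** gm 0 ** gm 2) (mon 2) = b g (mon 2)"
  "b (g ** gm 1 ** gm 2) (mon 2) = b g (mon 0 + 2 * mon 1 + mon 2)"
  "b (g ** gm 2 ** kmat 0 1 1 0 ** gm 2) (mon 2) = b g (mon (r - 2))"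
proof -
  have m: "gm 0 ** gm 2 = (mat 2 :: mat_q2)" "gm 1 ** gm 2 = mat 2 ** kmat 1 1 0 1"
    by (simp_all add: gm_def kmat_def matrix_eq_iff_2)
  show "b (g ** gm 0 ** gm 2) (mon 2) = b g (mon 2)"
    unfolding matrix_mul_assoc[symmetric] m by (rule b_mat_2)
  have "b (g ** gm 1 ** gm 2) (mon 2) = b (g ** mat 2 ** kmat 1 1 0 1) (mon 2)"
    unfolding matrix_mul_assoc[symmetric] m ..
  also have "\<dots> = b (g ** mat 2) (subst_XY (mon 2) XX (XX + YY))"
    by (subst b_kmat) simp_all
  also have "subst_XY (mon 2) XX (XX + YY) = mon 0 + 2 * mon 1 + mon 2"
    unfolding mon_quadratic by (simp add: subst_XY_hom algebra_simps)
  finally show "b (g ** gm 1 ** gm 2) (mon 2) = b g (mon 0 + 2 * mon 1 + mon 2)"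
    unfolding b_mat_2 .
  have "b (g ** gm 2 ** gm 0) w = b g w" for w
    using b_mat_2[of g w] by (simp only: matrix_mul_assoc[symmetric] matrix_relations)
  thus "b (g ** gm 2 ** kmat 0 1 1 0 ** gm 2) (mon 2) = b g (mon (r - 2))"
    unfolding b_flip_gm2 using mon_flip[OF r2] by simp
qed

lemma third_neighbours_sum:
  assumes g: "g \<in> GL2_q2"
  shows "b g (mon 2) + b g (mon 0 + 2 * mon 1 + mon 2) + b g (mon (r - 2)) - b g (mon 1) \<in> Zset (vge (1 / 2))"
proof -
  have eq: "b g (mon 2) + b g (mon 0 + 2 * mon 1 + mon 2) + b g (mon (r - 2)) - b g (mon 1) =
     b g (mon (r - 2) - mon 1) + b g (mon 0) + b g (2 * (mon 1 + mon 2))"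
    unfolding qb.brk_add[symmetric] qb.brk_diff[symmetric] by (rule arg_cong[of _ _ "b g"]) (simp add: algebra_simps)
  have "b g (mon (r - 2) - mon 1) \<in> Zset (vge (1 - 1 / 2))" using g r3 by (intro mon_diff_small) auto
  moreover have "b g (2 * (mon 1 + mon 2)) \<in> Zset (vge (1 / 2))"
    by (rule Zge_mono[OF b_lat_2[OF g mon_sum_12_in]]) simp
  ultimately show ?thesis unfolding eq using mon_0_small[OF g] by (intro Zset_add) simp_all
qed

lemma coefficient_small:
  "2 * of_nat r * of_nat \<epsilon> * 2 ^ (r - 2) / a + a * 2 ^ \<epsilon> \<in> vgt s"
proof -
  have "\<epsilon> = Suc (r - 2)" using r2 by (simp add: \<epsilon>_def)
  hence p: "2 * 2 ^ (r - 2) = (2 ^ \<epsilon> :: qbar2)" by simp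
  have "2 * of_nat r * of_nat \<epsilon> * 2 ^ (r - 2) / a + a * 2 ^ \<epsilon> = (2 ^ \<epsilon> * inverse a) * (of_nat r * of_nat \<epsilon> + a * a)"
  proof -
    define x :: qbar2 where "x = 2 ^ \<epsilon>"
    have "2 * of_nat r * of_nat \<epsilon> * 2 ^ (r - 2) / a = x * (of_nat r * of_nat \<epsilon>) / a"
      unfolding x_def p[symmetric] by (simp only: mult_ac)
    moreover have "x * n / a + a * x = (x * inverse a) * (n + a * a)" for n
    proof -
      have "inverse a * (a * a) = a" using a_neq_0 by simp
      hence "x * (inverse a * (a * a)) = x * a" by (simp only:)
      thus ?thesis by (simp only: divide_inverse distrib_left mult_ac)
    qed
    ultimately show ?thesis by (simp only: x_def)
  qed
  also have "of_nat r * of_nat \<epsilon> + a * a = \<beta> + of_nat (3 * r - 1) * of_nat r"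
  proof -
    have "3 * r - 1 = 3 * \<epsilon> + 2" using r2 by (simp add: \<epsilon>_def)
    hence "of_nat (3 * r - 1) = (3 * of_nat \<epsilon> + 2 :: qbar2)" by simp
    thus ?thesis unfolding \<beta>_def of_nat_r by (simp add: algebra_simps)
  qed
  also have "(2 ^ \<epsilon> * inverse a) * (\<beta> + of_nat (3 * r - 1) * of_nat r) =
     (2 ^ \<epsilon> * inverse a) * \<beta> + (2 ^ \<epsilon> * inverse a) * (of_nat (3 * r - 1) * of_nat r)"
    by (simp add: algebra_simps)
  also have "\<dots> \<in> vgt s"
  proof -
    have 1: "2 ^ \<epsilon> * inverse a \<in> vge (real \<epsilon> + - (1 / 2))"
      by (intro vge_mult vge_2_power inverse_a)
    have re: "real r = real \<epsilon> + 1" using Suc_\<epsilon>(1) by linarith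
    have "\<beta> \<in> vge s" using \<beta> by (simp only: \<beta>_def)
    from vge_mult[OF 1 this] have "(2 ^ \<epsilon> * inverse a) * \<beta> \<in> vgt s"
      by (rule vgt_if_vge) (use r3 re in linarith)
    moreover have "of_nat (3 * r - 1) * of_nat r \<in> vge (real t + 4 - real r + 0)"
      by (intro vge_mult r_t_bound vge_of_nat)
    from vge_mult[OF 1 this] have "(2 ^ \<epsilon> * inverse a) * (of_nat (3 * r - 1) * of_nat r) \<in> vgt s"
      by (rule vgt_if_vge) (use s re in linarith)
    ultimately show ?thesis by (rule vgt_add)
  qed
  finally show ?thesis .
qed

lemma child2_in: "g \<in> GL2_q2 \<Longrightarrow> child2 g \<in> Zset (vge 0)"
  unfolding child2_def by (intro Zset_add vcone_vge b_lat0 mon_1_W) simp_all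

lemma sigma_in: "g \<in> GL2_q2 \<Longrightarrow> sigma g \<in> Zset (vge 0)"
  unfolding sigma_def by (intro Zset_add vcone_vge child2_in) simp_all

lemma taum_sigma:
  assumes g: "g \<in> GL2_q2"
  shows "scal \<beta> (taum g) - scal (4 * of_nat r * of_nat \<epsilon> / a) (sigma g) \<in> Zset (vgt s)"
proof -
  define d where "d = 2 * of_nat r * of_nat \<epsilon> * (1 :: qbar2)"
  define e where "e = 4 * of_nat r * of_nat \<epsilon> / a"
  define \<kappa> where "\<kappa> = 2 * of_nat r * of_nat \<epsilon> * 2 ^ (r - 2) / a"
  define c where "c = a * 2 ^ \<epsilon>"
  define U where "U g = b g (mon 1 + mon 2)" for g
  define V where "V = b g (mon 2) + b g (mon 0 + 2 * mon 1 + mon 2) + b g (mon (r - 2))"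
  have "subst_XY (mon 1 + mon 2) YY XX = mon \<epsilon> + mon (r - 2)"
    using r2 mon_flip[of 1] mon_flip[of 2] by (simp add: subst_XY_add \<epsilon>_def)
  hence S: "Sig' g = U (g ** gm 0) + U (g ** gm 1) + U (g ** gm 2 ** kmat 0 1 1 0)"
    unfolding Sig'_def U_def b_flip by simp
  define E where "E h = scal d (U h) - scal e (child2 h) - scal \<kappa> (b (h ** gm 2) (mon 2))" for h
  have E: "E h \<in> Zset (vgt s)" if "h \<in> GL2_q2" for h
    using mon_12_scaled[OF that] unfolding E_def d_def U_def e_def \<kappa>_def mult_1_right .
  have dS: "scal d (Sig' g) = E (g ** gm 0) + E (g ** gm 1) + E (g ** gm 2 ** kmat 0 1 1 0)
      + scal e (sigma g) + scal \<kappa> V"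
    unfolding S E_def sigma_def V_def third_neighbours by (simp only: scal_simps) (simp only: algebra_simps)
  have \<kappa>: "\<kappa> \<in> vge (real t + 3 / 2)"
  proof -
    have "d \<in> vge (real t + 1)"
      using vge_mult[OF two_\<epsilon> vge_of_nat[of r]] by (simp add: d_def mult_ac)
    from vge_mult[OF vge_mult[OF this vge_2_power[of "r - 2"]] inverse_a]
    have "d * 2 ^ (r - 2) * inverse a \<in> vge (real t + 3 / 2)"
      by (rule vge_mono) (use r3 in \<open>simp add: of_nat_diff\<close>)
    thus ?thesis by (simp only: \<kappa>_def d_def divide_inverse mult_1_right)
  qed
  \<comment> \<open>The terms collected at g agree with \<kappa> [g, \<open>mon 1\<close>] up to a
    negligible error, and so combine with the term c [g, \<open>mon 1\<close>] of
    \<open>taum_relation\<close>.\<close>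
  have "scal \<kappa> (V - b g (mon 1)) \<in> Zset (vge (real t + 2))"
    unfolding V_def by (rule Zge_scal[OF third_neighbours_sum[OF g] \<kappa>]) simp
  hence V: "scal \<kappa> (V - b g (mon 1)) \<in> Zset (vgt s)" by (rule Zgt_if_Zge) (use s in linarith)
  have 1: "scal (\<kappa> + c) (b g (mon 1)) \<in> Zset (vgt s)"
    by (intro b_lat_s g mon_1_W) (simp only: \<kappa>_def c_def coefficient_small)
  define R where "R = scal \<beta> (taum g) - scal d (Sig' g) - scal c (b g (mon 1))"
  have R: "R \<in> Zset (vgt s)"
    using taum_relation[OF g] unfolding R_def d_def c_def mult_1_right .
  have "scal \<beta> (taum g) - scal e (sigma g) =
      R + E (g ** gm 0) + E (g ** gm 1) + E (g ** gm 2 ** kmat 0 1 1 0)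
      + scal \<kappa> (V - b g (mon 1)) + scal (\<kappa> + c) (b g (mon 1))"
    unfolding R_def dS by (simp only: scal_simps) (simp only: algebra_simps)
  also have "\<dots> \<in> Zset (vgt s)"
    by (intro Zset_add vcone_vgt R E V 1) (simp_all add: g)
  finally show ?thesis unfolding e_def .
qed

theorem tau_sigma:
  assumes g: "g \<in> GL2_q2"
  shows "scal (\<beta> / (2 * a)) (tau g) - scal (of_nat \<epsilon>) (sigma g) \<in> Zset (vgt (s - 3 / 2))"
proof -
  have \<beta>s: "\<beta> \<in> vge s" using \<beta> by (simp only: \<beta>_def)
  define e where "e = 4 * of_nat r * of_nat \<epsilon> / a"
  have tt: "tau g = taum g + b (g ** gm 1) (mon 1) + b (g ** gm 1) (mon 1)"
    unfolding tau_def taum_def \<epsilon>_def by (simp only: algebra_simps)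
  have "2 * \<beta> \<in> vge (1 + s)" by (intro vge_mult vge_2 \<beta>s)
  hence "2 * \<beta> \<in> vgt s" by (rule vgt_if_vge) simp
  hence 1: "scal (2 * \<beta>) (b (g ** gm 1) (mon 1)) \<in> Zset (vgt s)"
    by (intro b_lat_s mon_1_W) (simp_all add: g)
  \<comment> \<open>The coefficient 4 r / a may be replaced by 2 a because a^2 is close to 2 r: the
    difference 2 r - a^2 = -\<beta> - 2 r (r - 1) has valuation at least 3/2.\<close>
  have "e - 2 * a * of_nat \<epsilon> = (2 * of_nat \<epsilon> * inverse a) * (- \<beta> - 2 * of_nat \<epsilon> * of_nat r)"
  proof -
    have eq: "- \<beta> - 2 * of_nat \<epsilon> * of_nat r = 2 * of_nat r - a * a"
      unfolding \<beta>_def of_nat_r by (simp add: algebra_simps)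
    show ?thesis unfolding eq e_def using a_neq_0 by (simp add: field_simps)
  qed
  also have "\<dots> \<in> vge ((real t + 1 + - (1 / 2)) + 3 / 2)"
  proof (rule vge_mult[OF vge_mult[OF two_\<epsilon> inverse_a] vge_diff])
    show "- \<beta> \<in> vge (3 / 2)" using vge_mono[OF \<beta>s s(1)] by simp
    show "2 * of_nat \<epsilon> * of_nat r \<in> vge (3 / 2)"
      by (rule vge_mono[OF vge_mult[OF two_\<epsilon> vge_of_nat]]) (use t1 in simp)
  qed
  finally have "e - 2 * a * of_nat \<epsilon> \<in> vge (real t + 2)" by (rule vge_mono) simp
  from Zge_scal[OF sigma_in[OF g] this order.refl]
  have 2: "scal (e - 2 * a * of_nat \<epsilon>) (sigma g) \<in> Zset (vgt s)"
    by (rule Zgt_if_Zge) (use s in linarith)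
  have "scal \<beta> (tau g) - scal (2 * a * of_nat \<epsilon>) (sigma g) =
     (scal \<beta> (taum g) - scal e (sigma g)) + scal (2 * \<beta>) (b (g ** gm 1) (mon 1))
     + scal (e - 2 * a * of_nat \<epsilon>) (sigma g)"
  proof -
    have "scal (2 * \<beta>) f = scal \<beta> f + scal \<beta> f" for f :: ind_qbar2
      using scal_simps(4)[of \<beta> \<beta> f] by (simp only: mult_2)
    thus ?thesis unfolding tt by (simp only: scal_simps) (simp only: algebra_simps)
  qed
  also have "\<dots> \<in> Zset (vgt s)"
    using taum_sigma[OF g] 1 2 unfolding e_def[symmetric] by (intro Zset_add vcone_vgt)
  finally have f: "scal \<beta> (tau g) - scal (2 * a * of_nat \<epsilon>) (sigma g) \<in> Zset (vgt s)" .
  have a0: "2 * a \<noteq> 0" using a_neq_0 two_neq_0 by simp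
  have v2a: "v (2 * a) = ereal (3 / 2)" using va by (simp add: v_mult one_ereal_def)
  have "scal (2 * a) (scal (\<beta> / (2 * a)) (tau g) - scal (of_nat \<epsilon>) (sigma g)) =
      scal \<beta> (tau g) - scal (2 * a * of_nat \<epsilon>) (sigma g)"
    using a0 by (simp only: scal_simps nonzero_mult_div_cancel_left times_divide_eq_right simp_thms)
  with f show ?thesis by (intro Zgt_cancel[OF _ v2a]) simp
qed

end

section \<open>The two ranges of v(\<alpha>')\<close>

context slope01
begin

text \<open>The valuation of \<beta> = 2 a \<alpha>' is at least 1 + \<alpha>, which exceeds v(a^2)
  = 2 \<alpha>. Hence a^2 and 2 r^2 have the same valuation: 2 \<alpha> = 1 + 2 v(r), and \<alpha> <
  1 forces v(r) = 0.\<close>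

lemma half_if_nonneg:
  assumes "(a * a - 2 * of_nat r * of_nat r) / (2 * a) \<in> vge 0"
  shows "\<alpha> = 1 / 2 \<and> odd r"
proof -
  define \<beta> where "\<beta> = a * a - 2 * of_nat r * of_nat r"
  have "(2 * a) * (\<beta> / (2 * a)) \<in> vge ((1 + \<alpha>) + 0)"
    using assms unfolding \<beta>_def[symmetric] by (intro vge_mult vge_2 a_vge)
  hence \<beta>: "\<beta> \<in> vge (1 + \<alpha>)" using a_neq_0 two_neq_0 by simp
  have vaa: "v (a * a) = ereal (2 * \<alpha>)" by (simp add: v_mult va)
  have aa: "a * a = \<beta> + 2 * of_nat r * of_nat r" by (simp add: \<beta>_def)
  have "odd r"
  proof
    assume "even r"
    have "2 * of_nat r * of_nat r \<in> vge (1 + 1 + 1)" by (intro vge_mult vge_2 vge_even \<open>even r\<close>)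
    hence "2 * of_nat r * of_nat r \<in> vge (1 + \<alpha>)" by (rule vge_mono) (use \<alpha>_less in simp)
    hence "a * a \<in> vge (1 + \<alpha>)" unfolding aa using \<beta> by (intro vge_add)
    thus False using vaa \<alpha>_less by (simp add: vge_def)
  qed
  hence v1: "v (2 * of_nat r * of_nat r) = ereal 1" by (simp add: v_mult v_odd one_ereal_def)
  have "\<not> 2 * \<alpha> < 1"
  proof
    assume "2 * \<alpha> < 1"
    have "a * a \<in> vge 1" unfolding aa using \<alpha>_pos v1 by (intro vge_add vge_mono[OF \<beta>]) (auto intro: vge_I)
    thus False using vaa \<open>2 * \<alpha> < 1\<close> by (simp add: vge_def one_ereal_def)
  qed
  moreover have "\<not> 1 < 2 * \<alpha>"
  proof
    assume "1 < 2 * \<alpha>"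
    have "a * a - \<beta> \<in> vgt 1"
      using \<alpha>_pos vaa \<open>1 < 2 * \<alpha>\<close> by (intro vgt_diff vgt_if_vge[OF \<beta>] vgt_if_vge[OF vge_I]) auto
    thus False using v1 by (simp add: aa vgt_def)
  qed
  ultimately show ?thesis using \<open>odd r\<close> by auto
qed

text \<open>The level x of \<alpha>' is shifted by v(2 a) = 3/2 to give the precision for \<beta>.
  The bound \<open>2 ^ t \<le> r - 1\<close> holds since 2^t is the exact power of 2 in r -
  1.\<close>

lemma slope_half_I:
  assumes "(a * a - 2 * of_nat r * of_nat r) / (2 * a) \<in> vge x" "0 \<le> x" "x \<le> real t"
    and t: "v (of_nat (r - 1)) = ereal (real t)"
  shows "slope_half v red r a t (x + 3 / 2)"
proof -
  have \<alpha>: "\<alpha> = 1 / 2" and r: "odd r"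
    using half_if_nonneg[OF vge_mono[OF assms(1,2)]] by auto
  interpret q: slope01 v red r a "1 / 2" using slope01_axioms unfolding \<alpha> .
  have "r - 1 > 0" using r2 by simp
  then obtain k m where km: "odd m" "r - 1 = 2 ^ k * m" "v (of_nat (r - 1)) = ereal (real k)"
    by (rule v_of_nat)
  have kt: "k = t" using km(3) t by simp
  have "(2 * a) * ((a * a - 2 * of_nat r * of_nat r) / (2 * a)) \<in> vge ((1 + 1 / 2) + x)"
    by (intro vge_mult vge_2 q.a_vge assms(1))
  hence "a * a - 2 * of_nat r * of_nat r \<in> vge (x + 3 / 2)" using a_neq_0 two_neq_0 by (simp add: add.commute)
  moreover have "1 \<le> t"
  proof (rule ccontr)
    assume "\<not> 1 \<le> t"
    hence "r - 1 = m" using km kt by simp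
    thus False using km(1) r r2 by auto
  qed
  moreover have "2 ^ t \<le> r - 1" using km kt by (cases m) auto
  ultimately show ?thesis using r t assms(2,3) by unfold_locales auto
qed

theorem tau_zero:
  assumes "v ((a * a - 2 * of_nat r * of_nat r) / (2 * a)) < v (of_nat (r - 1))" and g: "g \<in> GL2_q2"
  shows "tau g \<in> Zset (vgt 0)"
proof -
  define \<alpha>' where "\<alpha>' = (a * a - 2 * of_nat r * of_nat r) / (2 * a)"
  have "\<alpha>' \<noteq> 0" using assms(1) by (auto simp: \<alpha>'_def)
  then obtain x where x: "v \<alpha>' = ereal x" using v_finite by blast
  show ?thesis
  proof (cases "0 \<le> x")
    case True
    have "r - 1 > 0" using r2 by simp
    then obtain t m where tm: "odd m" "r - 1 = 2 ^ t * m" "v (of_nat (r - 1)) = ereal (real t)"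
      by (rule v_of_nat)
    have xt: "x < real t" using assms(1) x tm(3) by (simp add: \<alpha>'_def)
    interpret h: slope_half v red r a t "x + 3 / 2"
      by (rule slope_half_I) (use True xt tm x in \<open>auto simp: \<alpha>'_def[symmetric] vge_I\<close>)
    have f: "scal \<alpha>' (tau g) - scal (of_nat h.\<epsilon>) (h.sigma g) \<in> Zset (vgt x)"
      using h.tau_sigma[OF g] unfolding h.\<beta>_def \<alpha>'_def[symmetric] by simp
    \<comment> \<open>As v(\<alpha>') = x lies strictly below t, the \<open>sigma\<close> term is
      itself an error, and dividing by \<alpha>' isolates \<open>tau\<close>.\<close>
    have "scal (of_nat h.\<epsilon>) (h.sigma g) \<in> Zset (vge (real t))"
      by (rule Zge_scal[OF h.sigma_in[OF g] h.\<epsilon>_vge]) simp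
    hence "scal (of_nat h.\<epsilon>) (h.sigma g) \<in> Zset (vgt x)" by (rule Zgt_if_Zge) (rule xt)
    from Zset_add[OF vcone_vgt f this] have "scal \<alpha>' (tau g) \<in> Zset (vgt x)" by simp
    from Zgt_cancel[OF this x] show ?thesis by simp
  next
    case False
    \<comment> \<open>This is v(\<beta>), because \<beta> = 2 a \<alpha>'. It lies below 1 +
      \<alpha> since x is negative, so the coarse relation suffices.\<close>
    define s where "s = 1 + \<alpha> + x"
    define \<beta> where "\<beta> = a * a - 2 * of_nat r * of_nat r"
    have "\<beta> = 2 * a * \<alpha>'" using a_neq_0 two_neq_0 by (simp add: \<beta>_def \<alpha>'_def)
    hence v\<beta>: "v \<beta> = ereal s" using x va by (simp add: v_mult s_def one_ereal_def)
    have s1: "s < 1 + \<alpha>" using False by (simp add: s_def)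
    \<comment> \<open>The coarse relation involves a^2 - 2 r instead of \<beta>. The difference 2 r
      (r - 1) is divisible by 4, and s < 1 + \<alpha> < 2, so the valuation stays the same.\<close>
    have "even (r * (r - 1))" by (cases "even r") simp_all
    hence "2 * of_nat (r * (r - 1)) \<in> vge (1 + 1)" by (intro vge_mult vge_2 vge_even)
    moreover have "of_nat (r - 1) = (of_nat r - 1 :: qbar2)" using r2 by (simp add: of_nat_diff)
    ultimately have "2 * (of_nat r * (of_nat r - 1)) \<in> vgt s"
      using s1 \<alpha>_less by (intro vgt_if_vge[of _ 2]) (simp_all only: of_nat_mult one_add_one)
    from v_add_eq[OF v\<beta> this] have "v (a * a - 2 * of_nat r) = ereal s"
      by (simp add: \<beta>_def algebra_simps)
    \<comment> \<open>For \<alpha> < 1/2 the term a^2 dominates 2 r^2 and s = 2 \<alpha>; otherwise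
      s < 1 + \<alpha> \<le> 3 \<alpha>.\<close>
    moreover have "s < 3 * \<alpha>"
    proof (cases "\<alpha> < 1 / 2")
      case True
      have "- (2 * of_nat r * of_nat r) \<in> vge (1 + 0 + 0)"
        unfolding vge_uminus by (intro vge_mult vge_2 vge_of_nat)
      hence "- (2 * of_nat r * of_nat r) \<in> vgt (2 * \<alpha>)" by (rule vgt_if_vge) (use True in simp)
      hence "v (a * a + - (2 * of_nat r * of_nat r)) = ereal (2 * \<alpha>)"
        by (intro v_add_eq) (simp add: v_mult va)
      thus ?thesis using v\<beta> \<alpha>_pos by (simp add: \<beta>_def)
    qed (use s1 in linarith)
    ultimately show ?thesis using tau_small[OF g s1] s1 \<alpha>_less by simp
  qed
qed

end

subsection \<open>Reduction modulo the maximal ideal\<close>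

context slope01
begin

abbreviation br :: "mat_q2 \<Rightarrow> 'f poly poly \<Rightarrow> mat_q2 \<Rightarrow> 'f poly poly" where
  "br \<equiv> brk (z2_res red)"

definition mid :: "'f poly poly \<Rightarrow> 'f" where
  "mid w = (\<Sum>j = 1..r - 1. coeff_XY w (r - j) j)"

lemma mid_linear: "mid 0 = 0" "mid (p + q) = mid p + mid q" "mid (p - q) = mid p - mid q"
  "mid (- p) = - mid p" "mid (CC c * p) = c * mid p"
  by (simp_all add: mid_def sum.distrib sum_subtractf sum_negf sum_distrib_left)

lemma q_map_eq: "q_map r F = (\<lambda>x. CC (mid (F x)))"
  by (simp add: q_map_def mid_def)

lemma q_map_linear: "q_map r (0 :: mat_q2 \<Rightarrow> 'f poly poly) = 0" "q_map r (F + F') = q_map r F + q_map r F'"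
  "q_map r (F - F') = q_map r F - q_map r F'" "q_map r (scal c F) = scal c (q_map r F)"
  "q_map r (trans g F) = trans g (q_map r F)"
  for F F' :: "mat_q2 \<Rightarrow> 'f poly poly"
  by (auto simp: q_map_eq mid_linear fun_eq_iff scal_def trans_def)

definition point_sum :: "'f poly poly \<Rightarrow> 'f poly poly" where
  "point_sum w = subst_XY w 1 1 + subst_XY w 1 0 + subst_XY w 0 1"

lemma poly2_add_self: "p + p = (0 :: 'f poly poly)"
proof -
  have "CC (1 + 1 :: 'f) = 0" using residue_add_self by simp
  hence "(1 + 1) * p = 0" by (simp only: CC_hom mult_zero_left)
  thus ?thesis by (simp only: distrib_right mult_1_left)
qed

text \<open>The map from Sym^r to the trivial representation sums the values at the three nonzero vectors
  over the field with two elements; this makes it invariant.\<close>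

lemma mid_point_sum:
  assumes "w \<in> sym_pow r"
  shows "CC (mid w) = point_sum w"
  using assms
proof (induction rule: sym_pow_induct)
  case (monom c j)
  have m: "mid (XX ^ (r - j) * YY ^ j) = (if 1 \<le> j \<and> j < r then 1 else 0)"
  proof -
    have "mid (XX ^ (r - j) * YY ^ j) = (\<Sum>i = 1..r - 1. if i = j then 1 else 0)"
      unfolding mid_def using monom by (intro sum.cong) (auto simp: coeff_XY_monom)
    also have "\<dots> = (if 1 \<le> j \<and> j < r then 1 else 0)" using r2 by auto
    finally show ?thesis .
  qed
  have "point_sum (XX ^ (r - j) * YY ^ j) = (if 1 \<le> j \<and> j < r then 1 else 0)"
    using monom r2 poly2_add_self[of 1]
    by (auto simp: point_sum_def subst_XY_monom power_0_left)
  hence "point_sum (XX ^ (r - j) * YY ^ j) = CC (mid (XX ^ (r - j) * YY ^ j))"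
    unfolding m by simp
  thus ?case by (simp add: mid_linear point_sum_def subst_XY_scale ring_distribs[symmetric])
next
  case (add f g)
  thus ?case by (simp add: mid_linear point_sum_def subst_XY_add algebra_simps)
qed

lemma z2_res_parity: "z2_res red z = (if 2 dvd z then 0 else 1)"
proof (cases "2 dvd z")
  case True
  then obtain y where "z = 2 * y" by auto
  thus ?thesis by simp
next
  case False
  then obtain y where "z - 1 = 2 * y" using z2_odd_iff by (auto elim!: dvdE)
  hence "z = 2 * y + 1" by (simp add: algebra_simps)
  hence "z2_res red z = 1" by simp
  thus ?thesis using False by simp
qed

text \<open>Modulo 2 the matrix is invertible over the field with two elements and permutes its
  three nonzero vectors. The case distinction runs over the parities of the four entries.\<close>

lemma point_sum_rh:
  assumes "det M dvd 1"
  shows "point_sum (rs.rh M w) = point_sum w"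
proof -
  have d: "\<not> 2 dvd M$1$1 * M$2$2 - M$1$2 * M$2$1"
    using assms by (simp add: z2_unit_iff det_2)
  have 11: "1 + 1 = (0 :: 'f poly poly)" by (rule poly2_add_self)
  have e: "subst_XY (rs.rh M w) P Q = subst_XY w
     (CC (z2_res red (M$1$1)) * P + CC (z2_res red (M$2$1)) * Q)
     (CC (z2_res red (M$1$2)) * P + CC (z2_res red (M$2$2)) * Q)" for P Q
    unfolding rs.rh_def rho_def subst_XY_comp by (simp add: subst_XY_add subst_XY_scale)
  show ?thesis
    using d unfolding z2_even_simps point_sum_def e z2_res_parity
    by (cases "2 dvd M$1$1"; cases "2 dvd M$1$2"; cases "2 dvd M$2$1"; cases "2 dvd M$2$2")
      (simp_all add: 11 del: one_add_one)
qed

lemma mid_act: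
  assumes "w \<in> sym_pow r" "h \<in> KZ"
  shows "mid (act (z2_res red) h w) = mid w"
proof -
  obtain n M where M: "det M dvd 1" "h = pmat n M" using assms(2) by (auto simp: KZ_iff)
  have "CC (mid (rs.rh M w)) = CC (mid w)"
    using assms(1) point_sum_rh[OF M(1)] by (simp add: mid_point_sum rs.rh_sym_pow)
  hence "coeff_XY (CC (mid (rs.rh M w))) 0 0 = coeff_XY (CC (mid w)) 0 0" by simp
  hence "mid (rs.rh M w) = mid w" by (simp add: coeff_XY_CC)
  thus ?thesis by (simp add: M(2) rs.act_pmat[OF M(1)])
qed

lemma q_map_br:
  assumes "w \<in> sym_pow r"
  shows "q_map r (br g w) = br g (CC (mid w))"
  unfolding q_map_eq using assms by (auto simp: brk_def fun_eq_iff mid_act mid_linear)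

section \<open>Reduction of functions in the lattice\<close>

abbreviation rf :: "ind_qbar2 \<Rightarrow> mat_q2 \<Rightarrow> 'f poly poly" where "rf \<equiv> red_fun red"

lemma rf_eq: "rf f = (\<lambda>x. map2 red (f x))"
  by (simp add: red_fun_def map2_def)

lemma L_coeffs: "f \<in> L \<Longrightarrow> coeffs_in (zbar2 v) (f x)"
  by (cases "x \<in> GL2_q2") (auto simp: lattice_ind_def cind_def W_iff zb.coeffs_in_0)

lemma rf_0: "rf 0 = 0"
  by (simp add: rf_eq fun_eq_iff)

lemma rf_add: "f \<in> L \<Longrightarrow> f' \<in> L \<Longrightarrow> rf (f + f') = rf f + rf f'"
  by (simp add: rf_eq fun_eq_iff rd.map2_add L_coeffs)

lemma rf_diff: "f \<in> L \<Longrightarrow> f' \<in> L \<Longrightarrow> rf (f - f') = rf f - rf f'"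
  by (simp add: rf_eq fun_eq_iff rd.map2_diff L_coeffs)

lemma rf_scal: "x \<in> zbar2 v \<Longrightarrow> f \<in> L \<Longrightarrow> rf (scal x f) = scal (red x) (rf f)"
  by (simp add: rf_eq fun_eq_iff scal_def rd.map2_mult L_coeffs zb.coeffs_in_CC)

lemma rf_trans: "rf (trans g f) = trans g (rf f)"
  by (simp add: rf_eq trans_def)

lemma map2_rh:
  assumes "coeffs_in (zbar2 v) w"
  shows "map2 red (qb.rh M w) = rs.rh M (map2 red w)"
proof -
  have c: "coeffs_in (zbar2 v) (CC (z2_qbar2 x) * XX + CC (z2_qbar2 y) * YY)" for x y
    by (intro zb.coeffs_in_add zb.coeffs_in_mult zb.coeffs_in_CC zb.coeffs_in_XX zb.coeffs_in_YY z2_zbar2)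
  have m: "map2 red (CC (z2_qbar2 x) * XX + CC (z2_qbar2 y) * YY) =
      CC (z2_res red x) * XX + CC (z2_res red y) * YY" for x y
    by (simp add: rd.map2_add rd.map2_mult zb.coeffs_in_mult zb.coeffs_in_CC zb.coeffs_in_XX zb.coeffs_in_YY
        z2_zbar2 z2_res_def)
  show ?thesis
    unfolding qb.rh_def rs.rh_def rho_def nth_map_matrix by (simp only: rd.map2_subst[OF assms c c] m)
qed

lemma map2_act: "coeffs_in (zbar2 v) w \<Longrightarrow> map2 red (act z2_qbar2 h w) = act (z2_res red) h (map2 red w)"
  by (simp add: qb.act_eq_rh rs.act_eq_rh map2_rh)

lemma rf_b: "w \<in> W \<Longrightarrow> rf (b g w) = br g (map2 red w)"
  by (auto simp: rf_eq brk_def fun_eq_iff W_iff map2_act)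

lemma q_rf_b: "w \<in> W \<Longrightarrow> q_map r (rf (b g w)) = br g (CC (mid (map2 red w)))"
  by (simp add: rf_b q_map_br rd.map2_sym_pow W_iff)

lemma mid_mon:
  assumes "1 \<le> j" "j < r"
  shows "mid (map2 red (mon j)) = 1"
proof -
  have "mid (map2 red (mon j)) = (\<Sum>i = 1..r - 1. if i = j then 1 else 0)"
    unfolding mid_def mon_def rd.map2_monom using assms by (intro sum.cong) (auto simp: coeff_XY_monom)
  thus ?thesis using assms by simp
qed

lemma q_rf_b_mon: "1 \<le> j \<Longrightarrow> j < r \<Longrightarrow> q_map r (rf (b g (mon j))) = br g 1"
  using q_rf_b[of "mon j" g] mid_mon[of j] mon_W[of j] by simp

subsection \<open>The kernel of the reduction map\<close>

definition W0 :: "qbar2 poly poly set" where "W0 = {w \<in> W. mid (map2 red w) = 0}"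

sublocale ker: z2_submodule z2_qbar2 W0
proof unfold_locales
  fix w and M :: "z2 ^ 2 ^ 2" assume w: "w \<in> W0" and M: "det M dvd 1"
  have "mid (rs.rh M (map2 red w)) = mid (map2 red w)"
    using mid_act[of "map2 red w" "pmat 0 M"] w KZ_pmat[OF M] rs.act_pmat[OF M]
    by (simp add: W0_def W_iff rd.map2_sym_pow)
  thus "qb.rh M w \<in> W0" using w M lat.W_rh by (simp add: W0_def map2_rh W_iff)
qed (auto simp: W0_def W_iff lat.W_0 lat.W_add lat.W_uminus rd.map2_add rd.map2_uminus mid_linear
      sym_pow_add sym_pow_uminus zb.coeffs_in_0 zb.coeffs_in_add zb.coeffs_in_uminus)

lemma b_W0_small:
  assumes "g \<in> GL2_q2" "w \<in> W0"
  shows "b g w \<in> Zset (vgt 0)"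
proof (rule mid_sum_small[OF assms(1)])
  show w: "w \<in> W" using assms(2) by (simp add: W0_def)
  hence c: "coeff_XY w i j \<in> zbar2 v" for i j by (simp add: W_iff coeffs_in_def)
  have "red (\<Sum>j = 1..r - 1. coeff_XY w (r - j) j) = mid (map2 red w)"
    by (simp add: mid_def rd.h_sum c)
  thus "(\<Sum>j = 1..r - 1. coeff_XY w (r - j) j) \<in> max_ideal v"
    using assms(2) red_eq_0_iff zb.sum_in[of "{1..r - 1}"] c by (simp add: W0_def)
qed

text \<open>A lattice function killed by q after reduction takes all its values in
  \<open>W0\<close>, so it lies in the induction of \<open>W0\<close>. The induction over brackets
  for that module reduces the claim to \<open>b_W0_small\<close>.\<close>

theorem ker_q_small:
  assumes "f \<in> L" "q_map r (rf f) = 0"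
  shows "f \<in> Zset (vgt 0)"
proof -
  have "mid (map2 red (f g)) = 0" for g
  proof -
    have "coeff_XY (q_map r (rf f) g) 0 0 = 0" by (simp add: assms(2))
    thus ?thesis by (simp add: q_map_eq rf_eq coeff_XY_CC)
  qed
  hence "f \<in> cind z2_qbar2 W0"
    using assms(1) unfolding lattice_ind_def cind_def W0_def by auto
  thus ?thesis
  proof (induction rule: ker.cind_induct)
    case zero
    show ?case by (rule Zset_0) simp
  next
    case (brk g w)
    thus ?case by (rule b_W0_small)
  next
    case (add f f')
    thus ?case by (intro Zset_add) auto
  qed
qed

lemma rf_surj:
  assumes "F \<in> ind_V red r"
  shows "\<exists>f\<in>L. rf f = F"
  using assms unfolding ind_V_def
proof (induction rule: rss.cind_induct)
  case zero
  show ?case using L_0 rf_0 by blast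
next
  case (brk g w)
  obtain lift where lift: "\<And>y. lift y \<in> zbar2 v" "\<And>y. red (lift y) = y" using red_surj by metis
  \<comment> \<open>The coefficients are lifted one by one along the monomials, which keeps the lift
    homogeneous and integral.\<close>
  define w' where "w' = (\<Sum>j\<le>r. CC (lift (coeff_XY w (r - j) j)) * mon j)"
  have w': "w' \<in> W" unfolding w'_def by (intro W_sum W_scale lift mon_W) simp
  have cM: "coeffs_in (zbar2 v) (mon j)" for j
    unfolding mon_def by (rule zb.coeffs_in_monom)
  have cW: "coeffs_in (zbar2 v) (CC (lift y) * mon j)" for y j
    by (intro zb.coeffs_in_mult zb.coeffs_in_CC lift cM)
  have "map2 red w' = (\<Sum>j\<le>r. CC (coeff_XY w (r - j) j) * (XX ^ (r - j) * YY ^ j))"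
    unfolding w'_def by (subst rd.map2_sum[OF cW])
      (intro sum.cong refl; simp add: rd.map2_mult zb.coeffs_in_CC lift cM; simp add: mon_def)
  also have "\<dots> = w" using sym_pow_expand[OF brk(2)] by simp
  finally show ?case using rf_b[OF w', of g] L_brk[OF brk(1) w'] by auto
next
  case (add F F')
  thus ?case using L_add rf_add by metis
qed

lemma q_rf_surj:
  assumes "F \<in> ind_V red 0"
  shows "\<exists>f\<in>L. q_map r (rf f) = F"
  using assms unfolding ind_V_def
proof (induction rule: rss.cind_induct)
  case zero
  show ?case using L_0 by (intro bexI[of _ 0]) (simp_all only: rf_0 q_map_linear)
next
  case (brk g w)
  have w: "w = CC (coeff_XY w 0 0)" using brk(2) by (simp only: sym_pow_0_iff)
  obtain c where c: "c \<in> zbar2 v" "red c = coeff_XY w 0 0" using red_surj by blast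
  have m: "mon 1 \<in> W" "1 < r" using r2 by (auto intro: mon_W)
  have "q_map r (rf (scal c (b g (mon 1)))) = scal (red c) (br g 1)"
    using m by (simp only: rf_scal[OF c(1) L_brk[OF brk(1) m(1)]] q_map_linear q_rf_b_mon order.refl)
  also have "\<dots> = br g w" unfolding rs.brk_scal[symmetric] c(2) mult_1_right w[symmetric] ..
  finally show ?case using L_scal[OF c(1) L_brk[OF brk(1) m(1)]] by blast
next
  case (add F F')
  then obtain f f' where "f \<in> L" "q_map r (rf f) = F" "f' \<in> L" "q_map r (rf f') = F'" by blast
  thus ?case using L_add by (intro bexI[of _ "f + f'"]) (simp_all only: rf_add q_map_linear)
qed

end

subsection \<open>The quotient\<close>

definition additive_set :: "'a :: ab_group_add set \<Rightarrow> bool" where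
  "additive_set N \<longleftrightarrow> 0 \<in> N \<and> (\<forall>x\<in>N. \<forall>y\<in>N. x + y \<in> N) \<and> (\<forall>x\<in>N. - x \<in> N)"

lemma additive_set_diff: "additive_set N \<Longrightarrow> x \<in> N \<Longrightarrow> y \<in> N \<Longrightarrow> x - y \<in> N"
  unfolding additive_set_def by (metis add_uminus_conv_diff)

lemma coset_self: "additive_set N \<Longrightarrow> x \<in> x +o N"
  by (auto simp: additive_set_def elt_set_plus_def)

lemma additive_set_plus: "additive_set N \<Longrightarrow> N + N = N"
  by (auto simp: additive_set_def set_plus_def) (metis add_0)

lemma coset_plus: "additive_set N \<Longrightarrow> (x +o N) + (y +o N) = (x + y) +o N"
  by (simp only: set_plus_rearrange additive_set_plus)

lemma mem_coset_iff: "y \<in> x +o N \<longleftrightarrow> y - x \<in> (N :: 'a :: ab_group_add set)"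
proof
  assume "y \<in> x +o N"
  thus "y - x \<in> N" by (auto simp: elt_set_plus_def)
next
  assume "y - x \<in> N"
  hence "x + (y - x) \<in> x +o N" by (rule set_plus_intro2)
  thus "y \<in> x +o N" by simp
qed

lemma coset_eq:
  assumes N: "additive_set N" and "x - y \<in> N"
  shows "x +o N = y +o N"
proof -
  have "z - x \<in> N \<longleftrightarrow> z - y \<in> N" for z
  proof
    assume "z - x \<in> N"
    hence "(z - x) + (x - y) \<in> N" using assms unfolding additive_set_def by blast
    thus "z - y \<in> N" by simp
  next
    assume "z - y \<in> N"
    from additive_set_diff[OF N this assms(2)] show "z - x \<in> N" by simp
  qed
  thus ?thesis by (intro Set.set_eqI) (simp only: mem_coset_iff)
qed

lemma image_coset:
  fixes s :: "'c :: plus \<Rightarrow> 'd :: plus"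
  assumes "\<And>x y. s (x + y) = s x + s y"
  shows "s ` (x +o N) = s x +o s ` N"
proof -
  have coset: "y +o M = (+) y ` M" for y :: 'c and M by (auto simp: elt_set_plus_def)
  have coset': "y +o M = (+) y ` M" for y :: 'd and M by (auto simp: elt_set_plus_def)
  show ?thesis unfolding coset coset' image_image assms ..
qed

text \<open>Needed for scalars whose image of \<open>N\<close> is smaller than \<open>N\<close>,
  such as multiplication by 0: adding \<open>N\<close> restores a full coset.\<close>

lemma coset_plus_subset:
  assumes "additive_set N" "M \<subseteq> N" "0 \<in> M"
  shows "(x +o M) + N = x +o N"
proof -
  have "M + N = N"
  proof
    show "M + N \<subseteq> N" using assms(1,2) by (auto simp: additive_set_def set_plus_def)
    show "N \<subseteq> M + N"
    proof
      fix n assume "n \<in> N"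
      with assms(3) have "0 + n \<in> M + N" by (rule set_plus_intro)
      thus "n \<in> M + N" by simp
    qed
  qed
  thus ?thesis by (simp only: set_plus_rearrange3)
qed

text \<open>Stability under the inverse of g supplies the reverse inclusion.\<close>

lemma trans_image:
  assumes g: "g \<in> GL2_q2" and N: "\<And>g x. g \<in> GL2_q2 \<Longrightarrow> x \<in> N \<Longrightarrow> trans g x \<in> N"
  shows "trans g ` N = N"
proof
  show "trans g ` N \<subseteq> N" using g N by blast
  obtain g' where g': "g' \<in> GL2_q2" "g ** g' = mat 1" "g' ** g = mat 1" using GL2_inverse[OF g] by blast
  have "trans g (trans g' x) = x" for x :: "mat_q2 \<Rightarrow> 'a"
    by (simp add: trans_def matrix_mul_assoc[symmetric] g')
  thus "N \<subseteq> trans g ` N" using N[OF g'(1)] by (metis imageI subsetI)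
qed

context slope01
begin

section \<open>The relations and the classes in \<open>Theta_bar\<close>\<close>

abbreviation R :: "ind_qbar2 set" where "R \<equiv> rel_sub r a"

lemma R_eq: "R = (\<lambda>h. qb.hk h - scal a h) ` cind z2_qbar2 (sym_pow r)"
  unfolding rel_sub_def by (intro image_cong refl) (simp add: qb.hecke_eq_hk)

lemma R_add: "x \<in> R \<Longrightarrow> y \<in> R \<Longrightarrow> x + y \<in> R"
proof -
  assume "x \<in> R" "y \<in> R"
  then obtain h k where "h \<in> cind z2_qbar2 (sym_pow r)" "k \<in> cind z2_qbar2 (sym_pow r)"
    "x = qb.hk h - scal a h" "y = qb.hk k - scal a k" unfolding R_eq by blast
  hence "h + k \<in> cind z2_qbar2 (sym_pow r)" "x + y = qb.hk (h + k) - scal a (h + k)"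
    by (simp_all only: qbs.cind_add qb.hk_add scal_simps) (simp_all only: algebra_simps)
  thus "x + y \<in> R" unfolding R_eq by blast
qed

lemma R_scal: "x \<in> R \<Longrightarrow> scal c x \<in> R"
proof -
  assume "x \<in> R"
  then obtain h where "h \<in> cind z2_qbar2 (sym_pow r)" "x = qb.hk h - scal a h" unfolding R_eq by blast
  hence "scal c h \<in> cind z2_qbar2 (sym_pow r)" "scal c x = qb.hk (scal c h) - scal a (scal c h)"
    by (simp_all only: qb.scal_cind qb.hk_scal scal_simps mult.commute)
  thus "scal c x \<in> R" unfolding R_eq by blast
qed

lemma R_trans: "g \<in> GL2_q2 \<Longrightarrow> x \<in> R \<Longrightarrow> trans g x \<in> R"
proof -
  assume g: "g \<in> GL2_q2" and "x \<in> R"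
  then obtain h where "h \<in> cind z2_qbar2 (sym_pow r)" "x = qb.hk h - scal a h" unfolding R_eq by blast
  hence "trans g h \<in> cind z2_qbar2 (sym_pow r)" "trans g x = qb.hk (trans g h) - scal a (trans g h)"
    by (simp_all only: qbs.cind_trans[OF _ g] qb.hk_trans trans_simps)
  thus "trans g x \<in> R" unfolding R_eq by blast
qed

lemma R_additive: "additive_set R"
proof -
  have "0 \<in> R" unfolding R_eq using qbs.cind_0 by (rule image_eqI[rotated]) (simp only: qb.hk_0 scal_simps diff_zero)
  moreover have "- x \<in> R" if "x \<in> R" for x
    using R_scal[OF that, of "- 1"] by (simp only: scal_simps)
  ultimately show ?thesis unfolding additive_set_def using R_add by blast
qed

text \<open>The maximal ideal times the lattice. Single products already form a group, because among
  finitely many scalars one of least valuation divides the others.\<close>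

definition mL :: "ind_qbar2 set" where "mL = {scal d l | d l. d \<in> max_ideal v \<and> l \<in> L}"

lemma mL_I: "d \<in> max_ideal v \<Longrightarrow> l \<in> L \<Longrightarrow> scal d l \<in> mL"
  unfolding mL_def by blast

lemma mL_add:
  assumes "x \<in> mL" "y \<in> mL"
  shows "x + y \<in> mL"
proof -
  have *: "scal d l + scal d' l' \<in> mL" if "d \<in> max_ideal v" "l \<in> L" "l' \<in> L" and le: "v d \<le> v d'" for d d' l l'
  proof -
    obtain c where c: "c \<in> zbar2 v" "d' = d * c"
    proof (cases "d = 0")
      case True
      hence "d' = 0" using le v_eq_inf_iff[of d'] by simp
      thus ?thesis using that[of 0] True zb.zero by simp
    next
      case False
      then obtain s where s: "v d = ereal s" using v_finite by blast
      have "d' \<in> vge s" using le s by (simp add: vge_def)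
      from vge_divide[OF this s] show ?thesis using that[of "d' / d"] False by (simp add: zbar2_eq)
    qed
    have "scal d l + scal d' l' = scal d (l + scal c l')" by (simp only: c scal_simps)
    thus ?thesis using that c mL_I L_add L_scal by metis
  qed
  obtain d l d' l' where "d \<in> max_ideal v" "l \<in> L" "d' \<in> max_ideal v" "l' \<in> L" "x = scal d l" "y = scal d' l'"
    using assms unfolding mL_def by blast
  thus ?thesis using *[of d l l' d'] *[of d' l' l d] by (cases "v d \<le> v d'") (auto simp: add.commute)
qed

lemma mL_0: "0 \<in> mL"
  using mL_I[OF _ L_0, of 0] by (simp add: max_ideal_def scal_simps)

lemma mL_scal: "c \<in> zbar2 v \<Longrightarrow> x \<in> mL \<Longrightarrow> scal c x \<in> mL"
proof -
  assume c: "c \<in> zbar2 v" and "x \<in> mL"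
  then obtain d l where dl: "d \<in> max_ideal v" "l \<in> L" "x = scal d l" unfolding mL_def by blast
  have "d * c \<in> max_ideal v" using vgt_mult[of d 0 c 0] dl c by (simp add: max_ideal_eq zbar2_eq)
  moreover have "scal c x = scal (d * c) l" unfolding dl(3) scal_simps by (simp only: mult.commute)
  ultimately show "scal c x \<in> mL" using mL_I dl(2) by metis
qed

lemma mL_trans: "g \<in> GL2_q2 \<Longrightarrow> x \<in> mL \<Longrightarrow> trans g x \<in> mL"
proof -
  assume g: "g \<in> GL2_q2" and "x \<in> mL"
  then obtain d l where dl: "d \<in> max_ideal v" "l \<in> L" "x = scal d l" unfolding mL_def by blast
  hence "trans g x = scal d (trans g l)" by (simp only: trans_simps)
  thus "trans g x \<in> mL" using mL_I dl L_trans g by metis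
qed

lemma max_ideal_Theta_eq: "max_ideal_Theta v r a = (\<lambda>m. m +o R) ` mL"
proof
  show "max_ideal_Theta v r a \<subseteq> (\<lambda>m. m +o R) ` mL"
  proof
    fix u assume "u \<in> max_ideal_Theta v r a"
    then obtain n :: nat and x f where n: "\<And>i. i < n \<Longrightarrow> x i \<in> max_ideal v \<and> f i \<in> L"
      "u = (\<Sum>i<n. scal (x i) (f i)) +o R"
      unfolding max_ideal_Theta_def by blast
    have "(\<Sum>i<m. scal (x i) (f i)) \<in> mL" if "m \<le> n" for m
      using that
    proof (induction m)
      case (Suc m)
      have "scal (x m) (f m) \<in> mL" using n(1)[of m] Suc.prems mL_I by auto
      thus ?case unfolding sum.lessThan_Suc using Suc by (intro mL_add) auto
    qed (simp only: lessThan_0 sum.empty mL_0)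
    thus "u \<in> (\<lambda>m. m +o R) ` mL" using n(2) by blast
  qed
  show "(\<lambda>m. m +o R) ` mL \<subseteq> max_ideal_Theta v r a"
  proof
    fix u assume "u \<in> (\<lambda>m. m +o R) ` mL"
    then obtain d l where "d \<in> max_ideal v" "l \<in> L" "u = scal d l +o R" unfolding mL_def by blast
    moreover have "(\<Sum>i<Suc 0. scal d l) = scal d l" by (simp only: sum.lessThan_Suc lessThan_0 sum.empty add_0)
    ultimately show "u \<in> max_ideal_Theta v r a"
      unfolding max_ideal_Theta_def by (intro CollectI exI[of _ "Suc 0"] exI[of _ "\<lambda>_. d"] exI[of _ "\<lambda>_. l"]) simp
  qed
qed

abbreviation cl :: "ind_qbar2 \<Rightarrow> ind_qbar2 set set" where "cl \<equiv> Theta_bar_class v r a"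

lemma cl_eq: "cl f = (\<lambda>m. (f + m) +o R) ` mL"
proof -
  have "cl f = (\<lambda>u. (f +o R) + u) ` (\<lambda>m. m +o R) ` mL"
    unfolding Theta_bar_class_def max_ideal_Theta_eq elt_set_plus_def[of "f +o R"] by auto
  also have "\<dots> = (\<lambda>m. (f + m) +o R) ` mL"
    unfolding image_image by (intro image_cong refl) (simp only: coset_plus[OF R_additive])
  finally show ?thesis .
qed

text \<open>\<open>Zset (vgt 0)\<close> is \<open>R + mL\<close>: the first part vanishes in Pi and
  the second in the quotient of Theta by the maximal ideal. This is how all earlier estimates
  enter.\<close>

lemma cl_cong:
  assumes "f - f' \<in> Zset (vgt 0)"
  shows "cl f = cl f'"
proof -
  have *: "cl f \<subseteq> cl f'" if fZ: "f - f' \<in> Zset (vgt 0)" for f f'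
  proof
    obtain h d l where h: "h \<in> cind z2_qbar2 (sym_pow r)" "d \<in> vgt 0" "l \<in> L"
      "f - f' = qb.hk h - scal a h + scal d l"
      using fZ by (rule ZsetE)
    fix u assume "u \<in> cl f"
    then obtain m where m: "m \<in> mL" "u = (f + m) +o R" unfolding cl_eq by blast
    have dl: "scal d l + m \<in> mL" using h m by (intro mL_add mL_I) (simp_all add: max_ideal_eq)
    have "(f + m) - (f' + (scal d l + m)) = qb.hk h - scal a h"
      using h(4) by (simp add: algebra_simps)
    also have "\<dots> \<in> R" unfolding R_eq using h(1) by (rule imageI)
    finally have "u = (f' + (scal d l + m)) +o R" unfolding m(2) by (intro coset_eq R_additive)
    thus "u \<in> cl f'" unfolding cl_eq using dl by blast
  qed
  have "f' - f \<in> Zset (vgt 0)" using Zset_uminus[OF vcone_vgt assms] by simp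
  thus ?thesis using * assms by blast
qed

lemma cl_add: "cl f + cl f' = cl (f + f')"
proof -
  have e: "((f + m) +o R) + ((f' + m') +o R) = (f + f' + (m + m')) +o R" for m m'
    unfolding coset_plus[OF R_additive] by (simp only: add_ac)
  show ?thesis
  proof (intro Set.set_eqI iffI)
    fix u assume "u \<in> cl f + cl f'"
    then obtain x y where xy: "x \<in> cl f" "y \<in> cl f'" "u = x + y" by (elim set_plus_elim)
    obtain m where m: "m \<in> mL" "x = (f + m) +o R" using xy(1) unfolding cl_eq by blast
    obtain m' where m': "m' \<in> mL" "y = (f' + m') +o R" using xy(2) unfolding cl_eq by blast
    have "u = (f + f' + (m + m')) +o R" by (simp only: xy m m' e)
    thus "u \<in> cl (f + f')" unfolding cl_eq by (rule image_eqI[OF _ mL_add[OF m(1) m'(1)]])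
  next
    fix u assume "u \<in> cl (f + f')"
    then obtain m where m: "m \<in> mL" "u = (f + f' + m) +o R" unfolding cl_eq by blast
    have "u = ((f + m) +o R) + ((f' + 0) +o R)"
      unfolding m(2) using e[of m 0] by (simp only: add_0_right)
    moreover have "(f + m) +o R \<in> cl f" "(f' + 0) +o R \<in> cl f'"
      unfolding cl_eq by (intro imageI m(1) mL_0)+
    ultimately show "u \<in> cl f + cl f'" by (simp only: set_plus_intro)
  qed
qed

lemma quot_op_coset:
  assumes N: "additive_set N" and s: "\<And>x y. s (x + y) = s x + s y" and sN: "\<And>x. x \<in> N \<Longrightarrow> s x \<in> N"
    and s0: "s 0 = 0"
  shows "quot_op N s (x +o N) = s x +o N"
  unfolding quot_op_def image_coset[OF s]
proof (rule coset_plus_subset[OF N])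
  have "0 \<in> N" using N by (simp add: additive_set_def)
  thus "0 \<in> s ` N" using s0 by (metis imageI)
qed (use sN in blast)

lemma cl_scal:
  assumes "x \<in> zbar2 v"
  shows "Theta_bar_scal v r a x (cl f) = cl (scal x f)"
proof -
  have q: "quot_op R (scal x) (h +o R) = scal x h +o R" for h
    by (rule quot_op_coset[OF R_additive]) (simp_all add: scal_simps R_scal)
  have "Theta_bar_scal v r a x (cl f) = (\<lambda>m. scal x (f + m) +o R) ` mL + (\<lambda>m. m +o R) ` mL"
    unfolding Theta_bar_scal_def quot_op_def[of "max_ideal_Theta v r a"]
    unfolding max_ideal_Theta_eq cl_eq image_image q ..
  also have "\<dots> = cl (scal x f)"
  proof (intro Set.set_eqI iffI)
    fix u assume "u \<in> (\<lambda>m. scal x (f + m) +o R) ` mL + (\<lambda>m. m +o R) ` mL"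
    then obtain m m' where m: "m \<in> mL" "m' \<in> mL" "u = (scal x (f + m) +o R) + (m' +o R)"
      by (elim set_plus_elim) blast
    hence "u = (scal x f + (scal x m + m')) +o R"
      by (simp only: coset_plus[OF R_additive] scal_simps add.assoc)
    thus "u \<in> cl (scal x f)" unfolding cl_eq
      by (rule image_eqI[OF _ mL_add[OF mL_scal[OF assms m(1)] m(2)]])
  next
    fix u assume "u \<in> cl (scal x f)"
    then obtain m where m: "m \<in> mL" "u = (scal x f + m) +o R" unfolding cl_eq by blast
    have "u = (scal x (f + 0) +o R) + (m +o R)" by (simp only: m(2) coset_plus[OF R_additive] add_0_right)
    moreover have "scal x (f + 0) +o R \<in> (\<lambda>m. scal x (f + m) +o R) ` mL" by (rule imageI[OF mL_0])
    moreover have "m +o R \<in> (\<lambda>m. m +o R) ` mL" by (rule imageI[OF m(1)])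
    ultimately show "u \<in> (\<lambda>m. scal x (f + m) +o R) ` mL + (\<lambda>m. m +o R) ` mL"
      by (simp only: set_plus_intro)
  qed
  finally show ?thesis .
qed

lemma cl_trans:
  assumes g: "g \<in> GL2_q2"
  shows "Theta_bar_trans g (cl f) = cl (trans g f)"
proof -
  have tR: "trans g ` R = R" by (rule trans_image[OF g]) (rule R_trans)
  have tm: "trans g ` mL = mL" by (rule trans_image[OF g]) (rule mL_trans)
  have t: "trans g ` (h +o R) = trans g h +o R" for h
    unfolding image_coset[of "trans g", OF trans_simps(1)] tR ..
  have "Theta_bar_trans g (cl f) = (\<lambda>m. (trans g f + m) +o R) ` trans g ` mL"
    unfolding Theta_bar_trans_def cl_eq image_image t by (simp only: trans_simps)
  thus ?thesis unfolding tm cl_eq .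
qed

lemma cl_Theta_bar: "f \<in> L \<Longrightarrow> cl f \<in> Theta_bar v r a"
  unfolding Theta_bar_def quot_def Theta_def Theta_bar_class_def by blast

text \<open>The description in \<open>P_map\<close> has a unique solution: two lifts of the same
  function differ by a lattice element that reduces to 0, hence is killed by q, and
  \<open>ker_q_small\<close> applies.\<close>

lemma P_map_eq:
  assumes "f \<in> L"
  shows "P_map v red r a (rf f) = cl f"
  unfolding P_map_def
proof (rule the_equality)
  show "\<exists>f'\<in>L. rf f' = rf f \<and> cl f = cl f'" using assms by blast
next
  fix \<xi> assume "\<exists>f'\<in>L. rf f' = rf f \<and> \<xi> = cl f'"
  then obtain f' where f': "f' \<in> L" "rf f' = rf f" "\<xi> = cl f'" by blast
  have "f' - f \<in> L" unfolding lattice_ind_def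
    using f'(1) assms by (intro lat.cind_diff) (simp_all only: lattice_ind_def)
  moreover have "q_map r (rf (f' - f)) = 0"
    by (simp only: rf_diff[OF f'(1) assms] f'(2) diff_self q_map_linear)
  ultimately have "f' - f \<in> Zset (vgt 0)" by (rule ker_q_small)
  thus "\<xi> = cl f" using f'(3) cl_cong by simp
qed

lemma L_diff: "f \<in> L \<Longrightarrow> f' \<in> L \<Longrightarrow> f - f' \<in> L"
  unfolding lattice_ind_def by (rule lat.cind_diff)

text \<open>Two lattice elements whose images under q agree modulo \<open>N\<close> differ by a lift
  of an element of \<open>N\<close>, chosen to vanish in \<open>Theta_bar\<close>, and by an element
  of the kernel of q, which vanishes there as well. So the class of a lift depends only on the
  coset.\<close>

theorem descent:
  assumes N: "additive_set N"
    and N_scal: "\<And>c F. F \<in> N \<Longrightarrow> scal c F \<in> N"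
    and N_trans: "\<And>g F. g \<in> GL2_q2 \<Longrightarrow> F \<in> N \<Longrightarrow> trans g F \<in> N"
    and N_lift: "\<And>F. F \<in> N \<Longrightarrow> \<exists>f\<in>L. f \<in> Zset (vgt 0) \<and> q_map r (rf f) = F"
  shows "\<exists>\<psi>. equivariant_map_to_Theta_bar v red r a N \<psi> \<and>
     (\<forall>F\<in>ind_V red r. \<psi> (q_map r F +o N) = P_map v red r a F)"
proof -
  have cong: "cl f = cl f'" if f: "f \<in> L" "f' \<in> L" "q_map r (rf f) - q_map r (rf f') \<in> N" for f f'
  proof -
    obtain k where k: "k \<in> L" "k \<in> Zset (vgt 0)" "q_map r (rf k) = q_map r (rf f) - q_map r (rf f')"
      using N_lift[OF f(3)] by blast
    have ff: "f - f' \<in> L" by (rule L_diff[OF f(1,2)])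
    have "q_map r (rf (f - f' - k)) = 0"
      by (simp only: rf_diff[OF ff k(1)] rf_diff[OF f(1,2)] q_map_linear k(3) diff_self)
    hence "f - f' - k \<in> Zset (vgt 0)" by (intro ker_q_small L_diff ff k)
    from Zset_add[OF vcone_vgt this k(2)] show ?thesis by (intro cl_cong) simp
  qed
  \<comment> \<open>The value is the class of an arbitrary lift of some member of the coset;
    \<open>cong\<close> makes it independent of the choice.\<close>
  define \<psi> where "\<psi> u = cl (SOME f. f \<in> L \<and> q_map r (rf f) \<in> u)" for u
  have \<psi>: "\<psi> (q_map r (rf f) +o N) = cl f" if f: "f \<in> L" for f
  proof -
    let ?P = "\<lambda>f'. f' \<in> L \<and> q_map r (rf f') \<in> q_map r (rf f) +o N"
    have "?P f" using f coset_self[OF N] by blast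
    hence "?P (Eps ?P)" by (rule someI[of ?P f])
    thus ?thesis unfolding \<psi>_def by (intro cong f) (simp_all only: mem_coset_iff)
  qed
  have Q: "\<exists>f\<in>L. u = q_map r (rf f) +o N" if "u \<in> quot (ind_V red 0) N" for u
    using that q_rf_surj unfolding quot_def by blast
  have "equivariant_map_to_Theta_bar v red r a N \<psi>"
    unfolding equivariant_map_to_Theta_bar_def Let_def
  proof (intro conjI ballI)
    fix u assume "u \<in> quot (ind_V red 0) N"
    then obtain f where f: "f \<in> L" "u = q_map r (rf f) +o N" using Q by blast
    show "\<psi> u \<in> Theta_bar v r a" unfolding f(2) \<psi>[OF f(1)] by (rule cl_Theta_bar[OF f(1)])
    show "\<psi> (u + u') = \<psi> u + \<psi> u'" if u': "u' \<in> quot (ind_V red 0) N" for u'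
    proof -
      obtain f' where f': "f' \<in> L" "u' = q_map r (rf f') +o N" using Q[OF u'] by blast
      have "u + u' = q_map r (rf (f + f')) +o N"
        unfolding f f' by (simp only: coset_plus[OF N] rf_add[OF f(1) f'(1)] q_map_linear)
      thus ?thesis using \<psi>[OF L_add[OF f(1) f'(1)]] \<psi>[OF f(1)] \<psi>[OF f'(1)] by (simp only: f f' cl_add)
    qed
    show "\<psi> (trans g ` u) = Theta_bar_trans g (\<psi> u)" if g: "g \<in> GL2_q2" for g
    proof -
      have tN: "trans g ` N = N" by (rule trans_image[OF g]) (rule N_trans)
      have "trans g ` u = q_map r (rf (trans g f)) +o N"
        unfolding f(2) image_coset[of "trans g", OF trans_simps(1)] tN rf_trans q_map_linear ..
      thus ?thesis using \<psi>[OF L_trans[OF f(1) g]] \<psi>[OF f(1)] by (simp only: f cl_trans[OF g])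
    qed
  next
    fix x u assume x: "x \<in> zbar2 v" and "u \<in> quot (ind_V red 0) N"
    then obtain f where f: "f \<in> L" "u = q_map r (rf f) +o N" using Q by blast
    have "quot_op N (scal (red x)) u = scal (red x) (q_map r (rf f)) +o N"
      unfolding f(2) by (rule quot_op_coset[OF N]) (simp_all only: scal_simps N_scal)
    also have "scal (red x) (q_map r (rf f)) = q_map r (rf (scal x f))"
      by (simp only: rf_scal[OF x f(1)] q_map_linear)
    finally show "\<psi> (quot_op N (scal (red x)) u) = Theta_bar_scal v r a x (\<psi> u)"
      using \<psi>[OF L_scal[OF x f(1)]] \<psi>[OF f(1)] by (simp only: f cl_scal[OF x])
  qed
  moreover have "\<psi> (q_map r F +o N) = P_map v red r a F" if "F \<in> ind_V red r" for F
    using rf_surj[OF that] \<psi> P_map_eq by blast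
  ultimately show ?thesis by blast
qed

end

subsection \<open>The two cases\<close>

context slope01
begin

text \<open>The elements [g, 1] generate the induction of V_0 under addition and scalars, so the
  lifts required by \<open>descent\<close> are needed only for them.\<close>

lemma descent_operator:
  assumes nu_add: "\<And>F F'. nu (F + F') = nu F + nu F'"
    and nu_scal: "\<And>c F. nu (scal c F) = scal c (nu F)"
    and nu_trans: "\<And>g F. nu (trans g F) = trans g (nu F)"
    and lift: "\<And>g. g \<in> GL2_q2 \<Longrightarrow> \<exists>f\<in>L. f \<in> Zset (vgt 0) \<and> q_map r (rf f) = nu (br g 1)"
  shows "\<exists>\<psi>. equivariant_map_to_Theta_bar v red r a (nu ` ind_V red 0) \<psi> \<and>
     (\<forall>F\<in>ind_V red r. \<psi> (q_map r F +o (nu ` ind_V red 0)) = P_map v red r a F)"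
proof (rule descent)
  note V_add = rss.cind_add[of _ 0, folded ind_V_def]
  note V_trans = rss.cind_trans[of _ 0, folded ind_V_def]
  note V_scal = rs.scal_cind[of _ 0, folded ind_V_def]
  have nu_0: "nu 0 = 0" using nu_scal[of 0 0] by (simp only: scal_simps)
  show N_scal: "scal c F \<in> nu ` ind_V red 0" if "F \<in> nu ` ind_V red 0" for c F
    using that nu_scal V_scal by (metis image_iff)
  show "additive_set (nu ` ind_V red 0)"
    unfolding additive_set_def
  proof (intro conjI ballI)
    have "(0 :: mat_q2 \<Rightarrow> 'f poly poly) \<in> ind_V red 0" unfolding ind_V_def by (rule rss.cind_0)
    thus "0 \<in> nu ` ind_V red 0" using nu_0 by (metis imageI)
  next
    fix x y assume "x \<in> nu ` ind_V red 0" "y \<in> nu ` ind_V red 0"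
    then obtain F F' where "F \<in> ind_V red 0" "x = nu F" "F' \<in> ind_V red 0" "y = nu F'" by blast
    thus "x + y \<in> nu ` ind_V red 0" using V_add nu_add by (metis imageI)
  next
    fix x assume "x \<in> nu ` ind_V red 0"
    from N_scal[OF this, of "- 1"] show "- x \<in> nu ` ind_V red 0" by (simp only: scal_simps)
  qed
  show "trans g F \<in> nu ` ind_V red 0" if "g \<in> GL2_q2" "F \<in> nu ` ind_V red 0" for g F
    using that nu_trans V_trans by (metis image_iff)
  have "\<exists>f\<in>L. f \<in> Zset (vgt 0) \<and> q_map r (rf f) = nu F" if "F \<in> ind_V red 0" for F
    using that unfolding ind_V_def
  proof (induction rule: rss.cind_induct)
    case zero
    show ?case using L_0 Zset_0[OF vcone_vgt] by (intro bexI[of _ 0]) (simp_all only: rf_0 q_map_linear nu_0 simp_thms)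
  next
    case (brk g w)
    have w: "w = CC (coeff_XY w 0 0) * 1" using brk(2) by (simp only: sym_pow_0_iff mult_1_right)
    obtain c where c: "c \<in> zbar2 v" "red c = coeff_XY w 0 0" using red_surj by blast
    obtain f where f: "f \<in> L" "f \<in> Zset (vgt 0)" "q_map r (rf f) = nu (br g 1)" using lift[OF brk(1)] by blast
    have "br g w = scal (red c) (br g 1)" by (subst w) (simp only: rs.brk_scal c(2))
    hence "q_map r (rf (scal c f)) = nu (br g w)"
      by (simp only: rf_scal[OF c(1) f(1)] q_map_linear f(3) nu_scal)
    moreover have "scal c f \<in> Zset (vgt 0)"
      using Zgt_scal[OF f(2), of c 0] c(1) by (simp add: zbar2_eq)
    ultimately show ?case using L_scal[OF c(1) f(1)] by blast
  next
    case (add F F')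
    obtain f where f: "f \<in> L" "f \<in> Zset (vgt 0)" "q_map r (rf f) = nu F" using add by blast
    obtain f' where f': "f' \<in> L" "f' \<in> Zset (vgt 0)" "q_map r (rf f') = nu F'" using add by blast
    have "q_map r (rf (f + f')) = nu (F + F')"
      by (simp only: rf_add[OF f(1) f'(1)] q_map_linear f f' nu_add)
    thus ?case using L_add[OF f(1) f'(1)] Zset_add[OF vcone_vgt f(2) f'(2)] by blast
  qed
  thus "\<exists>f\<in>L. f \<in> Zset (vgt 0) \<and> q_map r (rf f) = F" if "F \<in> nu ` ind_V red 0" for F
    using that by blast
qed

lemma br_KZ_1: "k \<in> KZ \<Longrightarrow> br (g ** k) 1 = br g 1"
  using rs.brk_KZ[of k g 1] rs.act_linear(6)[of k 1] by (simp only: CC_hom)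

lemma hk_br_1: "rs.hk (br g 1) = br (g ** gm 0) 1 + br (g ** gm 1) 1 + br (g ** gm 2) 1"
proof -
  have "rs.rh M 1 = 1" for M using rs.rh_linear(6)[of M 1] by (simp only: CC_hom)
  thus ?thesis unfolding rs.hk_brk by (simp add: eval_nat_numeral)
qed

lemma b_mon_L: "g \<in> GL2_q2 \<Longrightarrow> 1 \<le> j \<Longrightarrow> j < r \<Longrightarrow> b g (mon j) \<in> L"
  by (intro L_brk mon_W) auto

lemma tau_L: "g \<in> GL2_q2 \<Longrightarrow> tau g \<in> L"
  unfolding tau_def using r2 by (intro L_add b_mon_L) auto

lemma q_tau:
  assumes g: "g \<in> GL2_q2"
  shows "q_map r (rf (tau g)) = rs.hk (br g 1)"
proof -
  have j: "1 \<le> r - 1" "r - 1 < r" "1 < r" using r2 by auto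
  have "b (g ** gm 0) (mon 1) \<in> L" "b (g ** gm 1) (mon 1) \<in> L" "b (g ** gm 2) (mon (r - 1)) \<in> L"
    using g j by (simp_all only: b_mon_L GL2_mult_iff gm_GL2 order.refl simp_thms)
  thus ?thesis
    unfolding tau_def hk_br_1
    by (simp only: rf_add L_add q_map_linear q_rf_b_mon j order.refl)
qed

theorem case_tau_less:
  assumes "v ((a * a - 2 * of_nat r * of_nat r) / (2 * a)) < v (of_nat (r - 1))"
  shows "\<exists>\<psi>. equivariant_map_to_Theta_bar v red r a (rs.hk ` ind_V red 0) \<psi> \<and>
     (\<forall>F\<in>ind_V red r. \<psi> (q_map r F +o (rs.hk ` ind_V red 0)) = P_map v red r a F)"
proof (rule descent_operator)
  fix g :: mat_q2 assume "g \<in> GL2_q2"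
  thus "\<exists>f\<in>L. f \<in> Zset (vgt 0) \<and> q_map r (rf f) = rs.hk (br g 1)"
    using tau_L tau_zero[OF assms] q_tau by blast
qed (simp_all only: rs.hk_add rs.hk_scal rs.hk_trans)

lemma residue_fun_add_self: "F + F = (0 :: mat_q2 \<Rightarrow> 'f poly poly)"
  by (rule ext) (simp only: plus_fun_apply zero_fun_apply poly2_add_self)

text \<open>Of the nine paths of length two starting at g, three return to g. Together with the
  added [g, 1] they give four copies of it, which is 0 in characteristic 2; the six vertices at
  distance two remain, listed in the order of \<open>sigma\<close>.\<close>

lemma hk_hk_br_1:
  "rs.hk (rs.hk (br g 1)) + br g 1 =
     (br (g ** gm 0 ** gm 0) 1 + br (g ** gm 0 ** gm 1) 1)
   + (br (g ** gm 1 ** gm 0) 1 + br (g ** gm 1 ** gm 1) 1)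
   + (br (g ** gm 2 ** kmat 0 1 1 0 ** gm 0) 1 + br (g ** gm 2 ** kmat 0 1 1 0 ** gm 1) 1)"
proof -
  have m: "gm 0 ** gm 2 = (mat 2 :: mat_q2)" "gm 1 ** gm 2 = mat 2 ** kmat 1 1 0 1"
    "gm 2 ** gm 0 = (mat 2 :: mat_q2)"
    "kmat 0 1 1 0 ** gm 0 = gm 2 ** kmat 0 1 1 0" "kmat 0 1 1 0 ** gm 1 = gm 1 ** kmat (- 1) 0 2 1"
    by (simp_all add: gm_def kmat_def matrix_eq_iff_2)
  have K: "kmat 0 1 1 0 \<in> KZ" "kmat (- 1) 0 2 1 \<in> KZ" "mat 2 \<in> KZ" "mat 2 ** kmat 1 1 0 1 \<in> KZ"
    by (auto intro!: kmat_KZ KZ_mult rs.act_mat_2)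
  have retr: "br (g ** gm 0 ** gm 2) 1 = br g 1" "br (g ** gm 1 ** gm 2) 1 = br g 1"
    "br (g ** gm 2 ** gm 0) 1 = br g 1"
    unfolding matrix_mul_assoc[symmetric] m by (intro br_KZ_1 K)+
  have fl: "br (g ** gm 2 ** kmat 0 1 1 0 ** gm 0) 1 = br (g ** gm 2 ** gm 2) 1"
    "br (g ** gm 2 ** kmat 0 1 1 0 ** gm 1) 1 = br (g ** gm 2 ** gm 1) 1"
  proof -
    have "g ** gm 2 ** kmat 0 1 1 0 ** gm 0 = g ** gm 2 ** gm 2 ** kmat 0 1 1 0"
      "g ** gm 2 ** kmat 0 1 1 0 ** gm 1 = g ** gm 2 ** gm 1 ** kmat (- 1) 0 2 1"
      using m(4,5) by (simp_all only: matrix_mul_assoc[symmetric])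
    thus "br (g ** gm 2 ** kmat 0 1 1 0 ** gm 0) 1 = br (g ** gm 2 ** gm 2) 1"
      "br (g ** gm 2 ** kmat 0 1 1 0 ** gm 1) 1 = br (g ** gm 2 ** gm 1) 1"
      by (simp_all only: br_KZ_1 K)
  qed
  have four: "F + F + F + F = 0" for F :: "mat_q2 \<Rightarrow> 'f poly poly"
    by (simp only: residue_fun_add_self add_0_left)
  have "rs.hk (rs.hk (br g 1)) + br g 1 =
     (br (g ** gm 0 ** gm 0) 1 + br (g ** gm 0 ** gm 1) 1)
   + (br (g ** gm 1 ** gm 0) 1 + br (g ** gm 1 ** gm 1) 1)
   + (br (g ** gm 2 ** gm 2) 1 + br (g ** gm 2 ** gm 1) 1) + (br g 1 + br g 1 + br g 1 + br g 1)"
    unfolding hk_br_1 rs.hk_add retr by (simp only: add_ac)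
  thus ?thesis unfolding four fl add_0_right .
qed

text \<open>Relation \<open>tau_sigma\<close> is used at the full precision s = t + 3/2. Division by
  r - 1, of valuation t, puts \<open>sigma g\<close> - \<gamma> \<open>tau g\<close> into
  \<open>Zset (vgt 0)\<close>, and its image under q is (T^2 - c T + 1) [g, 1].\<close>

theorem case_tau_ge:
  assumes "v (of_nat (r - 1)) \<le> v ((a * a - 2 * of_nat r * of_nat r) / (2 * a))"
    and c: "c = red ((a * a - 2 * of_nat r * of_nat r) / (2 * a) / of_nat (r - 1))"
    and N: "N = (\<lambda>F. rs.hk (rs.hk F) - scal c (rs.hk F) + F) ` ind_V red 0"
  shows "\<exists>\<psi>. equivariant_map_to_Theta_bar v red r a N \<psi> \<and>
     (\<forall>F\<in>ind_V red r. \<psi> (q_map r F +o N) = P_map v red r a F)"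
  unfolding N
proof (rule descent_operator)
  define \<alpha>' where "\<alpha>' = (a * a - 2 * of_nat r * of_nat r) / (2 * a)"
  have "r - 1 > 0" using r2 by simp
  then obtain t m where t: "odd m" "r - 1 = 2 ^ t * m" "v (of_nat (r - 1)) = ereal (real t)"
    by (rule v_of_nat)
  have \<alpha>': "\<alpha>' \<in> vge (real t)" using assms(1) t(3) by (simp add: vge_def \<alpha>'_def)
  interpret h: slope_half v red r a t "real t + 3 / 2"
    by (rule slope_half_I) (use \<alpha>' t in \<open>simp_all add: \<alpha>'_def\<close>)
  define \<gamma> where "\<gamma> = \<alpha>' / of_nat h.\<epsilon>"
  have v\<epsilon>: "v (of_nat h.\<epsilon>) = ereal (real t)" using t(3) by (simp only: h.\<epsilon>_def)
  have \<gamma>: "\<gamma> \<in> zbar2 v" "red \<gamma> = c"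
    using vge_divide[OF \<alpha>' v\<epsilon>] by (simp_all add: \<gamma>_def zbar2_eq c \<alpha>'_def h.\<epsilon>_def)
  fix g :: mat_q2 assume g: "g \<in> GL2_q2"
  have "of_nat h.\<epsilon> \<noteq> (0 :: qbar2)" using of_nat_neq_0[OF h.\<epsilon>_pos] .
  hence "scal (of_nat h.\<epsilon>) (scal \<gamma> (tau g) - h.sigma g) = scal \<alpha>' (tau g) - scal (of_nat h.\<epsilon>) (h.sigma g)"
    by (simp only: \<gamma>_def scal_simps nonzero_mult_div_cancel_left times_divide_eq_right simp_thms)
  also have "\<dots> \<in> Zset (vgt (real t))"
    using h.tau_sigma[OF g] unfolding h.\<beta>_def \<alpha>'_def[symmetric] by simp
  finally have "scal (of_nat h.\<epsilon>) (scal \<gamma> (tau g) - h.sigma g) \<in> Zset (vgt (real t))" .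
  from Zgt_cancel[OF this v\<epsilon>] have "scal \<gamma> (tau g) - h.sigma g \<in> Zset (vgt 0)" by simp
  from Zset_uminus[OF vcone_vgt this] have Z: "h.sigma g - scal \<gamma> (tau g) \<in> Zset (vgt 0)" by simp
  have j: "1 < r" using r2 by simp
  have ch: "h.child2 k \<in> L" "q_map r (rf (h.child2 k)) = br (k ** gm 0) 1 + br (k ** gm 1) 1"
    if k: "k \<in> GL2_q2" for k
  proof -
    have l: "b (k ** gm 0) (mon 1) \<in> L" "b (k ** gm 1) (mon 1) \<in> L"
      using k j by (simp_all only: b_mon_L GL2_mult_iff gm_GL2 order.refl simp_thms)
    thus "h.child2 k \<in> L" unfolding h.child2_def by (rule L_add)
    show "q_map r (rf (h.child2 k)) = br (k ** gm 0) 1 + br (k ** gm 1) 1"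
      unfolding h.child2_def by (simp only: rf_add[OF l] q_map_linear q_rf_b_mon j order.refl)
  qed
  have k: "g ** gm 0 \<in> GL2_q2" "g ** gm 1 \<in> GL2_q2" "g ** gm 2 ** kmat 0 1 1 0 \<in> GL2_q2"
    using g by simp_all
  have sL: "h.sigma g \<in> L" unfolding h.sigma_def by (intro L_add ch(1) k)
  have "q_map r (rf (h.sigma g)) = rs.hk (rs.hk (br g 1)) + br g 1"
    unfolding h.sigma_def hk_hk_br_1
    by (simp only: rf_add L_add ch k q_map_linear)
  hence "q_map r (rf (h.sigma g - scal \<gamma> (tau g))) = rs.hk (rs.hk (br g 1)) - scal c (rs.hk (br g 1)) + br g 1"
    using q_tau[OF g]
    by (simp only: rf_diff[OF sL L_scal[OF \<gamma>(1) tau_L[OF g]]] rf_scal[OF \<gamma>(1) tau_L[OF g]] q_map_linear \<gamma>(2))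
      (simp only: algebra_simps)
  thus "\<exists>f\<in>L. f \<in> Zset (vgt 0) \<and> q_map r (rf f) =
      rs.hk (rs.hk (br g 1)) - scal c (rs.hk (br g 1)) + br g 1"
    using L_diff[OF sL L_scal[OF \<gamma>(1) tau_L[OF g]]] Z by blast
next
  fix F F' :: "mat_q2 \<Rightarrow> 'f poly poly" and d g
  show "rs.hk (rs.hk (F + F')) - scal c (rs.hk (F + F')) + (F + F') =
    rs.hk (rs.hk F) - scal c (rs.hk F) + F + (rs.hk (rs.hk F') - scal c (rs.hk F') + F')"
    by (simp only: rs.hk_add scal_simps) (simp only: algebra_simps)
  show "rs.hk (rs.hk (scal d F)) - scal c (rs.hk (scal d F)) + scal d F =
    scal d (rs.hk (rs.hk F) - scal c (rs.hk F) + F)"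
    by (simp only: rs.hk_scal scal_simps mult.commute)
  show "rs.hk (rs.hk (trans g F)) - scal c (rs.hk (trans g F)) + trans g F =
    trans g (rs.hk (rs.hk F) - scal c (rs.hk F) + F)"
    by (simp only: rs.hk_trans trans_simps)
qed

end

theorem theorem3p9:
  fixes v :: "qbar2 \<Rightarrow> ereal"
    and red :: "qbar2 \<Rightarrow> 'f :: field"
    and E :: "qbar2 set"
    and a \<alpha>' :: qbar2
    and k r :: nat
    and \<tau>' t :: ereal
    and T :: "(mat_q2 \<Rightarrow> 'f poly poly) \<Rightarrow> (mat_q2 \<Rightarrow> 'f poly poly)"
  assumes "two_adic_valuation v"
    and "reduction_map v red"
    and "finite_extension_q2 E"
    and "k = r + 2" and "k \<ge> 4"
    and "a \<in> E" and "0 < v a" and "v a < 1"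
    and "\<alpha>' = (a\<^sup>2 - 2 * (of_nat r)\<^sup>2) / (2 * a)"
    and "\<tau>' = v \<alpha>'"
    and "t = v (of_nat r - 1)"
    and "T = hecke (z2_res red) 0"
  shows "(\<tau>' < t \<longrightarrow>
            (\<exists>\<psi>. equivariant_map_to_Theta_bar v red r a (T ` ind_V red 0) \<psi> \<and>
                 (\<forall>F\<in>ind_V red r. \<psi> (q_map r F +o (T ` ind_V red 0)) = P_map v red r a F)))
       \<and> (\<tau>' \<ge> t \<longrightarrow>
            (let c = red (\<alpha>' / (of_nat r - 1));
                 N = (\<lambda>f. T (T f) - scal c (T f) + f) ` ind_V red 0
             in \<exists>\<psi>. equivariant_map_to_Theta_bar v red r a N \<psi> \<and>
                    (\<forall>F\<in>ind_V red r. \<psi> (q_map r F +o N) = P_map v red r a F)))"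
proof -
  obtain \<alpha> where va: "v a = ereal \<alpha>" using assms(7,8) by (cases "v a") auto
  have r2: "2 \<le> r" using assms(4,5) by simp
  interpret slope01 v red r a \<alpha>
    using assms(1,2,7,8) va r2 by unfold_locales (simp_all add: zero_ereal_def one_ereal_def)
  have r1: "of_nat r - 1 = (of_nat (r - 1) :: qbar2)" using r2 by (simp add: of_nat_diff)
  have \<alpha>': "\<alpha>' = (a * a - 2 * of_nat r * of_nat r) / (2 * a)"
    unfolding assms(9) power2_eq_square by (simp only: mult.assoc)
  have T: "T F = rs.hk F" if "F \<in> ind_V red 0" for F
    using that unfolding assms(12) ind_V_def by (rule rs.hecke_eq_hk)
  have hk: "rs.hk F \<in> ind_V red 0" if "F \<in> ind_V red 0" for F
    using that unfolding ind_V_def by (rule rs.hk_cind)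
  have T1: "T ` ind_V red 0 = rs.hk ` ind_V red 0"
    by (intro image_cong refl T)
  have T2: "(\<lambda>f. T (T f) - scal c (T f) + f) ` ind_V red 0 =
      (\<lambda>F. rs.hk (rs.hk F) - scal c (rs.hk F) + F) ` ind_V red 0" for c
    by (intro image_cong refl) (simp only: T hk)
  show ?thesis
    unfolding T1 T2 Let_def assms(10,11) r1 \<alpha>'
    using case_tau_less case_tau_ge[OF _ refl refl] by blast
qed

end
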